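(* Let $n$ be a positive integer. Then for each $A\subseteq\omega$ there is a compact connected abelian Polish group $G_A$ of covering dimension $n$ such that $E(\mathbb{R}^n)<_B E(G_A)<_B E(\mathbb{T}^n)$, and for all $A,B\subseteq\omega$ we have $$A\subseteq^*B\iff E(G_A)\leq_B E(G_B).$$
   Context: $\mathbb{T}$ is the multiplicative group of complex numbers of modulus $1$. For $A,B\subseteq\omega$, $A\subseteq^*B$ means $A\setminus B$ is finite. For a Polish group $G$, $E(G)$ is the equivalence relation on $G^\omega$ given by $x\,E(G)\,y$ iff $(x(n)y(n)^{-1})_n$ converges in $G$. $E\leq_B F$ means there is a Borel map $\theta$ with $x E y\iff \theta(x) F \theta(y)$; $E<_B F$ means $E\leq_B F$ and $F\not\leq_B E$. *)

theory Defs
  imports "HOL-Analysis.Analysis" "HOL-Algebra.Product_Groups"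
begin

record 'a top_monoid = "'a monoid" +
  gtop :: "'a topology"

definition topological_group :: "('a, 'b) top_monoid_scheme \<Rightarrow> bool" where
  "topological_group G \<longleftrightarrow>
     group G \<and> topspace (gtop G) = carrier G \<and>
     continuous_map (prod_topology (gtop G) (gtop G)) (gtop G) (\<lambda>(x, y). x \<otimes>\<^bsub>G\<^esub> y) \<and>
     continuous_map (gtop G) (gtop G) (\<lambda>x. inv\<^bsub>G\<^esub> x)"

definition Polish_space :: "'a topology \<Rightarrow> bool" where
  "Polish_space X \<longleftrightarrow> completely_metrizable_space X \<and> second_countable X"

definition Polish_group :: "('a, 'b) top_monoid_scheme \<Rightarrow> bool" where
  "Polish_group G \<longleftrightarrow> topological_group G \<and> Polish_space (gtop G)"

definition real_line_group :: "real top_monoid" where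
  "real_line_group = \<lparr>carrier = UNIV, monoid.mult = (+), one = 0, gtop = euclideanreal\<rparr>"

definition circle_group :: "complex top_monoid" where
  "circle_group =
     \<lparr>carrier = sphere 0 1, monoid.mult = (*), one = 1, gtop = top_of_set (sphere 0 1)\<rparr>"

definition power_group :: "('a, 'b) top_monoid_scheme \<Rightarrow> nat \<Rightarrow> (nat \<Rightarrow> 'a) top_monoid" where
  "power_group G n =
     monoid.extend (product_group {..<n} (\<lambda>_. G))
       \<lparr>gtop = product_topology (\<lambda>_. gtop G) {..<n}\<rparr>"

text \<open>
  Lebesgue covering dimension: \<open>covering_dim_le X d\<close> says that every open cover has an open
  refinement in which each point lies in at most \<open>d + 1\<close> members. The argument is an integer so
  that the empty space gets dimension \<open>-1\<close>. The property is monotone in \<open>d\<close>, so dimension exactly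
  \<open>d\<close> means that it holds for \<open>d\<close> and fails for \<open>d - 1\<close>.
\<close>

definition covering_dim_le :: "'a topology \<Rightarrow> int \<Rightarrow> bool" where
  "covering_dim_le X d \<longleftrightarrow>
     (\<forall>\<U>. (\<forall>U\<in>\<U>. openin X U) \<and> \<Union>\<U> = topspace X \<longrightarrow>
       (\<exists>\<V>. (\<forall>V\<in>\<V>. openin X V) \<and> \<Union>\<V> = topspace X \<and>
            (\<forall>V\<in>\<V>. \<exists>U\<in>\<U>. V \<subseteq> U) \<and>
            (\<forall>x\<in>topspace X. finite {V \<in> \<V>. x \<in> V} \<and> int (card {V \<in> \<V>. x \<in> V}) \<le> d + 1)))"

definition has_covering_dim :: "'a topology \<Rightarrow> int \<Rightarrow> bool" where
  "has_covering_dim X d \<longleftrightarrow> covering_dim_le X d \<and> \<not> covering_dim_le X (d - 1)"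

definition borel_of :: "'a topology \<Rightarrow> 'a measure" where
  "borel_of X = sigma (topspace X) {U. openin X U}"

definition borel_reducible ::
    "'a topology \<Rightarrow> 'a rel \<Rightarrow> 'b topology \<Rightarrow> 'b rel \<Rightarrow> bool" where
  "borel_reducible X E Y F \<longleftrightarrow>
     (\<exists>\<theta> \<in> borel_of X \<rightarrow>\<^sub>M borel_of Y.
        \<forall>x\<in>topspace X. \<forall>y\<in>topspace X. (x, y) \<in> E \<longleftrightarrow> (\<theta> x, \<theta> y) \<in> F)"

definition seq_space :: "('a, 'b) top_monoid_scheme \<Rightarrow> (nat \<Rightarrow> 'a) topology" where
  "seq_space G = product_topology (\<lambda>_. gtop G) UNIV"

definition conv_rel :: "('a, 'b) top_monoid_scheme \<Rightarrow> (nat \<Rightarrow> 'a) rel" where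
  "conv_rel G =
     {(x, y). x \<in> topspace (seq_space G) \<and> y \<in> topspace (seq_space G) \<and>
        (\<exists>l. limitin (gtop G) (\<lambda>k. x k \<otimes>\<^bsub>G\<^esub> inv\<^bsub>G\<^esub> (y k)) l sequentially)}"

text \<open>\<open>E_le G H\<close> and \<open>E_less G H\<close> are \<open>E(G) \<le>\<^sub>B E(H)\<close> and \<open>E(G) <\<^sub>B E(H)\<close>.\<close>

definition E_le :: "('a, 'b) top_monoid_scheme \<Rightarrow> ('c, 'd) top_monoid_scheme \<Rightarrow> bool" where
  "E_le G H \<longleftrightarrow> borel_reducible (seq_space G) (conv_rel G) (seq_space H) (conv_rel H)"

definition E_less :: "('a, 'b) top_monoid_scheme \<Rightarrow> ('c, 'd) top_monoid_scheme \<Rightarrow> bool" where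
  "E_less G H \<longleftrightarrow> E_le G H \<and> \<not> E_le H G"

definition almost_subset :: "nat set \<Rightarrow> nat set \<Rightarrow> bool"  (infix \<open>\<subseteq>\<^sup>*\<close> 50) where
  "A \<subseteq>\<^sup>* B \<longleftrightarrow> finite (A - B)"

text \<open>
  Every Polish group is isomorphic, as a topological group, to one whose carrier is a subset of
  the type \<open>nat \<Rightarrow> complex\<close> (a set of cardinality continuum), the operation and the topology being
  arbitrary. An existential quantifier over \<open>(nat \<Rightarrow> complex) top_monoid\<close> therefore loses no
  generality.
\<close>

end

theory Submission
  imports Defs "HOL-Computational_Algebra.Primes" "HOL-Library.Infinite_Set"
begin

text \<open>
  For a set \<open>D\<close> of indices of primes let \<open>\<Sigma>\<^sub>D\<close> be the solenoid dual to the group of rationals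
  whose denominators are products of distinct primes \<open>p\<^sub>i\<close>, \<open>i \<in> D\<close>. The groups are the powers
  \<open>\<Sigma>\<^sub>D\<^sup>n\<close>, and the point is that \<open>E(\<Sigma>\<^sub>D\<^sup>n) \<le>\<^sub>B E(\<Sigma>\<^bsub>D'\<^esub>\<^sup>n)\<close> iff \<open>D' \<subseteq>\<^sup>* D\<close>. Since \<open>\<Sigma>\<^sub>\<emptyset>\<close> is the circle
  and \<open>E(\<real>\<^sup>n)\<close> lies below every \<open>E(\<Sigma>\<^sub>D\<^sup>n)\<close>, strictness follows by keeping \<open>D\<close> infinite and coinfinite.

  If \<open>D' \<subseteq>\<^sup>* D\<close>, coordinatewise powers define a homomorphism \<open>S\<close> with totally disconnected kernel. A
  sequence \<open>d\<^sub>k\<close> converges iff \<open>S(d\<^sub>k)\<close> converges and \<open>d\<^sub>k\<^sub>+\<^sub>1 - d\<^sub>k\<close> tends to \<open>0\<close>; the second condition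
  ignores the group structure and is coded by small displacements along a one-parameter subgroup.

  Conversely, write sequences as partial sums of rational increments. By Baire category a Borel
  reduction is continuous near a generic point, and perturbing that point at sparse positions makes
  it additive up to summable errors: there are \<open>c\<^sub>m : \<rat> \<rightarrow> \<T>\<close> such that \<open>\<Prod>c\<^sub>m(a\<^sub>k)/c\<^sub>m(b\<^sub>k)\<close> converges
  whenever \<open>\<Sum>(a\<^sub>k - b\<^sub>k)\<close> converges in \<open>\<Sigma>\<^sub>D\<close>. As the circle has no small subgroups, \<open>c\<^sub>m\<close> must be a
  continuous character, and divisibility of the resulting rational numbers gives \<open>D' \<subseteq>\<^sup>* D\<close>.

  The dimension is bounded above by Ostrand's covers of the torus and below by Kuhn's lemma.
\<close>

subsection \<open>Solenoids\<close>

text \<open>The order is reversed because a larger \<open>D\<close> makes the dual group of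
  rationals larger, and a homomorphism of solenoids is dual to a map from the group of
  \<open>D'\<close> into that of \<open>D\<close>. Denominators are squarefree, so each prime is
  available once; multiplication by a fixed nonzero integer repairs finitely many missing primes and
  no more, which is why inclusion modulo finite sets appears. The obstacle to rigidity is that a
  Borel reduction is no homomorphism and that each term of its output may depend on the whole input.
  Rational increments help twice. With the discrete topology, closeness of two inputs means
  agreement on an initial segment; and changing one increment merely translates the tail, so the
  input stays in its class. The diagonal copy of the rationals in the power already detects which
  primes divide, so one argument serves every \<open>n\<close>.\<close>

definition sprime :: "nat \<Rightarrow> nat" where
  "sprime = enumerate {p. prime p}"

lemma prime_sprime: "prime (sprime i)"
  using enumerate_in_set[OF primes_infinite, of i] by (simp add: sprime_def)

lemma sprime_eq_iff [simp]: "sprime i = sprime j \<longleftrightarrow> i = j"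
  using strict_mono_eq[OF strict_mono_enumerate[OF primes_infinite]] by (simp add: sprime_def)

text \<open>Levels outside \<open>D\<close> carry the exponent 1. Thus level \<open>i\<close> always
  belongs to the \<open>i\<close>-th prime, and different sets \<open>D\<close> can be compared
  level by level.\<close>

definition sfac :: "nat set \<Rightarrow> nat \<Rightarrow> nat" where
  "sfac D i = (if i \<in> D then sprime i else 1)"

definition sden :: "nat set \<Rightarrow> nat \<Rightarrow> nat" where
  "sden D k = (\<Prod>i<k. sfac D i)"

lemma sfac_pos: "sfac D i > 0"
  by (simp add: sfac_def prime_gt_0_nat prime_sprime)

lemma sden_pos: "sden D k > 0"
  by (simp add: sden_def sfac_pos)

lemma sden_0 [simp]: "sden D 0 = 1"
  by (simp add: sden_def)

lemma sden_Suc: "sden D (Suc k) = sfac D k * sden D k"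
  by (simp add: sden_def mult.commute)

lemma sden_dvd: "k \<le> k' \<Longrightarrow> sden D k dvd sden D k'"
  unfolding sden_def by (rule prod_dvd_prod_subset) auto

lemma sprime_dvd_sden: "sprime i dvd sden D k \<longleftrightarrow> i \<in> D \<and> i < k"
proof -
  have "sprime i dvd sden D k \<longleftrightarrow> (\<exists>j<k. sprime i dvd sfac D j)"
    unfolding sden_def by (subst prime_dvd_prod_iff) (auto simp: prime_sprime)
  also have "\<dots> \<longleftrightarrow> i \<in> D \<and> i < k"
  proof -
    have "sprime i dvd sfac D j \<longleftrightarrow> j \<in> D \<and> i = j" for j
      using primes_dvd_imp_eq[OF prime_sprime prime_sprime, of i j] prime_gt_1_nat[OF prime_sprime, of i]
      by (auto simp: sfac_def)
    then show ?thesis by auto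
  qed
  finally show ?thesis .
qed

text \<open>For \<open>j < n\<close>, entry \<open>j + n * k\<close> is the \<open>j\<close>-th coordinate on level \<open>k\<close> of the inverse limit of
  \<open>n\<close>-tori under the power maps with exponents \<open>sfac D k\<close>.\<close>
definition solenoid_set :: "nat \<Rightarrow> nat set \<Rightarrow> (nat \<Rightarrow> complex) set" where
  "solenoid_set n D = {x. \<forall>m. norm (x m) = 1 \<and> x m = x (m + n) ^ sfac D (m div n)}"

definition solenoid :: "nat \<Rightarrow> nat set \<Rightarrow> (nat \<Rightarrow> complex) top_monoid" where
  "solenoid n D = \<lparr>carrier = solenoid_set n D, monoid.mult = (\<lambda>x y m. x m * y m),
     one = (\<lambda>_. 1), gtop = top_of_set (solenoid_set n D)\<rparr>"

lemma solenoid_simps [simp]: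
  "carrier (solenoid n D) = solenoid_set n D"
  "x \<otimes>\<^bsub>solenoid n D\<^esub> y = (\<lambda>m. x m * y m)"
  "\<one>\<^bsub>solenoid n D\<^esub> = (\<lambda>_. 1)"
  "gtop (solenoid n D) = top_of_set (solenoid_set n D)"
  by (simp_all add: solenoid_def)

lemma solenoid_set_norm: "x \<in> solenoid_set n D \<Longrightarrow> norm (x m) = 1"
  unfolding solenoid_set_def by blast

lemma solenoid_set_nonzero: "x \<in> solenoid_set n D \<Longrightarrow> x m \<noteq> 0"
  using solenoid_set_norm[of x n D m] by auto

lemma solenoid_set_step: "x \<in> solenoid_set n D \<Longrightarrow> x m = x (m + n) ^ sfac D (m div n)"
  unfolding solenoid_set_def by blast

lemma solenoid_set_mult:
  "x \<in> solenoid_set n D \<Longrightarrow> y \<in> solenoid_set n D \<Longrightarrow> (\<lambda>m. x m * y m) \<in> solenoid_set n D"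
  unfolding solenoid_set_def mem_Collect_eq by (metis mult_1 norm_mult power_mult_distrib)

lemma solenoid_set_inverse:
  "x \<in> solenoid_set n D \<Longrightarrow> (\<lambda>m. inverse (x m)) \<in> solenoid_set n D"
  unfolding solenoid_set_def mem_Collect_eq by (metis inverse_1 norm_inverse power_inverse)

lemma one_mem_solenoid_set: "(\<lambda>_. 1) \<in> solenoid_set n D"
  by (simp add: solenoid_set_def)

lemma comm_group_solenoid: "comm_group (solenoid n D)"
proof (rule comm_groupI)
  fix x assume "x \<in> carrier (solenoid n D)"
  then show "\<exists>y\<in>carrier (solenoid n D). y \<otimes>\<^bsub>solenoid n D\<^esub> x = \<one>\<^bsub>solenoid n D\<^esub>"
    by (intro bexI[of _ "\<lambda>m. inverse (x m)"])
       (auto simp: solenoid_set_nonzero solenoid_set_inverse)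
qed (auto simp: solenoid_set_mult mult_ac one_mem_solenoid_set)

lemma inv_solenoid:
  assumes "x \<in> solenoid_set n D"
  shows "inv\<^bsub>solenoid n D\<^esub> x = (\<lambda>m. inverse (x m))"
proof -
  interpret comm_group "solenoid n D" by (rule comm_group_solenoid)
  show ?thesis
    using assms by (intro inv_equality) (auto simp: solenoid_set_nonzero solenoid_set_inverse)
qed

lemma closed_solenoid_set: "closed (solenoid_set n D)"
proof -
  have "solenoid_set n D =
      (\<Inter>m. {x. norm (x m) = 1}) \<inter> (\<Inter>m. {x. x m = x (m + n) ^ sfac D (m div n)})"
    unfolding solenoid_set_def by blast
  moreover have "closed {x::nat \<Rightarrow> complex. norm (x m) = 1}" for m
    by (intro closed_Collect_eq continuous_on_norm continuous_on_power continuous_on_const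
          continuous_on_product_coordinates)
  moreover have "closed {x::nat \<Rightarrow> complex. x m = x (m + n) ^ sfac D (m div n)}" for m
    by (intro closed_Collect_eq continuous_on_norm continuous_on_power continuous_on_const
          continuous_on_product_coordinates)
  ultimately show ?thesis by (simp add: closed_INT closed_Int)
qed

lemma compact_torus: "compact {x::'a \<Rightarrow> complex. \<forall>m. norm (x m) = 1}"
proof -
  have "compactin (product_topology (\<lambda>_. euclidean) UNIV)
          (PiE (UNIV::'a set) (\<lambda>_. sphere (0::complex) 1))"
    by (subst compactin_PiE) auto
  moreover have "PiE (UNIV::'a set) (\<lambda>_. sphere (0::complex) 1) = {x. \<forall>m. norm (x m) = 1}"
    by (auto simp: PiE_def Pi_def)
  ultimately show ?thesis
    by (simp add: euclidean_product_topology)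
qed

lemma compact_solenoid_set: "compact (solenoid_set n D)"
proof -
  have "solenoid_set n D = {x. \<forall>m. norm (x m) = 1} \<inter> solenoid_set n D"
    by (auto intro: solenoid_set_norm)
  then show ?thesis
    using compact_Int_closed[OF compact_torus closed_solenoid_set] by metis
qed

lemma topological_group_solenoid: "topological_group (solenoid n D)"
proof -
  have "continuous_map (prod_topology (top_of_set (solenoid_set n D)) (top_of_set (solenoid_set n D)))
      (top_of_set (solenoid_set n D)) (\<lambda>(x, y) m. x m * y m)"
  proof -
    have "continuous_on (solenoid_set n D \<times> solenoid_set n D) (\<lambda>p m. fst p m * snd p m)"
    proof (rule continuous_on_coordinatewise_then_product, rule continuous_on_mult)
      fix m
      show "continuous_on (solenoid_set n D \<times> solenoid_set n D) (\<lambda>p. fst p m)"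
        by (rule continuous_on_product_then_coordinatewise[OF continuous_on_fst[OF continuous_on_id]])
      show "continuous_on (solenoid_set n D \<times> solenoid_set n D) (\<lambda>p. snd p m)"
        by (rule continuous_on_product_then_coordinatewise[OF continuous_on_snd[OF continuous_on_id]])
    qed
    then have "continuous_on (solenoid_set n D \<times> solenoid_set n D) (\<lambda>(x, y) m. x m * y m)"
      by (rule continuous_on_eq) auto
    then show ?thesis
      by (auto simp: solenoid_set_mult)
  qed
  moreover have "continuous_map (top_of_set (solenoid_set n D)) (top_of_set (solenoid_set n D))
      (\<lambda>x. inv\<^bsub>solenoid n D\<^esub> x)"
  proof -
    have "continuous_on (solenoid_set n D) (\<lambda>x m. inverse (x m))"
    proof (rule continuous_on_coordinatewise_then_product, rule continuous_on_inverse)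
      fix m
      show "continuous_on (solenoid_set n D) (\<lambda>x. x m)"
        by (rule continuous_on_product_then_coordinatewise[OF continuous_on_id])
    qed (simp add: solenoid_set_nonzero)
    then have "continuous_on (solenoid_set n D) (\<lambda>x. inv\<^bsub>solenoid n D\<^esub> x)"
      by (rule continuous_on_eq) (simp add: inv_solenoid)
    then show ?thesis
      by (auto simp: inv_solenoid solenoid_set_inverse)
  qed
  ultimately show ?thesis
    using comm_group.axioms(2)[OF comm_group_solenoid]
    by (simp add: topological_group_def)
qed

lemma Polish_group_solenoid: "Polish_group (solenoid n D)"
proof -
  have "completely_metrizable_space (top_of_set (solenoid_set n D))"
    by (rule completely_metrizable_space_closedin[OF completely_metrizable_space_euclidean])
       (simp add: closed_solenoid_set)
  moreover have "second_countable (top_of_set (solenoid_set n D))"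
  proof (intro second_countable_subtopology)
    obtain B :: "(nat \<Rightarrow> complex) set set" where "countable B" "topological_basis B"
      using ex_countable_basis by blast
    then show "second_countable (euclidean :: (nat \<Rightarrow> complex) topology)"
      unfolding second_countable_def
      by (metis open_openin topological_basisE topological_basis_open)
  qed
  ultimately show ?thesis
    by (simp add: Polish_group_def topological_group_solenoid Polish_space_def)
qed

subsection \<open>Convergence in solenoids and one-parameter subgroups\<close>

lemma tendsto_fun_iff:
  fixes f :: "'b \<Rightarrow> 'a \<Rightarrow> 'c::topological_space"
  shows "(f \<longlongrightarrow> l) F \<longleftrightarrow> (\<forall>i. ((\<lambda>c. f c i) \<longlongrightarrow> l i) F)"
proof -
  have "(f \<longlongrightarrow> l) F \<longleftrightarrow> limitin (product_topology (\<lambda>_. euclidean) UNIV) f l F"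
    by (simp add: euclidean_product_topology)
  then show ?thesis
    by (simp add: limitin_componentwise)
qed

section \<open>Borel reducibility and the relation of a solenoid\<close>

lemma space_borel_of [simp]: "space (borel_of X) = topspace X"
  unfolding borel_of_def by (rule space_measure_of) (auto dest: openin_subset)

lemma sets_borel_of: "sets (borel_of X) = sigma_sets (topspace X) {U. openin X U}"
  unfolding borel_of_def by (rule sets_measure_of) (auto dest: openin_subset)

lemma measurable_continuous_map:
  assumes "continuous_map X Y f"
  shows "f \<in> borel_of X \<rightarrow>\<^sub>M borel_of Y"
  unfolding borel_of_def[of Y]
proof (rule measurable_measure_of)
  show "{U. openin Y U} \<subseteq> Pow (topspace Y)" by (auto dest: openin_subset)
  show "f \<in> space (borel_of X) \<rightarrow> topspace Y"
    using assms by (simp add: continuous_map_def Pi_iff)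
  fix U assume "U \<in> {U. openin Y U}"
  then have "openin X {x \<in> topspace X. f x \<in> U}"
    using assms by (simp add: continuous_map_def)
  moreover have "f -` U \<inter> space (borel_of X) = {x \<in> topspace X. f x \<in> U}" by auto
  ultimately show "f -` U \<inter> space (borel_of X) \<in> sets (borel_of X)"
    by (auto simp: sets_borel_of intro!: sigma_sets.Basic)
qed

lemma borel_reducible_trans:
  assumes "borel_reducible X E Y F" "borel_reducible Y F Z K"
  shows "borel_reducible X E Z K"
proof -
  from assms(1) obtain f where f: "f \<in> borel_of X \<rightarrow>\<^sub>M borel_of Y"
    "\<forall>x\<in>topspace X. \<forall>y\<in>topspace X. (x, y) \<in> E \<longleftrightarrow> (f x, f y) \<in> F"
    unfolding borel_reducible_def by blast
  from assms(2) obtain g where g: "g \<in> borel_of Y \<rightarrow>\<^sub>M borel_of Z"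
    "\<forall>x\<in>topspace Y. \<forall>y\<in>topspace Y. (x, y) \<in> F \<longleftrightarrow> (g x, g y) \<in> K"
    unfolding borel_reducible_def by blast
  have "f x \<in> topspace Y" if "x \<in> topspace X" for x
    using measurable_space[OF f(1)] that by simp
  then show ?thesis
    unfolding borel_reducible_def
    by (intro bexI[of _ "g \<circ> f"] measurable_comp[OF f(1) g(1)]) (simp add: f(2) g(2))
qed

lemma borel_reducible_continuous:
  assumes "continuous_map X Y f"
    and "\<And>x y. x \<in> topspace X \<Longrightarrow> y \<in> topspace X \<Longrightarrow> (x, y) \<in> E \<longleftrightarrow> (f x, f y) \<in> F"
  shows "borel_reducible X E Y F"
  unfolding borel_reducible_def using measurable_continuous_map[OF assms(1)] assms(2) by blast

lemma E_le_trans: "E_le G H \<Longrightarrow> E_le H K \<Longrightarrow> E_le G K"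
  unfolding E_le_def by (rule borel_reducible_trans)

lemma seq_space_solenoid:
  "seq_space (solenoid n D) = top_of_set {x. \<forall>l. x l \<in> solenoid_set n D}"
proof -
  have "{x. \<forall>l::nat. x l \<in> solenoid_set n D} = PiE UNIV (\<lambda>_. solenoid_set n D)"
    by (auto simp: PiE_def Pi_def)
  then show ?thesis
    by (simp only: seq_space_def solenoid_simps subtopology_product_topology[symmetric]
          euclidean_product_topology)
qed

lemma topspace_seq_space_solenoid:
  "topspace (seq_space (solenoid n D)) = {x. \<forall>l. x l \<in> solenoid_set n D}"
  by (simp add: seq_space_solenoid)

text \<open>The solenoid is closed in the product, so a coordinatewise limit of quotients
  automatically lies in it.\<close>

lemma conv_rel_solenoid:
  "(x, y) \<in> conv_rel (solenoid n D) \<longleftrightarrow>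
     (\<forall>l. x l \<in> solenoid_set n D) \<and> (\<forall>l. y l \<in> solenoid_set n D) \<and>
     (\<forall>m. convergent (\<lambda>l. x l m / y l m))"
proof (cases "(\<forall>l. x l \<in> solenoid_set n D) \<and> (\<forall>l. y l \<in> solenoid_set n D)")
  case True
  define z where "z = (\<lambda>l m. x l m / y l m)"
  have z: "z l \<in> solenoid_set n D" for l
    unfolding z_def divide_inverse using True by (simp add: solenoid_set_mult solenoid_set_inverse)
  have zeq: "(\<lambda>l. x l \<otimes>\<^bsub>solenoid n D\<^esub> inv\<^bsub>solenoid n D\<^esub> (y l)) = z"
    using True by (auto simp: z_def inv_solenoid divide_inverse)
  have "(x, y) \<in> conv_rel (solenoid n D) \<longleftrightarrow> (\<exists>l\<in>solenoid_set n D. z \<longlonglongrightarrow> l)"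
    unfolding conv_rel_def zeq mem_Collect_eq case_prod_conv topspace_seq_space_solenoid
    using True z by (auto simp: limitin_subtopology)
  also have "\<dots> \<longleftrightarrow> (\<exists>l. z \<longlonglongrightarrow> l)"
    using closed_sequentially[OF closed_solenoid_set, of z] z by blast
  also have "\<dots> \<longleftrightarrow> (\<forall>m. convergent (\<lambda>l. z l m))"
    unfolding tendsto_fun_iff convergent_def by metis
  finally show ?thesis using True by (simp add: z_def)
qed (auto simp: conv_rel_def topspace_seq_space_solenoid)

text \<open>The homomorphism from \<open>\<real>\<^sup>n\<close> dual to the inclusion of the group
  of rationals into the reals in each coordinate. Only \<open>t 0\<close>, ...,
  \<open>t (n - 1)\<close> matter.\<close>

definition wind :: "nat \<Rightarrow> nat set \<Rightarrow> (nat \<Rightarrow> real) \<Rightarrow> nat \<Rightarrow> complex" where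
  "wind n D t m = cis (2 * pi * t (m mod n) / sden D (m div n))"

lemma wind_mem_solenoid_set:
  assumes "n > 0"
  shows "wind n D t \<in> solenoid_set n D"
proof -
  have "wind n D t m = wind n D t (m + n) ^ sfac D (m div n)" for m
  proof -
    define b where "b = 2 * pi * t (m mod n) / real (sden D (Suc (m div n)))"
    have "real (sfac D (m div n)) * b = 2 * pi * t (m mod n) / real (sden D (m div n))"
      using sfac_pos[of D "m div n"] by (simp add: sden_Suc b_def)
    moreover have "wind n D t (m + n) = cis b"
      using assms by (simp add: wind_def b_def)
    ultimately show ?thesis
      by (simp only: Complex.DeMoivre wind_def)
  qed
  moreover have "norm (wind n D t m) = 1" for m
    by (simp add: wind_def)
  ultimately show ?thesis
    unfolding solenoid_set_def by blast
qed

text \<open>Level \<open>K\<close> determines all lower levels, so it is enough to take arguments on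
  level \<open>K\<close> and rescale them by \<open>sden D K\<close>.\<close>

lemma wind_interpolates:
  assumes n: "n > 0" and x: "x \<in> solenoid_set n D"
  obtains t where "\<And>m. m div n \<le> K \<Longrightarrow> wind n D t m = x m"
proof -
  define t where "t j = Arg (x (j + n * K)) * sden D K / (2 * pi)" for j
  have "\<forall>j<n. wind n D t (j + n * k) = x (j + n * k)" if "k \<le> K" for k
    using that
  proof (induction rule: inc_induct)
    case base
    have "cis (Arg (x (j + n * K))) = x (j + n * K)" for j
      using cis_Arg_unique cis_Arg[OF solenoid_set_nonzero[OF x]] solenoid_set_norm[OF x]
      by (simp add: sgn_eq)
    then show ?case
      using sden_pos[of D K] n by (simp add: wind_def t_def)
  next
    case (step k)
    show ?case
    proof (intro allI impI)
      fix j assume j: "j < n"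
      have eq: "(j + n * k) + n = j + n * Suc k" by simp
      show "wind n D t (j + n * k) = x (j + n * k)"
        using solenoid_set_step[OF x, of "j + n * k"] step(3) j
          solenoid_set_step[OF wind_mem_solenoid_set[OF n, of D t], of "j + n * k"]
        unfolding eq by metis
    qed
  qed
  then have "wind n D t m = x m" if "m div n \<le> K" for m
    using that n by (metis mod_less_divisor mod_mult_div_eq)
  then show ?thesis using that by blast
qed

lemma continuous_on_wind: "continuous_on S (wind n D)"
proof (rule continuous_on_coordinatewise_then_product)
  fix m
  have "continuous_on S (\<lambda>t. t (m mod n) :: real)"
    by (rule continuous_on_product_then_coordinatewise[OF continuous_on_id])
  then show "continuous_on S (\<lambda>t. wind n D t m)"
    unfolding wind_def using sden_pos[of D "m div n"] by (intro continuous_intros) auto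
qed

text \<open>Points of the range that match more and more levels converge coordinatewise. This
  density is what makes the solenoid connected.\<close>

lemma closure_range_wind:
  assumes "n > 0"
  shows "closure (range (wind n D)) = solenoid_set n D"
proof
  show "closure (range (wind n D)) \<subseteq> solenoid_set n D"
    using wind_mem_solenoid_set[OF assms]
    by (intro closure_minimal closed_solenoid_set) auto
  show "solenoid_set n D \<subseteq> closure (range (wind n D))"
  proof
    fix x assume x: "x \<in> solenoid_set n D"
    have "\<exists>t. \<forall>m. m div n \<le> K \<longrightarrow> wind n D t m = x m" for K
      using wind_interpolates[OF assms x, of K] by metis
    then obtain t where t: "\<And>K m. m div n \<le> K \<Longrightarrow> wind n D (t K) m = x m" by metis
    have "(\<lambda>K. wind n D (t K)) \<longlonglongrightarrow> x"
      unfolding tendsto_fun_iff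
    proof
      fix m
      have "eventually (\<lambda>K. wind n D (t K) m = x m) sequentially"
        by (rule eventually_mono[OF eventually_ge_at_top[of "m div n"]]) (rule t)
      then show "(\<lambda>K. wind n D (t K) m) \<longlonglongrightarrow> x m"
        by (rule tendsto_eventually)
    qed
    then show "x \<in> closure (range (wind n D))"
      unfolding closure_sequential by (intro exI[of _ "\<lambda>K. wind n D (t K)"]) simp
  qed
qed

lemma connected_UNIV_fun: "connected (UNIV :: ('a \<Rightarrow> real) set)"
proof -
  have "connected_space (euclideanreal)"
    using connected_UNIV[where 'a=real] by (metis connectedin_iff_connected connectedin_topspace topspace_euclidean)
  then have "connected_space (product_topology (\<lambda>_. euclideanreal) (UNIV::'a set))"
    by (simp add: connected_space_product_topology)
  then show ?thesis
    by (metis connectedin_iff_connected connectedin_topspace topspace_euclidean euclidean_product_topology)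
qed

lemma connected_solenoid_set: "n > 0 \<Longrightarrow> connected (solenoid_set n D)"
  using connected_imp_connected_closure[OF connected_continuous_image[OF continuous_on_wind connected_UNIV_fun]]
    closure_range_wind by metis

subsection \<open>Covering dimension\<close>

lemma solenoid_lebesgue_number:
  assumes op: "\<forall>U\<in>\<U>. openin (top_of_set (solenoid_set n D)) U" and cov: "\<Union>\<U> = solenoid_set n D"
  obtains e where "e > 0" "\<forall>x\<in>solenoid_set n D. \<exists>U\<in>\<U>. solenoid_set n D \<inter> ball x e \<subseteq> U"
proof -
  let ?S = "solenoid_set n D"
  define \<G> where "\<G> = {W. open W \<and> ?S \<inter> W \<in> \<U>}"
  have "?S \<subseteq> \<Union>\<G>"
  proof
    fix x assume "x \<in> ?S"
    then obtain U where U: "U \<in> \<U>" "x \<in> U" using cov by blast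
    then obtain W where "open W" "U = ?S \<inter> W" using op by (meson openin_open)
    then show "x \<in> \<Union>\<G>" using U by (auto simp: \<G>_def)
  qed
  then obtain e where e: "e > 0" "\<forall>x\<in>?S. \<exists>G\<in>\<G>. ball x e \<subseteq> G"
    using Heine_Borel_lemma[OF compact_solenoid_set, of n D \<G>] by (metis (no_types, lifting) \<G>_def mem_Collect_eq)
  have "\<exists>U\<in>\<U>. ?S \<inter> ball x e \<subseteq> U" if "x \<in> ?S" for x
  proof -
    obtain G where "G \<in> \<G>" "ball x e \<subseteq> G" using e(2) \<open>x \<in> ?S\<close> by blast
    then show ?thesis unfolding \<G>_def by (intro bexI[of _ "?S \<inter> G"]) auto
  qed
  then show ?thesis using that e(1) by blast
qed

text \<open>The metric on functions is dominated by finitely many coordinates of an enumeration plus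
  a geometric tail; with radius \<open>e / 8\<close> the total is below
  \<open>e / 4 + e / 2\<close>.\<close>

lemma dist_fun_small:
  assumes "(e::real) > 0"
  obtains M r where "r > 0"
    "\<forall>x y :: nat \<Rightarrow> complex. (\<forall>m<M. dist (x m) (y m) \<le> r) \<longrightarrow> dist x y < e"
proof -
  obtain N :: nat where N: "(1/2::real)^N < e / 2" using real_arch_pow_inv[of "e / 2" "1/2"] assms by auto
  define M where "M = Suc (Max (from_nat ` {..N}))"
  have M: "from_nat i < M" if "i \<le> N" for i
    unfolding M_def using that by (simp add: less_Suc_eq_le)
  have "dist x y < e" if xy: "\<forall>m<M. dist (x m) (y m) \<le> e / 8" for x y :: "nat \<Rightarrow> complex"
  proof -
    let ?A = "{dist (x (from_nat i)) (y (from_nat i)) |i. i \<le> N}"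
    have eq: "?A = (\<lambda>i. dist (x (from_nat i)) (y (from_nat i))) ` {..N}" by auto
    have "Max ?A \<le> e / 8" unfolding eq by (rule Max.boundedI) (use xy M in auto)
    then have "dist x y \<le> 2 * (e / 8) + (1/2)^N"
      using dist_fun_le_dist_first_terms[of x y N] by linarith
    then show ?thesis using N assms by simp
  qed
  then show ?thesis using that[of "e / 8" M] assms by simp
qed

text \<open>Going down one level is a power map, which on the unit circle is Lipschitz with its
  exponent as constant. The exponents below level \<open>K\<close> multiply to
  \<open>sden D K\<close>.\<close>

lemma solenoid_level_dist:
  fixes r :: real
  assumes x: "x \<in> solenoid_set n D" and y: "y \<in> solenoid_set n D" and n: "n > 0"
    and close: "\<And>j. j < n \<Longrightarrow> dist (x (j + n * K)) (y (j + n * K)) \<le> r" and m: "m div n \<le> K"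
  shows "dist (x m) (y m) \<le> sden D K * r"
proof -
  have r: "r \<ge> 0" using close[OF n] zero_le_dist order_trans by blast
  have *: "\<forall>j<n. dist (x (j + n * k)) (y (j + n * k)) \<le> sden D K / sden D k * r" if "k \<le> K" for k
    using that
  proof (induction rule: inc_induct)
    case base
    then show ?case using close sden_pos[of D K] by simp
  next
    case (step k)
    show ?case
    proof (intro allI impI)
      fix j assume j: "j < n"
      have eq: "(j + n * k) + n = j + n * Suc k" "(j + n * k) div n = k" using j by simp_all
      have "dist (x (j + n * k)) (y (j + n * k)) =
          norm (x (j + n * Suc k) ^ sfac D k - y (j + n * Suc k) ^ sfac D k)"
        using solenoid_set_step[OF x, of "j + n * k"] solenoid_set_step[OF y, of "j + n * k"]
        unfolding eq dist_norm by simp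
      also have "\<dots> \<le> sfac D k * norm (x (j + n * Suc k) - y (j + n * Suc k))"
        by (rule norm_power_diff) (simp_all add: solenoid_set_norm[OF x] solenoid_set_norm[OF y])
      also have "\<dots> \<le> sfac D k * (sden D K / sden D (Suc k) * r)"
        using step(3) j by (intro mult_left_mono) (auto simp: dist_norm)
      also have "\<dots> = sden D K / sden D k * r"
        using sfac_pos[of D k] by (simp add: sden_Suc)
      finally show "dist (x (j + n * k)) (y (j + n * k)) \<le> sden D K / sden D k * r" .
    qed
  qed
  have "m = m mod n + n * (m div n)" by simp
  then have "dist (x m) (y m) \<le> sden D K / sden D (m div n) * r"
    using *[OF m] n by (metis mod_less_divisor)
  also have "\<dots> \<le> sden D K * r"
  proof (rule mult_right_mono[OF _ r])
    have "real (sden D (m div n)) \<ge> 1" using sden_pos[of D "m div n"] by linarith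
    then show "sden D K / sden D (m div n) \<le> real (sden D K)"
      by (simp add: divide_le_eq mult_le_cancel_left1)
  qed
  finally show ?thesis .
qed

section \<open>Systems of arcs on the circle\<close>

lemma cos_greater_imp:
  assumes "cos x > cos h" "0 \<le> h" "h \<le> pi"
  obtains k :: int where "\<bar>x - 2 * pi * k\<bar> < h"
proof -
  define k where "k = round (x / (2 * pi))"
  define y where "y = x - 2 * pi * k"
  have "\<bar>of_int k - x / (2 * pi)\<bar> \<le> 1/2" unfolding k_def by (rule of_int_round_abs_le)
  then have "\<bar>2 * pi * (of_int k - x / (2 * pi))\<bar> \<le> 2 * pi * (1/2)"
    unfolding abs_mult by (intro mult_mono) auto
  then have y: "\<bar>y\<bar> \<le> pi" unfolding y_def by (simp add: right_diff_distrib abs_minus_commute)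
  have "cos \<bar>y\<bar> = cos x"
  proof -
    have "cos y = cos x" by (simp add: y_def cos_diff)
    then show ?thesis by simp
  qed
  then have "\<not> h \<le> \<bar>y\<bar>" using cos_monotone_0_pi_le[of h "\<bar>y\<bar>"] assms y by auto
  then show ?thesis using that[of k] by (simp add: y_def)
qed

lemma norm_unit_diff:
  assumes "norm z = 1" "norm w = 1"
  shows "(norm (z - w))\<^sup>2 = 2 - 2 * Re (z * cnj w)"
proof -
  have "(Re z)\<^sup>2 + (Im z)\<^sup>2 = 1" "(Re w)\<^sup>2 + (Im w)\<^sup>2 = 1"
    using assms cmod_power2[of z] cmod_power2[of w] by simp_all
  then show ?thesis unfolding cmod_power2 by (simp add: power2_eq_square algebra_simps)
qed

lemma cos_near_imp_norm:
  assumes "norm z = 1" "norm w = 1" "Re (z * cnj w) > cos h"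
  shows "norm (z - w) \<le> \<bar>h\<bar>"
proof -
  have "(norm (z - w))\<^sup>2 \<le> 2 - 2 * cos h" using norm_unit_diff[OF assms(1,2)] assms(3) by simp
  also have "\<dots> = (norm (cis h - 1))\<^sup>2" using norm_unit_diff[of "cis h" 1] by simp
  also have "\<dots> \<le> \<bar>h\<bar>\<^sup>2"
    using dist_exp_i_1[of h] abs_sin_x_le_abs_x[of "h / 2"] by (intro power_mono) (simp_all add: cis_conv_exp)
  finally show ?thesis by (rule power2_le_imp_le) simp
qed

text \<open>The centre of the \<open>a\<close>-th of \<open>N\<close> equal arcs in the
  \<open>i\<close>-th system. Consecutive systems are shifted by the fraction
  \<open>1 / Suc n\<close> of an arc, so systems with different indices up to \<open>n\<close> share
  no endpoint.\<close>

definition arc_centre :: "nat \<Rightarrow> nat \<Rightarrow> nat \<Rightarrow> int \<Rightarrow> real" where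
  "arc_centre n N i a = 2 * pi * (of_int a + 1/2 + i / Suc n) / N"

lemma arc_cover:
  assumes N: "N > 0" and not_int: "N * \<phi> / (2 * pi) - i / Suc n \<notin> \<int>"
  shows "cos (\<phi> - arc_centre n N i \<lfloor>N * \<phi> / (2 * pi) - i / Suc n\<rfloor>) > cos (pi / N)"
proof -
  define r where "r = N * \<phi> / (2 * pi) - i / Suc n"
  define s where "s = r - of_int \<lfloor>r\<rfloor> - 1/2"
  have "of_int \<lfloor>r\<rfloor> \<noteq> r" using not_int unfolding r_def[symmetric] by (metis Ints_of_int)
  then have s: "\<bar>s\<bar> < 1/2" unfolding s_def by linarith
  have "r + i / Suc n = N * \<phi> / (2 * pi)" unfolding r_def by simp
  then have eq: "N * \<phi> = 2 * pi * (r + i / Suc n)" by simp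
  have "\<phi> = N * \<phi> / N" using N by simp
  then have "\<phi> = 2 * pi * (r + i / Suc n) / N" unfolding eq .
  then have "\<phi> - arc_centre n N i \<lfloor>r\<rfloor> = 2 * pi * s / N"
    by (simp add: arc_centre_def s_def diff_divide_distrib[symmetric] right_diff_distrib[symmetric])
  moreover have "cos (pi / N) < cos (\<bar>2 * pi * s / N\<bar>)"
  proof (rule cos_monotone_0_pi)
    show "\<bar>2 * pi * s / N\<bar> < pi / N" using s N by (simp add: abs_mult abs_divide divide_strict_right_mono)
    have "real N \<ge> 1" using N by simp
    then show "pi / N \<le> pi" by (simp add: divide_le_eq)
  qed simp
  ultimately show ?thesis unfolding r_def cos_abs_real by simp
qed

text \<open>Centres in one system differ by integer multiples of \<open>2 * pi / N\<close>, while
  two arcs with a common point have centres less than that apart modulo a full turn. The integers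
  \<open>a\<close> and \<open>b\<close> may differ by a multiple of \<open>N\<close>, hence the
  comparison through \<open>cis\<close>.\<close>

lemma arc_disjoint:
  assumes N: "N > 0"
    and "cos (\<phi> - arc_centre n N i a) > cos (pi / N)" "cos (\<phi> - arc_centre n N i b) > cos (pi / N)"
  shows "cis (arc_centre n N i a) = cis (arc_centre n N i b)"
proof -
  have N1: "real N \<ge> 1" using N by simp
  then have h: "0 \<le> pi / N" "pi / N \<le> pi" by (simp_all add: divide_le_eq)
  obtain k where k: "\<bar>\<phi> - arc_centre n N i a - 2 * pi * of_int k\<bar> < pi / N"
    using cos_greater_imp[OF assms(2) h] by metis
  obtain k' where k': "\<bar>\<phi> - arc_centre n N i b - 2 * pi * of_int k'\<bar> < pi / N"
    using cos_greater_imp[OF assms(3) h] by metis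
  have diff: "arc_centre n N i a - arc_centre n N i b = 2 * pi * (of_int (a - b) / N)"
    by (simp add: arc_centre_def diff_divide_distrib[symmetric] right_diff_distrib[symmetric])
  have "\<bar>(arc_centre n N i a - arc_centre n N i b) - 2 * pi * of_int (k' - k)\<bar> < 2 * (pi / N)"
    using k k' by (simp add: right_diff_distrib)
  moreover have "(arc_centre n N i a - arc_centre n N i b) - 2 * pi * of_int (k' - k) =
      (2 * pi / N) * of_int (a - b - int N * (k' - k))"
    unfolding diff using N by (simp add: field_simps)
  ultimately have "(2 * pi / N) * \<bar>of_int (a - b - int N * (k' - k))\<bar> < (2 * pi / N) * 1"
    using N by (simp add: abs_mult)
  then have "\<bar>of_int (a - b - int N * (k' - k)) :: real\<bar> < 1"
    using N by (subst (asm) mult_less_cancel_left_pos) auto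
  then have "a - b = int N * (k' - k)" by linarith
  then have "arc_centre n N i a = arc_centre n N i b + 2 * pi * of_int (k' - k)"
    using diff N by simp
  then have "cis (arc_centre n N i a) = cis (arc_centre n N i b) * cis (2 * pi * of_int (k' - k))"
    by (simp only: cis_mult)
  moreover have "cis (2 * pi * of_int (k' - k)) = 1" by (rule cis_multiple_2pi) simp
  ultimately show ?thesis by simp
qed

text \<open>Ostrand's covers: for \<open>i = 0, \<dots>, n\<close> the boxes of arcs with index \<open>i\<close> are disjoint, and they
  miss a point only if one of its \<open>n\<close> coordinates is an endpoint of an arc with index \<open>i\<close>; a
  coordinate is an endpoint for at most one \<open>i\<close>.\<close>
lemma covering_dim_le_solenoid:
  assumes n: "n > 0"
  shows "covering_dim_le (top_of_set (solenoid_set n D)) (int n)"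
  unfolding covering_dim_le_def topspace_euclidean_subtopology
proof (intro allI impI, elim conjE)
  let ?S = "solenoid_set n D"
  fix \<U> assume op: "\<forall>U\<in>\<U>. openin (top_of_set ?S) U" and cov: "\<Union>\<U> = ?S"
  obtain e where e: "e > 0" "\<forall>x\<in>?S. \<exists>U\<in>\<U>. ?S \<inter> ball x e \<subseteq> U"
    by (rule solenoid_lebesgue_number[OF op cov])
  obtain M r where r: "r > 0"
      "\<forall>x y :: nat \<Rightarrow> complex. (\<forall>m<M. dist (x m) (y m) \<le> r) \<longrightarrow> dist x y < e"
    by (rule dist_fun_small[OF e(1)])
  \<comment> \<open>An arc has length \<open>2 * pi / N\<close>, and descending from level
    \<open>M\<close> stretches distances by at most \<open>sden D M\<close>; the product has to stay
    below \<open>r\<close>.\<close>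
  obtain N :: nat where N: "2 * pi * sden D M / r < real N" using reals_Archimedean2 by blast
  have "2 * pi * sden D M / r > 0" using r(1) sden_pos[of D M] by simp
  then have N0: "N > 0" using N by (cases N) auto
  define ang where "ang y j = Arg (y (j + n * M))" for y :: "nat \<Rightarrow> complex" and j
  define box where "box i \<alpha> = {y \<in> ?S. \<forall>j<n. Re (y (j + n * M) * cnj (cis (arc_centre n N i (\<alpha> j)))) > cos (pi / N)}"
    for i \<alpha>
  have box_ang: "Re (y (j + n * M) * cnj (cis t)) = cos (ang y j - t)" if "y \<in> ?S" for y j t
  proof -
    have "y (j + n * M) = cis (ang y j)"
      using cis_Arg[OF solenoid_set_nonzero[OF that]] solenoid_set_norm[OF that]
      by (simp add: ang_def sgn_eq)
    then show ?thesis by (simp add: cos_diff)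
  qed
  define \<V> where "\<V> = {box i \<alpha> |i \<alpha>. i \<le> n}"
  have open_box: "openin (top_of_set ?S) (box i \<alpha>)" for i \<alpha>
  proof -
    have "open {y :: nat \<Rightarrow> complex. Re (y (j + n * M) * cnj (cis (arc_centre n N i (\<alpha> j)))) > cos (pi / N)}" for j
      by (intro open_Collect_less continuous_on_const continuous_on_Re continuous_on_mult
          continuous_on_product_coordinates)
    then have "open (\<Inter>j\<in>{..<n}. {y :: nat \<Rightarrow> complex. Re (y (j + n * M) * cnj (cis (arc_centre n N i (\<alpha> j)))) > cos (pi / N)})"
      by (intro open_INT) auto
    moreover have "box i \<alpha> = ?S \<inter> (\<Inter>j\<in>{..<n}. {y. Re (y (j + n * M) * cnj (cis (arc_centre n N i (\<alpha> j)))) > cos (pi / N)})"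
      by (auto simp: box_def)
    ultimately show ?thesis by (simp add: openin_open_Int)
  qed
  have covers: "\<exists>i\<le>n. \<exists>\<alpha>. y \<in> box i \<alpha>" if y: "y \<in> ?S" for y
  proof -
    have "\<exists>i\<le>n. \<forall>j<n. N * ang y j / (2 * pi) - i / Suc n \<notin> \<int>"
    proof (rule ccontr)
      assume "\<not> ?thesis"
      then have "\<forall>i\<in>{..n}. \<exists>j\<in>{..<n}. N * ang y j / (2 * pi) - i / Suc n \<in> \<int>" by auto
      then obtain g where g: "\<forall>i\<in>{..n}. g i \<in> {..<n} \<and> N * ang y (g i) / (2 * pi) - i / Suc n \<in> \<int>"
        by metis
      have "inj_on g {..n}"
      proof (rule inj_onI)
        fix i i' assume i: "i \<in> {..n}" "i' \<in> {..n}" "g i = g i'"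
        have "(N * ang y (g i) / (2 * pi) - i / Suc n) - (N * ang y (g i') / (2 * pi) - i' / Suc n) \<in> \<int>"
          by (rule Ints_diff) (use g i in blast)+
        then have "(real i' - real i) / Suc n \<in> \<int>" using i(3) by (simp add: diff_divide_distrib)
        moreover have "\<bar>(real i' - real i) / Suc n\<bar> < 1" using i by (simp add: abs_divide divide_less_eq)
        ultimately have "(real i' - real i) / Suc n = 0" by (rule Ints_nonzero_abs_less1)
        then show "i = i'" by simp
      qed
      moreover have "g ` {..n} \<subseteq> {..<n}" using g by blast
      ultimately have "card {..n} \<le> card {..<n}" by (rule card_inj_on_le) simp
      then show False by simp
    qed
    then obtain i where i: "i \<le> n" "\<forall>j<n. N * ang y j / (2 * pi) - i / Suc n \<notin> \<int>" by blast
    have "y \<in> box i (\<lambda>j. \<lfloor>N * ang y j / (2 * pi) - i / Suc n\<rfloor>)"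
      unfolding box_def mem_Collect_eq box_ang[OF y] using y i(2) arc_cover[OF N0] by blast
    then show ?thesis using i(1) by blast
  qed
  have small: "\<exists>U\<in>\<U>. box i \<alpha> \<subseteq> U" for i \<alpha>
  proof (cases "box i \<alpha> = {}")
    case True
    have "?S \<noteq> {}" using one_mem_solenoid_set by blast
    then have "\<U> \<noteq> {}" using cov by blast
    then show ?thesis using True by blast
  next
    case False
    then obtain z where z: "z \<in> box i \<alpha>" by blast
    then have zS: "z \<in> ?S" by (simp add: box_def)
    have "box i \<alpha> \<subseteq> ?S \<inter> ball z e"
    proof
      fix y assume y: "y \<in> box i \<alpha>"
      then have yS: "y \<in> ?S" by (simp add: box_def)
      have "dist (z (j + n * M)) (y (j + n * M)) \<le> 2 * pi / N" if j: "j < n" for j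
      proof -
        let ?c = "cis (arc_centre n N i (\<alpha> j))"
        have "norm (z (j + n * M) - ?c) \<le> \<bar>pi / N\<bar>"
          using z j by (intro cos_near_imp_norm solenoid_set_norm[OF zS]) (simp_all add: box_def)
        moreover have "norm (y (j + n * M) - ?c) \<le> \<bar>pi / N\<bar>"
          using y j by (intro cos_near_imp_norm solenoid_set_norm[OF yS]) (simp_all add: box_def)
        ultimately show ?thesis
          using dist_triangle2[of "z (j + n * M)" "y (j + n * M)" ?c] by (simp add: dist_norm)
      qed
      then have "dist (z m) (y m) \<le> sden D M * (2 * pi / N)" if "m div n \<le> M" for m
        using solenoid_level_dist[OF zS yS n] that by blast
      moreover have "sden D M * (2 * pi / N) \<le> r"
        using N N0 r(1) by (simp add: field_simps)
      moreover have "m div n \<le> M" if "m < M" for m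
        using that by (meson div_le_dividend less_imp_le order_trans)
      ultimately have "\<forall>m<M. dist (z m) (y m) \<le> r" by (meson order_trans)
      then have "dist z y < e" using r(2) by blast
      then show "y \<in> ?S \<inter> ball z e" using yS by simp
    qed
    then show ?thesis using e(2) zS by (meson order_trans)
  qed
  have same: "box i \<alpha> = box i \<beta>" if "y \<in> box i \<alpha>" "y \<in> box i \<beta>" for y i \<alpha> \<beta>
  proof -
    have yS: "y \<in> ?S" using that by (simp add: box_def)
    have "cis (arc_centre n N i (\<alpha> j)) = cis (arc_centre n N i (\<beta> j))" if j: "j < n" for j
    proof (rule arc_disjoint[OF N0])
      show "cos (ang y j - arc_centre n N i (\<alpha> j)) > cos (pi / N)"
        using \<open>y \<in> box i \<alpha>\<close> j unfolding box_ang[OF yS, symmetric] box_def by blast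
      show "cos (ang y j - arc_centre n N i (\<beta> j)) > cos (pi / N)"
        using \<open>y \<in> box i \<beta>\<close> j unfolding box_ang[OF yS, symmetric] box_def by blast
    qed
    then show ?thesis unfolding box_def by auto
  qed
  have mult: "finite {V \<in> \<V>. y \<in> V} \<and> int (card {V \<in> \<V>. y \<in> V}) \<le> int n + 1" for y
  proof -
    \<comment> \<open>Boxes of one system through \<open>y\<close> coincide, so one choice per
      system lists every member through \<open>y\<close>. Where no such box exists the choice is
      arbitrary, which an upper bound tolerates.\<close>
    define F where "F i = (SOME V. \<exists>\<alpha>. V = box i \<alpha> \<and> y \<in> V)" for i
    have sub: "{V \<in> \<V>. y \<in> V} \<subseteq> F ` {..n}"
    proof
      fix V assume "V \<in> {V \<in> \<V>. y \<in> V}"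
      then obtain i \<alpha> where V: "V = box i \<alpha>" "i \<le> n" "y \<in> V" by (auto simp: \<V>_def)
      have "\<exists>\<beta>. F i = box i \<beta> \<and> y \<in> F i"
        unfolding F_def by (rule someI[of "\<lambda>V. \<exists>\<alpha>. V = box i \<alpha> \<and> y \<in> V" V]) (use V in blast)
      then have "V = F i" using V same by metis
      then show "V \<in> F ` {..n}" using V(2) by blast
    qed
    have "card {V \<in> \<V>. y \<in> V} \<le> card (F ` {..n})" by (rule card_mono[OF _ sub]) simp
    also have "\<dots> \<le> Suc n" using card_image_le[of "{..n}" F] by simp
    finally show ?thesis using finite_subset[OF sub] by simp
  qed
  have "\<Union>\<V> = ?S"
  proof
    show "\<Union>\<V> \<subseteq> ?S" by (auto simp: \<V>_def box_def)
    show "?S \<subseteq> \<Union>\<V>" using covers unfolding \<V>_def by blast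
  qed
  moreover have "\<forall>V\<in>\<V>. openin (top_of_set ?S) V" using open_box by (auto simp: \<V>_def)
  moreover have "\<forall>V\<in>\<V>. \<exists>U\<in>\<U>. V \<subseteq> U" using small by (auto simp: \<V>_def)
  ultimately show "\<exists>\<V>. (\<forall>V\<in>\<V>. openin (top_of_set ?S) V) \<and> \<Union>\<V> = ?S \<and> (\<forall>V\<in>\<V>. \<exists>U\<in>\<U>. V \<subseteq> U) \<and>
      (\<forall>x\<in>?S. finite {V \<in> \<V>. x \<in> V} \<and> int (card {V \<in> \<V>. x \<in> V}) \<le> int n + 1)"
    using mult by (intro exI[of _ \<V>]) blast
qed

text \<open>Each member of a fine cover misses one of any two opposite faces of the cube \<open>wind n D\<close>, hence
  carries a Kuhn label; a fully labelled small simplex yields \<open>n + 1\<close> members with a common point.\<close>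
lemma not_covering_dim_le_solenoid:
  assumes n: "n > 0"
  shows "\<not> covering_dim_le (top_of_set (solenoid_set n D)) (int n - 1)"
proof
  let ?S = "solenoid_set n D"
  assume dim: "covering_dim_le (top_of_set ?S) (int n - 1)"
  \<comment> \<open>In the cube of parameters between 0 and 1/2, the faces where \<open>t j\<close>
    is 0 or 1/2 are sent to coordinate 1 or -1 on level 0. A cell misses one of the two values in
    every coordinate.\<close>
  define cell where "cell s = {y \<in> ?S. \<forall>j<n. if j \<in> s then y j \<noteq> 1 else y j \<noteq> - 1}" for s
  have open_cell: "openin (top_of_set ?S) (cell s)" for s
  proof -
    have "open {y :: nat \<Rightarrow> complex. y j \<noteq> (if j \<in> s then 1 else - 1)}" for j
      by (intro open_Collect_neq continuous_on_const continuous_on_product_coordinates)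
    then have "open (\<Inter>j\<in>{..<n}. {y :: nat \<Rightarrow> complex. y j \<noteq> (if j \<in> s then 1 else - 1)})"
      by (intro open_INT) auto
    moreover have "cell s = ?S \<inter> (\<Inter>j\<in>{..<n}. {y. y j \<noteq> (if j \<in> s then 1 else - 1)})"
      by (auto simp: cell_def split: if_splits)
    ultimately show ?thesis by (simp add: openin_open_Int)
  qed
  have "\<Union>(range cell) = ?S"
  proof
    show "?S \<subseteq> \<Union>(range cell)"
    proof
      fix y assume "y \<in> ?S"
      then have "y \<in> cell {j. y j \<noteq> 1}" by (auto simp: cell_def)
      then show "y \<in> \<Union>(range cell)" by blast
    qed
  qed (auto simp: cell_def)
  with dim open_cell have "\<exists>\<V>. (\<forall>V\<in>\<V>. openin (top_of_set ?S) V) \<and> \<Union>\<V> = ?S \<and>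
      (\<forall>V\<in>\<V>. \<exists>U\<in>range cell. V \<subseteq> U) \<and>
      (\<forall>x\<in>?S. finite {V \<in> \<V>. x \<in> V} \<and> int (card {V \<in> \<V>. x \<in> V}) \<le> (int n - 1) + 1)"
    unfolding covering_dim_le_def topspace_euclidean_subtopology by (elim allE[of _ "range cell"]) auto
  then obtain \<V> where \<V>: "\<forall>V\<in>\<V>. openin (top_of_set ?S) V" "\<Union>\<V> = ?S"
      "\<forall>V\<in>\<V>. \<exists>U\<in>range cell. V \<subseteq> U"
      "\<forall>x\<in>?S. finite {V \<in> \<V>. x \<in> V} \<and> int (card {V \<in> \<V>. x \<in> V}) \<le> (int n - 1) + 1"
    by (elim exE conjE)
  obtain e where e: "e > 0" "\<forall>x\<in>?S. \<exists>V\<in>\<V>. ?S \<inter> ball x e \<subseteq> V"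
    by (rule solenoid_lebesgue_number[OF \<V>(1,2)])
  obtain M r where r: "r > 0"
      "\<forall>x y :: nat \<Rightarrow> complex. (\<forall>m<M. dist (x m) (y m) \<le> r) \<longrightarrow> dist x y < e"
    by (rule dist_fun_small[OF e(1)])
  \<comment> \<open>Grid points of mesh \<open>1 / (2 * p)\<close> fill a cube of side 1/2; one grid
    step turns any coordinate by at most \<open>pi / p\<close>, which is below
    \<open>r\<close>.\<close>
  obtain p :: nat where p: "pi / r < real p" using reals_Archimedean2 by blast
  have "pi / r > 0" using r(1) by simp
  then have p0: "p > 0" using p by (cases p) auto
  define G where "G x = wind n D (\<lambda>j. real (x j) / (2 * p))" for x :: "nat \<Rightarrow> nat"
  have GS: "G x \<in> ?S" for x unfolding G_def by (rule wind_mem_solenoid_set[OF n])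
  have G_close: "dist (G x) (G b) < e" if xb: "\<And>j. b j \<le> x j \<and> x j \<le> Suc (b j)" for x b
  proof -
    have "dist (G x m) (G b m) \<le> r" for m
    proof -
      let ?a = "2 * pi * (real (x (m mod n)) / (2 * p)) / sden D (m div n)"
      let ?b = "2 * pi * (real (b (m mod n)) / (2 * p)) / sden D (m div n)"
      have "cis ?a - cis ?b = cis ?b * (cis (?a - ?b) - 1)" by (simp add: algebra_simps cis_mult)
      then have "dist (G x m) (G b m) = norm (cis (?a - ?b) - 1)"
        by (simp only: G_def wind_def dist_norm) (simp add: norm_mult)
      also have "\<dots> \<le> \<bar>?a - ?b\<bar>"
        using dist_exp_i_1[of "?a - ?b"] abs_sin_x_le_abs_x[of "(?a - ?b) / 2"] by (simp add: cis_conv_exp)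
      also have "?a - ?b = pi * (real (x (m mod n)) - real (b (m mod n))) / (p * sden D (m div n))"
        using p0 sden_pos[of D "m div n"] by (simp add: field_simps)
      also have "\<bar>\<dots>\<bar> \<le> pi * 1 / (p * 1)"
      proof -
        have "\<bar>real (x (m mod n)) - real (b (m mod n))\<bar> \<le> 1" using xb[of "m mod n"] by linarith
        moreover have "real (sden D (m div n)) \<ge> 1" using sden_pos[of D "m div n"] by linarith
        ultimately show ?thesis
          unfolding abs_divide abs_mult using p0 by (intro frac_le mult_mono) auto
      qed
      also have "\<dots> \<le> r" using p r(1) p0 by (simp add: field_simps)
      finally show ?thesis .
    qed
    then show ?thesis using r(2) by blast
  qed
  define W where "W x = (SOME V. V \<in> \<V> \<and> ?S \<inter> ball (G x) e \<subseteq> V)" for x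
  have W: "W x \<in> \<V>" "?S \<inter> ball (G x) e \<subseteq> W x" for x
  proof -
    have "\<exists>V. V \<in> \<V> \<and> ?S \<inter> ball (G x) e \<subseteq> V" using e(2) GS by blast
    then have "W x \<in> \<V> \<and> ?S \<inter> ball (G x) e \<subseteq> W x" unfolding W_def by (rule someI_ex)
    then show "W x \<in> \<V>" "?S \<inter> ball (G x) e \<subseteq> W x" by blast+
  qed
  have GW: "G x \<in> W x" for x using W(2)[of x] GS[of x] e(1) by auto
  \<comment> \<open>The label is attached to the member of the cover and not to the point. Hence
    \<open>n + 1\<close> different reduced labels on a simplex come from \<open>n + 1\<close>
    different members.\<close>
  define lab where "lab V j = (if \<exists>y\<in>V. y j = 1 then 0 else 1 :: nat)" for V :: "(nat \<Rightarrow> complex) set" and j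
  have "odd (card {s. ksimplex p n s \<and> (reduced n \<circ> (\<lambda>x. lab (W x))) ` s = {..n}})"
  proof (rule kuhn_combinatorial[OF p0]; intro allI impI; elim conjE)
    fix x :: "nat \<Rightarrow> nat" and j assume j: "j < n" "x j = 0"
    then have "G x j = 1" by (simp add: G_def wind_def)
    then show "lab (W x) j = 0" using GW[of x] by (auto simp: lab_def)
  next
    fix x :: "nat \<Rightarrow> nat" and j assume j: "j < n" "x j = p"
    then have G1: "G x j = - 1" using p0 by (simp add: G_def wind_def)
    obtain s where "W x \<subseteq> cell s" using \<V>(3) W(1)[of x] by blast
    then have "j \<in> s" and "\<forall>y\<in>W x. y j \<noteq> 1"
      using G1 GW[of x] j(1) unfolding cell_def by (auto split: if_splits) 
    then show "lab (W x) j = 1" by (simp add: lab_def)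
  qed
  then have "{s. ksimplex p n s \<and> (reduced n \<circ> (\<lambda>x. lab (W x))) ` s = {..n}} \<noteq> {}"
    by (rule odd_card_imp_not_empty)
  then obtain s b u where ks: "kuhn_simplex p n b u s" and lab_s: "(reduced n \<circ> (\<lambda>x. lab (W x))) ` s = {..n}"
    by (auto elim: ksimplex.cases)
  have s_eq: "s = (\<lambda>i j. if j \<in> u ` {..<i} then Suc (b j) else b j) ` {..n}"
    using ks by (simp add: kuhn_simplex_def)
  have near: "b j \<le> v j \<and> v j \<le> Suc (b j)" if "v \<in> s" for v j
    using that unfolding s_eq by auto
  have sub: "W ` s \<subseteq> {V \<in> \<V>. G b \<in> V}"
  proof
    fix V assume "V \<in> W ` s"
    then obtain v where v: "v \<in> s" "V = W v" by blast
    have "G b \<in> ?S \<inter> ball (G v) e" using G_close[of b v] near[OF v(1)] GS by simp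
    then show "V \<in> {V \<in> \<V>. G b \<in> V}" using W v(2) by blast
  qed
  have "(reduced n \<circ> lab) ` (W ` s) = {..n}" using lab_s by (simp add: image_comp comp_def)
  moreover have fin: "finite (W ` s)" unfolding s_eq by simp
  ultimately have "Suc n \<le> card (W ` s)"
    using card_image_le[OF fin, of "reduced n \<circ> lab"] by simp
  also have "\<dots> \<le> card {V \<in> \<V>. G b \<in> V}" using \<V>(4) GS by (intro card_mono sub) blast
  also have "int \<dots> \<le> int n" using \<V>(4) GS[of b] by force
  finally show False by simp
qed

lemma has_covering_dim_solenoid:
  "n > 0 \<Longrightarrow> has_covering_dim (top_of_set (solenoid_set n D)) (int n)"
  by (simp add: has_covering_dim_def covering_dim_le_solenoid not_covering_dim_le_solenoid)

subsection \<open>Characters from convergent products\<close>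

text \<open>Convergence and convergence to \<open>0\<close> for the topology that the rationals inherit from the
  one-parameter subgroup \<open>wind 1 D\<close>.\<close>
definition tconv :: "nat set \<Rightarrow> (nat \<Rightarrow> rat) \<Rightarrow> bool" where
  "tconv D s \<longleftrightarrow> (\<forall>k. convergent (\<lambda>i. cis (2 * pi * of_rat (s i) / sden D k)))"

definition tnull :: "nat set \<Rightarrow> (nat \<Rightarrow> rat) \<Rightarrow> bool" where
  "tnull D s \<longleftrightarrow> (\<forall>k. (\<lambda>i. cis (2 * pi * of_rat (s i) / sden D k)) \<longlonglongrightarrow> 1)"

lemma tendsto_interleave:
  fixes f :: "nat \<Rightarrow> 'a::topological_space"
  assumes "(\<lambda>i. f (2 * i)) \<longlonglongrightarrow> l" "(\<lambda>i. f (2 * i + 1)) \<longlonglongrightarrow> l"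
  shows "f \<longlonglongrightarrow> l"
proof (rule topological_tendstoI)
  fix S assume "open S" "l \<in> S"
  obtain N1 where N1: "\<And>i. i \<ge> N1 \<Longrightarrow> f (2 * i) \<in> S"
    using topological_tendstoD[OF assms(1) \<open>open S\<close> \<open>l \<in> S\<close>] unfolding eventually_sequentially by blast
  obtain N2 where N2: "\<And>i. i \<ge> N2 \<Longrightarrow> f (2 * i + 1) \<in> S"
    using topological_tendstoD[OF assms(2) \<open>open S\<close> \<open>l \<in> S\<close>] unfolding eventually_sequentially by blast
  have "f i \<in> S" if "i \<ge> 2 * N1 + 2 * N2" for i
  proof (cases "even i")
    case True
    then show ?thesis using N1[of "i div 2"] that by auto
  next
    case False
    then have "i = 2 * (i div 2) + 1" by presburger
    moreover have "N2 \<le> i div 2" using that by linarith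
    ultimately show ?thesis using N2 by metis
  qed
  then show "eventually (\<lambda>i. f i \<in> S) sequentially"
    unfolding eventually_sequentially by blast
qed

text \<open>The circle has no small subgroups. As long as \<open>z\<close> stays within distance 1
  of 1, the parallelogram law gives \<open>norm (z + 1) \<ge> 3/2\<close>, so squaring expands the
  distance to 1 by that factor.\<close>

lemma unit_power_far:
  fixes w :: complex
  assumes "norm w = 1" "w \<noteq> 1"
  obtains N where "norm (w ^ N - 1) \<ge> 1" "N > 0"
proof -
  have "\<exists>N>0. norm (w ^ N - 1) \<ge> 1"
  proof (rule ccontr)
    assume "\<not> ?thesis"
    then have small: "norm (w ^ N - 1) < 1" if "N > 0" for N
      using that by (meson not_le)
    have grow: "norm (w ^ (2 ^ k) - 1) \<ge> (3/2) ^ k * norm (w - 1)" for k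
    proof (induction k)
      case (Suc k)
      define z where "z = w ^ (2 ^ k)"
      have "norm z = 1" using assms by (simp add: z_def norm_power)
      then have z1: "(Re z)\<^sup>2 + (Im z)\<^sup>2 = 1" using cmod_power2[of z] by simp
      have "(norm (z + 1))\<^sup>2 + (norm (z - 1))\<^sup>2 = 2 * ((Re z)\<^sup>2 + (Im z)\<^sup>2) + 2"
        unfolding cmod_power2 by (simp add: power2_eq_square algebra_simps)
      moreover have "(norm (z - 1))\<^sup>2 < 1"
        using small[of "2 ^ k"] power_less_one_iff[of "norm (z - 1)" 2] by (simp add: z_def)
      ultimately have "(norm (z + 1))\<^sup>2 \<ge> (3/2)\<^sup>2"
        unfolding z1 by (simp add: power2_eq_square)
      then have "norm (z + 1) \<ge> 3/2"
        using power2_le_imp_le norm_ge_zero by blast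
      then have "(3/2) * ((3/2) ^ k * norm (w - 1)) \<le> norm (z + 1) * norm (z - 1)"
        using Suc by (intro mult_mono) (auto simp: z_def)
      also have "\<dots> = norm (z * z - 1)"
        unfolding norm_mult[symmetric] by (simp add: algebra_simps)
      also have "z * z = w ^ (2 ^ Suc k)"
        by (simp add: z_def mult_2 power_add)
      finally show ?case by simp
    qed simp
    have pos: "norm (w - 1) > 0" using assms by simp
    obtain k where "(3/2::real) ^ k > 1 / norm (w - 1)"
      using real_arch_pow[of "3/2::real" "1 / norm (w - 1)"] by auto
    then have "(3/2::real) ^ k * norm (w - 1) > 1"
      using pos by (simp add: field_simps)
    then show False using grow[of k] small[of "2 ^ k"] by simp
  qed
  then show ?thesis using that by blast
qed

lemma norm_cis_minus_1: "norm (cis t - 1) \<le> \<bar>t\<bar>"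
  using dist_exp_i_1[of t] abs_sin_x_le_abs_x[of "t / 2"] by (simp add: cis_conv_exp)

lemma Arg_near: "norm (z - 1) < 1 \<Longrightarrow> \<bar>Arg z\<bar> < pi / 2"
proof -
  assume "norm (z - 1) < 1"
  then have "Re z > 0"
    using abs_Re_le_cmod[of "z - 1"] by auto
  then show ?thesis using Arg_Re_pos by blast
qed

lemma tnull_compose:
  assumes "tnull D e" "filterlim \<kappa> sequentially sequentially"
  shows "tnull D (\<lambda>i. e (\<kappa> i))"
  unfolding tnull_def
proof
  fix k
  show "(\<lambda>i. cis (2 * pi * of_rat (e (\<kappa> i)) / sden D k)) \<longlonglongrightarrow> 1"
    using filterlim_compose[OF _ assms(2), of "\<lambda>i. cis (2 * pi * of_rat (e i) / sden D k)"] assms(1)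
    unfolding tnull_def by blast
qed

text \<open>The abstract form of what a reduction yields. Additivity and continuity of
  \<open>c\<close> are not part of the data; both are consequences of
  \<open>prod_conv\<close>.\<close>

locale sum_product_map =
  fixes D :: "nat set" and c :: "rat \<Rightarrow> complex"
  assumes norm_c: "norm (c t) = 1"
    and c_0: "c 0 = 1"
    and prod_conv: "tconv D (\<lambda>i. \<Sum>p<i. a p - b p) \<Longrightarrow>
      convergent (\<lambda>i. \<Prod>p<i. c (a p) / c (b p))"
begin

lemma c_nonzero: "c a \<noteq> 0"
  using norm_c[of a] by auto

text \<open>The sequence \<open>a 0 + e 0, 0, a 1 + e 1, 0, ...\<close> is compared with
  \<open>a 0, e 0, a 1, e 1, ...\<close>. The partial sums of the differences alternate between
  \<open>e i\<close> and 0, so they converge. Even products give the first claim, the ratio of odd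
  to even ones the second.\<close>

lemma shift_conv:
  assumes e: "tnull D e"
  shows "convergent (\<lambda>i. \<Prod>p<i. c (a p + e p) / (c (a p) * c (e p)))"
    and "(\<lambda>i. c (a i + e i) / c (a i)) \<longlonglongrightarrow> 1"
proof -
  define u where "u p = (if even p then a (p div 2) + e (p div 2) else 0)" for p
  define v where "v p = (if even p then a (p div 2) else e (p div 2))" for p
  have sums: "(\<Sum>p<2 * i. u p - v p) = 0 \<and> (\<Sum>p<2 * i + 1. u p - v p) = e i" for i
    by (induction i) (simp_all add: u_def v_def)
  have "tconv D (\<lambda>i. \<Sum>p<i. u p - v p)"
    unfolding tconv_def
  proof
    fix k
    have "(\<lambda>i. cis (2 * pi * of_rat (\<Sum>p<i. u p - v p) / sden D k)) \<longlonglongrightarrow> 1"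
    proof (rule tendsto_interleave)
      show "(\<lambda>i. cis (2 * pi * of_rat (\<Sum>p<2 * i. u p - v p) / sden D k)) \<longlonglongrightarrow> 1"
        unfolding sums[THEN conjunct1] by simp
      show "(\<lambda>i. cis (2 * pi * of_rat (\<Sum>p<2 * i + 1. u p - v p) / sden D k)) \<longlonglongrightarrow> 1"
        unfolding sums[THEN conjunct2] using e unfolding tnull_def by blast
    qed
    then show "convergent (\<lambda>i. cis (2 * pi * of_rat (\<Sum>p<i. u p - v p) / sden D k))"
      by (rule convergentI)
  qed
  then obtain L where L: "(\<lambda>i. \<Prod>p<i. c (u p) / c (v p)) \<longlonglongrightarrow> L"
    using prod_conv unfolding convergent_def by blast
  let ?w = "\<lambda>p. c (a p + e p) / (c (a p) * c (e p))"
  have prods: "(\<Prod>p<2 * i. c (u p) / c (v p)) = (\<Prod>p<i. ?w p)" for i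
    by (induction i) (simp_all add: u_def v_def c_0)
  have prods': "(\<Prod>p<2 * i + 1. c (u p) / c (v p)) = (\<Prod>p<i. ?w p) * (c (a i + e i) / c (a i))" for i
    using prods[of i] by (simp add: u_def v_def)
  have L1: "(\<lambda>i. \<Prod>p<i. ?w p) \<longlonglongrightarrow> L"
    using LIMSEQ_subseq_LIMSEQ[OF L, of "\<lambda>i. 2 * i"] by (simp add: strict_mono_def o_def prods)
  then show "convergent (\<lambda>i. \<Prod>p<i. ?w p)" by (rule convergentI)
  have L2: "(\<lambda>i. (\<Prod>p<i. ?w p) * (c (a i + e i) / c (a i))) \<longlonglongrightarrow> L"
    using LIMSEQ_subseq_LIMSEQ[OF L, of "\<lambda>i. 2 * i + 1"]
    unfolding o_def prods' by (simp add: strict_mono_def)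
  have "norm (\<Prod>p<i. ?w p) = 1" for i
    by (simp add: prod_norm[symmetric] norm_divide norm_mult norm_c)
  moreover from this have "norm L = 1"
    using tendsto_norm[OF L1] by (simp add: LIMSEQ_const_iff)
  ultimately have nz: "(\<Prod>p<i. ?w p) \<noteq> 0" "L \<noteq> 0" for i
    by (metis norm_zero zero_neq_one)+
  have "(\<lambda>i. (\<Prod>p<i. ?w p) * (c (a i + e i) / c (a i)) / (\<Prod>p<i. ?w p)) \<longlonglongrightarrow> L / L"
    using nz by (intro tendsto_divide L1 L2)
  then show "(\<lambda>i. c (a i + e i) / c (a i)) \<longlonglongrightarrow> 1"
    using nz by simp
qed

lemma c_tnull: "tnull D e \<Longrightarrow> (\<lambda>i. c (e i)) \<longlonglongrightarrow> 1"
  using shift_conv(2)[of e "\<lambda>_. 0"] by (simp add: c_0)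

text \<open>If \<open>w \<noteq> 1\<close>, some power of \<open>w\<close> is far from \<open>1\<close>; repeating each pair \<open>(a p, e p)\<close> that many
  times contradicts the convergence of the product.\<close>
lemma shift_exact_frequently:
  assumes e: "tnull D e"
  shows "\<exists>p. c (a p + e p) = c (a p) * c (e p)"
proof (rule ccontr)
  assume neg: "\<not> ?thesis"
  define w where "w p = c (a p + e p) / (c (a p) * c (e p))" for p
  have w: "norm (w p) = 1" "w p \<noteq> 1" for p
    using neg c_nonzero by (auto simp: w_def norm_divide norm_mult norm_c field_simps)
  have "\<exists>N. norm (w p ^ N - 1) \<ge> 1 \<and> N > 0" for p
    using unit_power_far[OF w[of p]] by metis
  then obtain N where N: "\<And>p. norm (w p ^ N p - 1) \<ge> 1" "\<And>p. N p > 0" by metis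
  \<comment> \<open>Block \<open>k\<close> consists of the \<open>N k\<close> positions from
    \<open>M k\<close> on, and \<open>\<kappa>\<close> sends a position to its block.\<close>
  define M where "M k = (\<Sum>i<k. N i)" for k
  have M_Suc: "M (Suc k) = M k + N k" for k by (simp add: M_def)
  have M_mono: "strict_mono M"
    using N(2) by (simp add: strict_mono_Suc_iff M_Suc)
  define \<kappa> where "\<kappa> p = (LEAST k. p < M (Suc k))" for p
  have \<kappa>: "\<kappa> p = k" if "M k \<le> p" "p < M (Suc k)" for p k
    unfolding \<kappa>_def
  proof (rule Least_equality)
    fix j assume "p < M (Suc j)"
    then have "M k < M (Suc j)" using that by linarith
    then show "k \<le> j" using M_mono by (simp add: strict_mono_less)
  qed (rule that)
  have "\<kappa> p \<ge> k" if "p \<ge> M k" for p k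
  proof -
    have "p < M (Suc p)" using strict_mono_imp_increasing[OF M_mono, of "Suc p"] by simp
    then have "p < M (Suc (\<kappa> p))" unfolding \<kappa>_def by (rule LeastI)
    then have "M k < M (Suc (\<kappa> p))" using that by linarith
    then show ?thesis using M_mono by (simp add: strict_mono_less)
  qed
  then have "filterlim \<kappa> sequentially sequentially"
    unfolding filterlim_at_top eventually_sequentially by blast
  then have "tnull D (\<lambda>p. e (\<kappa> p))" by (rule tnull_compose[OF e])
  from shift_conv(1)[OF this, of "\<lambda>p. a (\<kappa> p)"]
  have conv: "convergent (\<lambda>i. \<Prod>p<i. w (\<kappa> p))" by (simp add: w_def)
  let ?P = "\<lambda>i. \<Prod>p<i. w (\<kappa> p)"
  have nP: "norm (?P i) = 1" for i by (simp add: prod_norm[symmetric] w)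
  have step: "?P (M (Suc k)) = ?P (M k) * w k ^ N k" for k
  proof -
    have "?P (M (Suc k)) = ?P (M k) * (\<Prod>p\<in>{M k..<M (Suc k)}. w (\<kappa> p))"
      by (subst prod.union_disjoint[symmetric]) (auto simp: M_Suc intro!: prod.cong)
    also have "(\<Prod>p\<in>{M k..<M (Suc k)}. w (\<kappa> p)) = (\<Prod>p\<in>{M k..<M (Suc k)}. w k)"
      by (intro prod.cong) (auto simp: \<kappa>)
    finally show ?thesis by (simp add: M_Suc)
  qed
  have far: "dist (?P (M (Suc k))) (?P (M k)) \<ge> 1" for k
  proof -
    have "?P (M (Suc k)) - ?P (M k) = ?P (M k) * (w k ^ N k - 1)"
      by (simp add: step algebra_simps)
    then have "dist (?P (M (Suc k))) (?P (M k)) = norm (w k ^ N k - 1)"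
      by (simp add: dist_norm norm_mult nP)
    then show ?thesis using N(1) by simp
  qed
  have "Cauchy ?P" using conv by (rule convergent_Cauchy)
  then obtain I where I: "\<And>i j. i \<ge> I \<Longrightarrow> j \<ge> I \<Longrightarrow> dist (?P i) (?P j) < 1"
    unfolding Cauchy_def by (meson zero_less_one)
  have "M I \<ge> I" "M (Suc I) \<ge> I"
    using strict_mono_imp_increasing[OF M_mono, of I] strict_mono_imp_increasing[OF M_mono, of "Suc I"]
    by auto
  then show False using I[of "M (Suc I)" "M I"] far[of I] by simp
qed

text \<open>Basic neighbourhoods of 0 for the topology inherited from the solenoid. The index
  governs both the number of levels and the radius, so one point from each ball gives a sequence
  with \<open>tnull\<close>.\<close>

definition tball :: "nat \<Rightarrow> rat set" where
  "tball k = {e. \<forall>i\<le>k. norm (cis (2 * pi * of_rat e / sden D i) - 1) < 1 / Suc k}"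

lemma tball_tnull:
  assumes "\<And>k. e k \<in> tball k"
  shows "tnull D e"
  unfolding tnull_def
proof
  fix i
  have "\<forall>\<^sub>F k in sequentially.
      norm (cis (2 * pi * of_rat (e k) / sden D i) - 1) \<le> 1 / Suc k"
    using eventually_ge_at_top[of i]
  proof eventually_elim
    case (elim k)
    then show ?case using assms[of k] by (auto simp: tball_def less_imp_le)
  qed
  then have "(\<lambda>k. cis (2 * pi * of_rat (e k) / sden D i) - 1) \<longlonglongrightarrow> 0"
    by (rule Lim_null_comparison) (rule LIMSEQ_inverse_real_of_nat[unfolded inverse_eq_divide])
  then show "(\<lambda>k. cis (2 * pi * of_rat (e k) / sden D i)) \<longlonglongrightarrow> 1"
    by (simp add: LIM_zero_iff)
qed

lemma tball_small:
  obtains N :: nat where "N > 0" "\<And>e. \<bar>e\<bar> \<le> B / of_nat N \<Longrightarrow> e \<in> tball k"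
proof -
  obtain N :: nat where N: "real N > 2 * pi * \<bar>of_rat B\<bar> * Suc k" "N > 0"
  proof -
    obtain N0 :: nat where "real N0 > 2 * pi * \<bar>of_rat B\<bar> * Suc k" using reals_Archimedean2 by blast
    then show ?thesis by (intro that[of "Suc N0"]) auto
  qed
  show ?thesis
  proof
    fix e :: rat assume e: "\<bar>e\<bar> \<le> B / of_nat N"
    have "norm (cis (2 * pi * of_rat e / sden D i) - 1) < 1 / Suc k" for i
    proof -
      have "of_rat \<bar>e\<bar> \<le> (of_rat (B / of_nat N) :: real)"
        using e by (simp only: of_rat_less_eq)
      moreover have "(of_rat (B / of_nat N) :: real) = of_rat B / N"
        by (simp add: of_rat_divide)
      moreover have "of_rat B / N \<le> \<bar>of_rat B :: real\<bar> / N"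
        by (intro divide_right_mono abs_ge_self) simp
      ultimately have e': "\<bar>of_rat e :: real\<bar> \<le> \<bar>of_rat B\<bar> / N"
        by (simp add: abs_of_rat)
      have "norm (cis (2 * pi * of_rat e / sden D i) - 1) \<le> \<bar>2 * pi * of_rat e / sden D i\<bar>"
        by (rule norm_cis_minus_1)
      also have "\<dots> \<le> 2 * pi * \<bar>of_rat e\<bar> / 1"
        unfolding abs_divide abs_mult using sden_pos[of D i] by (intro divide_mono) auto
      also have "\<dots> \<le> 2 * pi * (\<bar>of_rat B\<bar> / N)"
        using mult_left_mono[OF e', of "2 * pi"] by simp
      also have "\<dots> < 1 / Suc k"
        using N by (simp add: field_simps)
      finally show ?thesis .
    qed
    then show "e \<in> tball k" by (simp add: tball_def)
  qed (rule N)
qed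

text \<open>Failure in every ball would produce a null sequence that violates additivity at each of
  its terms.\<close>

lemma local_additive: "\<exists>k. \<forall>e\<in>tball k. \<forall>a. c (a + e) = c a * c e"
proof (rule ccontr)
  assume "\<not> ?thesis"
  then obtain e a where "\<And>k. e k \<in> tball k" "\<And>k. c (a k + e k) \<noteq> c (a k) * c (e k)"
    by metis
  then show False using shift_exact_frequently[OF tball_tnull] by blast
qed

text \<open>Rationals are divisible: \<open>b\<close> is a sum of \<open>N\<close> equal pieces,
  each so small that local additivity applies to it.\<close>

lemma c_add: "c (a + b) = c a * c b"
proof -
  obtain k where k: "\<And>e a. e \<in> tball k \<Longrightarrow> c (a + e) = c a * c e"
    using local_additive by blast
  obtain N :: nat where N: "N > 0" "\<And>e. \<bar>e\<bar> \<le> \<bar>b\<bar> / of_nat N \<Longrightarrow> e \<in> tball k"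
    using tball_small[of "\<bar>b\<bar>"] by metis
  have mem: "b / of_nat N \<in> tball k" by (rule N) simp
  have "c (a' + of_nat i * (b / of_nat N)) = c a' * c (b / of_nat N) ^ i" for a' i
  proof (induction i)
    case (Suc i)
    have "a' + of_nat (Suc i) * (b / of_nat N) = (a' + of_nat i * (b / of_nat N)) + b / of_nat N"
      by (simp add: algebra_simps add_divide_distrib)
    then show ?case by (simp only: k[OF mem] Suc) (simp add: mult_ac)
  qed simp
  from this[of _ N] have "c (a' + b) = c a' * c (b / of_nat N) ^ N" for a'
    using N(1) by simp
  from this[of a] this[of 0] show ?thesis by (simp add: c_0)
qed

lemma c_uminus: "c (- a) = inverse (c a)"
  using c_add[of a "- a"] c_0 c_nonzero by (simp add: field_simps)

lemma c_of_nat: "c (of_nat i * a) = c a ^ i"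
  by (induction i) (simp_all add: c_0 c_add distrib_right)

lemma c_of_int: "c (of_int p * a) = c a powi p"
proof (cases p rule: int_cases2)
  case (nonneg i)
  then show ?thesis by (simp add: c_of_nat)
next
  case (nonpos i)
  then show ?thesis by (simp add: c_uminus c_of_nat power_int_minus)
qed

lemma c_near: "\<exists>k. \<forall>e\<in>tball k. norm (c e - 1) < 1"
proof (rule ccontr)
  assume "\<not> ?thesis"
  then obtain e where e: "\<And>k. e k \<in> tball k" "\<And>k. norm (c (e k) - 1) \<ge> 1"
    by (metis not_less)
  have "(\<lambda>k. c (e k)) \<longlonglongrightarrow> 1" by (rule c_tnull[OF tball_tnull[OF e(1)]])
  then have "eventually (\<lambda>k. dist (c (e k)) 1 < 1) sequentially"
    by (rule tendstoD) simp
  then obtain k where "dist (c (e k)) 1 < 1"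
    using eventually_happens by fastforce
  then show False using e(2)[of k] by (simp add: dist_norm)
qed

text \<open>All multiples of \<open>sden D k\<close> lie in \<open>tball k\<close>, because levels
  up to \<open>k\<close> send them to 1. Their images are the powers of one number, all within
  distance 1 of 1, and the circle has no small subgroups.\<close>

lemma c_trivial_on_multiples: "\<exists>k. c (of_nat (sden D k)) = 1"
proof -
  obtain k where k: "\<And>e. e \<in> tball k \<Longrightarrow> norm (c e - 1) < 1" using c_near by blast
  have "of_nat i * of_nat (sden D k) \<in> tball k" for i
    unfolding tball_def
  proof (rule CollectI, intro allI impI)
    fix j assume "j \<le> k"
    then obtain q where q: "sden D k = sden D j * q" using sden_dvd by blast
    have "2 * pi * of_rat (of_nat i * of_nat (sden D k)) / sden D j = 2 * pi * real (i * q)"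
      using sden_pos[of D j] by (simp add: q of_rat_mult)
    moreover have "cis (2 * pi * real (i * q)) = 1"
      by (rule cis_multiple_2pi) simp
    ultimately show "norm (cis (2 * pi * of_rat (of_nat i * of_nat (sden D k)) / sden D j) - 1) < 1 / Suc k"
      by simp
  qed
  then have "norm (c (of_nat (sden D k)) ^ i - 1) < 1" for i
    using k by (metis c_of_nat)
  then have "c (of_nat (sden D k)) = 1"
    using unit_power_far[OF norm_c] by (metis not_less)
  then show ?thesis by blast
qed

text \<open>Near 0 the values stay within a quarter turn of 1, where \<open>Arg\<close> is additive.
  Summing along the multiples of \<open>1 / (N * M)\<close> up to \<open>1 / N\<close> removes the
  ambiguity of the \<open>M\<close>-th root and makes the argument linear.\<close>

lemma character: "\<exists>x. \<forall>t. c t = cis (2 * pi * x * of_rat t)"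
proof -
  obtain k where k: "\<And>e. e \<in> tball k \<Longrightarrow> norm (c e - 1) < 1" using c_near by blast
  obtain N :: nat where N: "N > 0" "\<And>e. \<bar>e\<bar> \<le> 1 / of_nat N \<Longrightarrow> e \<in> tball k"
    using tball_small[of 1] by metis
  have A: "\<bar>Arg (c e)\<bar> < pi / 2" if "\<bar>e\<bar> \<le> 1 / of_nat N" for e
    using Arg_near k N(2) that by blast
  define \<phi> where "\<phi> = Arg (c (1 / of_nat N))"
  have cisArg: "cis (Arg (c t)) = c t" for t
    using cis_Arg[OF c_nonzero, of t] norm_c[of t] by (simp add: sgn_eq)
  have *: "c (1 / of_nat (N * M)) = cis (\<phi> / M)" if M: "M > 0" for M
  proof -
    define s :: rat where "s = 1 / of_nat (N * M)"
    have "Arg (c (of_nat i * s)) = i * Arg (c s)" if "i \<le> M" for i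
      using that
    proof (induction i)
      case (Suc i)
      have b: "\<bar>of_nat i * s\<bar> \<le> 1 / of_nat N" "\<bar>s\<bar> \<le> 1 / of_nat N"
        using Suc.prems M N(1) by (auto simp: s_def field_simps)
      have "c (of_nat (Suc i) * s) = c (of_nat i * s) * c s"
        by (simp only: of_nat_Suc distrib_right c_add) simp
      moreover have "Arg (c (of_nat i * s) * c s) = Arg (c (of_nat i * s)) + Arg (c s)"
        using A[OF b(1)] A[OF b(2)] by (intro Arg_times) (auto simp: c_nonzero)
      ultimately show ?case using Suc by (simp add: algebra_simps)
    qed (simp add: c_0)
    from this[of M] have "\<phi> = M * Arg (c s)"
      using M by (simp add: \<phi>_def s_def)
    then show ?thesis using cisArg[of s] M by (simp add: s_def)
  qed
  have "c t = cis (2 * pi * (N * \<phi> / (2 * pi)) * of_rat t)" for t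
  proof -
    obtain p q where pq: "quotient_of t = (p, q)" by (cases "quotient_of t")
    have q: "q > 0" using quotient_of_denom_pos[OF pq] .
    define M where "M = nat q"
    have M: "M > 0" "t = of_int p / of_nat M"
      using q quotient_of_div[OF pq] by (auto simp: M_def)
    have "t = of_int (p * int N) * (1 / of_nat (N * M))"
      using M N(1) by simp
    then have "c t = cis (\<phi> / M) powi (p * int N)"
      by (simp only: c_of_int *[OF M(1)])
    also have "\<dots> = cis (of_int (p * int N) * (\<phi> / M))"
      by (simp add: cis_power_int)
    also have "of_int (p * int N) * (\<phi> / M) = 2 * pi * (N * \<phi> / (2 * pi)) * of_rat t"
      by (simp add: M of_rat_divide)
    finally show ?thesis .
  qed
  then show ?thesis by blast
qed

end

section \<open>Divisibility of the frequencies\<close>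

lemma cis_2pi_eq_1D: "cis (2 * pi * x) = 1 \<Longrightarrow> x \<in> \<int>"
proof -
  assume "cis (2 * pi * x) = 1"
  then have "cos (2 * pi * x) = 1" by (simp add: complex_eq_iff)
  then obtain k :: int where "2 * pi * x = of_int k * 2 * pi"
    using cos_one_2pi_int by blast
  then have "x = of_int k" by simp
  then show ?thesis by simp
qed

text \<open>Testing at \<open>t = 1 / N\<close> with \<open>N\<close> larger than the difference of
  the frequencies leaves less than a full turn, so the values can agree only if the frequencies
  do.\<close>

lemma cis_rat_multiples_eq:
  fixes x y :: real
  assumes "\<And>t::rat. cis (2 * pi * x * of_rat t) = cis (2 * pi * y * of_rat t)"
  shows "x = y"
proof (rule ccontr)
  assume "x \<noteq> y"
  define d where "d = x - y"
  have d: "d \<noteq> 0" using \<open>x \<noteq> y\<close> by (simp add: d_def)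
  obtain N :: nat where N: "real N > \<bar>d\<bar>" using reals_Archimedean2 by blast
  then have N0: "N > 0" by (cases N) auto
  have "cis (2 * pi * (d / N)) = cis (2 * pi * x * of_rat (1 / of_nat N)) / cis (2 * pi * y * of_rat (1 / of_nat N))"
    by (simp add: cis_divide d_def of_rat_divide field_simps diff_divide_distrib)
  also have "\<dots> = 1" by (simp add: assms)
  finally have "d / N \<in> \<int>" by (rule cis_2pi_eq_1D)
  moreover have "\<bar>d / N\<bar> < 1" using N N0 by (simp add: field_simps)
  ultimately have "d / N = 0" by (metis Ints_nonzero_abs_less1)
  then show False using d N0 by simp
qed

lemma sprime_ge: "i \<le> sprime i"
  using strict_mono_imp_increasing[OF strict_mono_enumerate[OF primes_infinite]] by (simp add: sprime_def)

text \<open>The frequencies \<open>x m\<close> become integers after multiplication by some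
  \<open>sden D k\<close>, and \<open>step\<close> makes \<open>x m\<close> divisible within such
  numbers by the factors of \<open>D'\<close> on all levels from \<open>m div n\<close> on. If
  \<open>x m\<close> is nonzero, a prime of \<open>D'\<close> missing from \<open>D\<close> has to
  divide its numerator. The hypothesis \<open>detect\<close> provides a nonzero frequency.\<close>

theorem almost_subset_if_characters:
  fixes c :: "nat \<Rightarrow> rat \<Rightarrow> complex"
  assumes n: "n > 0"
    and spm: "\<And>m. sum_product_map D (c m)"
    and step: "\<And>m t. c m t = c (m + n) t ^ sfac D' (m div n)"
    and detect: "\<And>a. tnull D a \<Longrightarrow> \<forall>m. convergent (\<lambda>i. \<Prod>p<i. c m (a p)) \<Longrightarrow> tconv D (\<lambda>i. \<Sum>p<i. a p)"
  shows "D' \<subseteq>\<^sup>* D"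
proof -
  have "\<exists>x. \<forall>m t. c m t = cis (2 * pi * x m * of_rat t)"
    using sum_product_map.character[OF spm] by metis
  then obtain x where x: "\<And>m t. c m t = cis (2 * pi * x m * of_rat t)" by blast
  have x_int: "\<exists>k. x m * sden D k \<in> \<int>" for m
  proof -
    obtain k where "c m (of_nat (sden D k)) = 1"
      using sum_product_map.c_trivial_on_multiples[OF spm] by blast
    then have "cis (2 * pi * (x m * sden D k)) = 1"
      by (simp add: x mult_ac)
    then show ?thesis using cis_2pi_eq_1D by blast
  qed
  have x_step: "x m = sfac D' (m div n) * x (m + n)" for m
  proof (rule cis_rat_multiples_eq)
    fix t
    have "cis (2 * pi * x m * of_rat t) = cis (2 * pi * x (m + n) * of_rat t) ^ sfac D' (m div n)"
      using step[of m t] by (simp only: x)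
    then show "cis (2 * pi * x m * of_rat t) = cis (2 * pi * (sfac D' (m div n) * x (m + n)) * of_rat t)"
      by (simp only: Complex.DeMoivre) (simp add: mult_ac)
  qed
  have "\<exists>m. x m \<noteq> 0"
  proof (rule ccontr)
    assume "\<not> ?thesis"
    then have c1: "c m t = 1" for m t by (simp add: x)
    \<comment> \<open>Half of the harmonic series: the terms tend to 0, but those from
      \<open>i\<close> to \<open>2 * i - 1\<close> add up to between 1/4 and 1/2. The partial sums
      therefore keep moving by a quarter to a half turn.\<close>
    define a :: "nat \<Rightarrow> rat" where "a p = 1 / of_nat (2 * Suc p)" for p
    have a_real: "of_rat (a p) = 1 / (2 * real (Suc p))" for p
      by (simp add: a_def of_rat_divide of_rat_mult of_rat_add)
    have "(\<lambda>p. of_rat (a p) :: real) \<longlonglongrightarrow> 0"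
      using tendsto_mult_right_zero[OF LIMSEQ_inverse_real_of_nat, of "1/2"]
      by (simp add: a_real inverse_eq_divide)
    then have "tnull D a"
      unfolding tnull_def using sden_pos[of D] by (auto intro!: tendsto_eq_intros simp: less_imp_neq[symmetric])
    then have "tconv D (\<lambda>i. \<Sum>p<i. a p)"
      using detect by (simp add: c1 convergent_const)
    then have "convergent (\<lambda>i. cis (2 * pi * of_rat (\<Sum>p<i. a p) / sden D 0))"
      unfolding tconv_def by blast
    then have "Cauchy (\<lambda>i. cis (2 * pi * of_rat (\<Sum>p<i. a p)))"
      by (intro convergent_Cauchy) simp
    then obtain I where I: "\<And>i j. i \<ge> I \<Longrightarrow> j \<ge> I \<Longrightarrow>
        dist (cis (2 * pi * of_rat (\<Sum>p<i. a p))) (cis (2 * pi * of_rat (\<Sum>p<j. a p))) < 1"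
      unfolding Cauchy_def by (meson zero_less_one)
    obtain i where i: "i > 0" "i \<ge> I" by (meson lessI less_or_eq_imp_le zero_less_Suc)
    define s where "s = (\<Sum>p\<in>{i..<2 * i}. a p)"
    have split: "(\<Sum>p<2 * i. a p) = (\<Sum>p<i. a p) + s"
      unfolding s_def by (subst sum.union_disjoint[symmetric]) (auto intro!: sum.cong)
    have s_real: "(of_rat s :: real) = (\<Sum>p\<in>{i..<2 * i}. 1 / (2 * real (Suc p)))"
      by (simp add: s_def of_rat_sum a_real)
    have "of_rat s \<le> (\<Sum>p\<in>{i..<2 * i}. 1 / (2 * real i))"
      unfolding s_real using i by (intro sum_mono divide_left_mono) auto
    also have "\<dots> = 1/2" using i by simp
    finally have s1: "of_rat s \<le> (1/2 :: real)" .
    have "1/4 = (\<Sum>p\<in>{i..<2 * i}. 1 / (4 * real i))" using i by simp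
    also have "\<dots> \<le> of_rat s"
      unfolding s_real using i by (intro sum_mono divide_left_mono) auto
    finally have s2: "of_rat s \<ge> (1/4 :: real)" .
    define y where "y = 2 * pi * of_rat s"
    have y: "pi / 2 \<le> y" "y \<le> pi"
      using s1 s2 pi_gt_zero by (simp_all add: y_def field_simps) 
    have "cos y \<le> 0"
      using cos_monotone_0_pi_le[of "pi/2" y] y by simp
    then have "1 \<le> norm (cis y - 1)"
      using abs_Re_le_cmod[of "cis y - 1"] by simp
    also have "norm (cis y - 1) = dist (cis (2 * pi * of_rat (\<Sum>p<2 * i. a p))) (cis (2 * pi * of_rat (\<Sum>p<i. a p)))"
    proof -
      have "cis (2 * pi * of_rat (\<Sum>p<2 * i. a p)) = cis (2 * pi * of_rat (\<Sum>p<i. a p)) * cis y"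
        by (simp add: split of_rat_add y_def cis_mult distrib_left)
      then have "cis (2 * pi * of_rat (\<Sum>p<2 * i. a p)) - cis (2 * pi * of_rat (\<Sum>p<i. a p)) =
          cis (2 * pi * of_rat (\<Sum>p<i. a p)) * (cis y - 1)"
        by (simp add: algebra_simps)
      then show ?thesis by (simp add: dist_norm norm_mult)
    qed
    also have "\<dots> < 1" by (rule I) (use i in auto)
    finally show False by simp
  qed
  then obtain m where m: "x m \<noteq> 0" by blast
  obtain k a where a: "x m * sden D k = of_int a" using x_int[of m] by (auto elim: Ints_cases)
  have "a \<noteq> 0" using a m sden_pos[of D k] by auto
  have x_iter: "x m = (\<Prod>i<r. sfac D' (m div n + i)) * x (m + r * n)" for r
  proof (induction r)
    case (Suc r)
    have "(m + r * n) div n = m div n + r" using n by simp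
    with x_step[of "m + r * n"] have "x (m + r * n) = sfac D' (m div n + r) * x (m + Suc r * n)"
      by (simp add: algebra_simps)
    with Suc show ?case by simp
  qed simp
  have "i \<le> max (m div n) (nat \<bar>a\<bar>)" if i: "i \<in> D'" "i \<notin> D" for i
  proof (rule ccontr)
    assume "\<not> ?thesis"
    then have i2: "m div n \<le> i" "nat \<bar>a\<bar> < i" by auto
    \<comment> \<open>Climbing \<open>r\<close> levels from \<open>m div n\<close> just passes level
      \<open>i\<close>, so the prime with index \<open>i\<close> is one of the factors collected in
      \<open>R\<close>.\<close>
    define r where "r = Suc (i - m div n)"
    define R where "R = (\<Prod>j<r. sfac D' (m div n + j))"
    have "sfac D' (m div n + (i - m div n)) dvd R"
      unfolding R_def by (rule dvd_prodI) (auto simp: r_def)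
    then have pR: "sprime i dvd R" using i i2 by (simp add: sfac_def)
    obtain k' b where b: "x (m + r * n) * sden D k' = of_int b"
      using x_int[of "m + r * n"] by (auto elim: Ints_cases)
    have "real_of_int a * sden D k' = (R * x (m + r * n)) * sden D k * sden D k'"
      using x_iter[of r] by (simp add: R_def a[symmetric])
    also have "\<dots> = of_int (int R * b * int (sden D k))"
      by (simp add: b[symmetric])
    finally have "a * int (sden D k') = int R * b * int (sden D k)"
      by (metis of_int_eq_iff of_int_mult of_int_of_nat_eq)
    then have "int (sprime i) dvd a * int (sden D k')"
      using pR by (metis dvd_mult2 int_dvd_int_iff mult.assoc)
    moreover have "\<not> int (sprime i) dvd int (sden D k')"
      using i by (simp add: sprime_dvd_sden)
    ultimately have "int (sprime i) dvd a"
      using prime_dvd_mult_iff[of "int (sprime i)"] prime_sprime by auto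
    then have "int (sprime i) \<le> \<bar>a\<bar>"
      using \<open>a \<noteq> 0\<close> by (intro zdvd_imp_le) auto
    then show False using i2 sprime_ge[of i] by linarith
  qed
  then have "D' - D \<subseteq> {..max (m div n) (nat \<bar>a\<bar>)}" by auto
  then show ?thesis unfolding almost_subset_def by (rule finite_subset) simp
qed

subsection \<open>Reductions between solenoids\<close>

lemma Arg_tendsto_0:
  assumes "(z \<longlongrightarrow> 1) F"
  shows "((\<lambda>i. Arg (z i)) \<longlongrightarrow> 0) F"
proof -
  have "isCont Arg 1" by (rule continuous_at_Arg) simp
  from isCont_tendsto_compose[OF this assms] show ?thesis by simp
qed

lemma tendsto_0_of_cis:
  assumes "\<And>i. \<bar>d i\<bar> \<le> 1" "((\<lambda>i. cis (d i)) \<longlongrightarrow> 1) F"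
  shows "(d \<longlongrightarrow> 0) F"
proof -
  have "Arg (cis (d i)) = d i" for i
    using assms(1)[of i] pi_gt3 by (intro Arg_cis) auto
  then show ?thesis using Arg_tendsto_0[OF assms(2)] by simp
qed

text \<open>Up to a null sequence, \<open>a\<close> differs from a fixed argument of the limit by
  integer multiples of \<open>2 * pi\<close>. Their increments tend to 0, so these integers are
  eventually constant.\<close>

lemma convergent_lift_cis:
  fixes a :: "nat \<Rightarrow> real"
  assumes step: "(\<lambda>i. a (Suc i) - a i) \<longlonglongrightarrow> 0" and conv: "convergent (\<lambda>i. cis (a i))"
  shows "convergent a"
proof -
  obtain l where l: "(\<lambda>i. cis (a i)) \<longlonglongrightarrow> l" using conv unfolding convergent_def by blast
  have nl: "norm l = 1" using tendsto_norm[OF l] by (simp add: LIMSEQ_const_iff)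
  then have l0: "l \<noteq> 0" by auto
  define b where "b = Arg l"
  have lb: "cis b = l" using cis_Arg[OF l0] nl by (simp add: b_def sgn_eq)
  define r where "r i = Arg (cis (a i - b))" for i
  have "(\<lambda>i. cis (a i) / l) \<longlonglongrightarrow> l / l" by (intro tendsto_divide l tendsto_const l0)
  then have "(\<lambda>i. cis (a i - b)) \<longlonglongrightarrow> 1" using l0 by (simp add: lb[symmetric] cis_divide)
  then have r0: "r \<longlonglongrightarrow> 0" unfolding r_def by (rule Arg_tendsto_0)
  define d where "d i = (a i - b - r i) / (2 * pi)" for i
  have d_int: "d i \<in> \<int>" for i
  proof (rule cis_2pi_eq_1D)
    have "cis (r i) = cis (a i - b)"
      using cis_Arg[of "cis (a i - b)"] by (simp add: r_def sgn_eq)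
    moreover have "cis (2 * pi * d i) = cis (a i - b) / cis (r i)"
      by (simp add: d_def cis_divide)
    ultimately show "cis (2 * pi * d i) = 1" by simp
  qed
  have "(\<lambda>i. ((a (Suc i) - a i) - (r (Suc i) - r i)) / (2 * pi)) \<longlonglongrightarrow> (0 - (0 - 0)) / (2 * pi)"
    by (intro tendsto_divide tendsto_diff step r0 LIMSEQ_Suc[OF r0] tendsto_const) simp
  moreover have "((a (Suc i) - a i) - (r (Suc i) - r i)) / (2 * pi) = d (Suc i) - d i" for i
    by (simp add: d_def diff_divide_distrib[symmetric])
  ultimately have "(\<lambda>i. d (Suc i) - d i) \<longlonglongrightarrow> 0" by simp
  then obtain I where I: "\<And>i. i \<ge> I \<Longrightarrow> \<bar>d (Suc i) - d i\<bar> < 1"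
    using LIMSEQ_D[of "\<lambda>i. d (Suc i) - d i" 0 1] by auto
  have "d i = d I" if "i \<ge> I" for i
    using that
  proof (induction rule: dec_induct)
    case (step i)
    have "d (Suc i) - d i = 0"
      by (rule Ints_nonzero_abs_less1[OF Ints_diff[OF d_int d_int] I]) (use step in simp)
    then show ?case using step by simp
  qed simp
  then have "eventually (\<lambda>i. d i = d I) sequentially" unfolding eventually_sequentially by blast
  then have "d \<longlonglongrightarrow> d I" by (rule tendsto_eventually)
  then have "(\<lambda>i. b + r i + 2 * pi * d i) \<longlonglongrightarrow> b + 0 + 2 * pi * d I"
    by (intro tendsto_intros r0)
  moreover have "b + r i + 2 * pi * d i = a i" for i by (simp add: d_def)
  ultimately show ?thesis unfolding convergent_def by auto
qed

text \<open>A \<open>k\<close>-th root is ambiguous by a finite, hence discrete, group. Small steps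
  allow a real lift with small steps, and \<open>k\<close> times this lift converges because it does
  so modulo full turns.\<close>

lemma convergent_unit_root:
  fixes z :: "nat \<Rightarrow> complex"
  assumes nz: "\<And>i. norm (z i) = 1" and step: "(\<lambda>i. z (Suc i) / z i) \<longlonglongrightarrow> 1"
    and conv: "convergent (\<lambda>i. z i ^ k)" and k: "k > 0"
  shows "convergent z"
proof -
  define a where "a i = Arg (z 0) + (\<Sum>p<i. Arg (z (Suc p) / z p))" for i
  have z0: "z i \<noteq> 0" for i using nz[of i] by auto
  have cA: "cis (Arg w) = w" if "norm w = 1" for w :: complex
    using cis_Arg[of w] that by (cases "w = 0") (auto simp: sgn_eq)
  have az: "cis (a i) = z i" for i
  proof (induction i)
    case 0
    then show ?case by (simp add: a_def cA nz)
  next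
    case (Suc i)
    have "cis (a (Suc i)) = cis (a i) * cis (Arg (z (Suc i) / z i))"
      by (simp add: a_def cis_mult add.assoc)
    also have "\<dots> = z i * (z (Suc i) / z i)"
      by (simp only: Suc) (simp add: cA nz norm_divide)
    finally show ?case using z0 by simp
  qed
  have "(\<lambda>i. Arg (z (Suc i) / z i)) \<longlonglongrightarrow> 0" by (rule Arg_tendsto_0[OF step])
  then have "(\<lambda>i. k * Arg (z (Suc i) / z i)) \<longlonglongrightarrow> real k * 0" by (intro tendsto_mult tendsto_const)
  moreover have "k * a (Suc i) - k * a i = k * Arg (z (Suc i) / z i)" for i
    by (simp add: a_def algebra_simps)
  ultimately have "(\<lambda>i. k * a (Suc i) - k * a i) \<longlonglongrightarrow> 0" by simp
  moreover have "cis (k * a i) = z i ^ k" for i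
    by (simp only: Complex.DeMoivre[symmetric] az)
  ultimately have "convergent (\<lambda>i. k * a i)"
    using conv by (intro convergent_lift_cis) simp_all
  then obtain L where "(\<lambda>i. k * a i) \<longlonglongrightarrow> L" unfolding convergent_def by blast
  then have "(\<lambda>i. cis (k * a i / k)) \<longlonglongrightarrow> cis (L / k)"
    using k by (intro tendsto_intros) auto
  then have "z \<longlonglongrightarrow> cis (L / k)" using k by (simp add: az)
  then show ?thesis by (rule convergentI)
qed

text \<open>A double array listed along a bijection with the naturals tends to 0 exactly when each
  threshold is reached by finitely many entries, whatever the bijection is.\<close>

lemma tendsto_prod_decode_iff:
  fixes h :: "nat \<times> nat \<Rightarrow> real"
  shows "(\<lambda>l. h (prod_decode l)) \<longlonglongrightarrow> 0 \<longleftrightarrow> (\<forall>e>0. finite {p. \<bar>h p\<bar> \<ge> e})"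
proof -
  have img: "{p. \<bar>h p\<bar> \<ge> e} = prod_decode ` {l. \<bar>h (prod_decode l)\<bar> \<ge> e}" for e
  proof
    show "{p. \<bar>h p\<bar> \<ge> e} \<subseteq> prod_decode ` {l. \<bar>h (prod_decode l)\<bar> \<ge> e}"
    proof
      fix p assume "p \<in> {p. \<bar>h p\<bar> \<ge> e}"
      then show "p \<in> prod_decode ` {l. \<bar>h (prod_decode l)\<bar> \<ge> e}"
        by (intro image_eqI[of _ _ "prod_encode p"]) simp_all
    qed
  qed auto
  have fin: "finite {p. \<bar>h p\<bar> \<ge> e} \<longleftrightarrow> finite {l. \<bar>h (prod_decode l)\<bar> \<ge> e}" for e
    unfolding img using finite_image_iff[OF inj_on_subset[OF inj_prod_decode[of UNIV] subset_UNIV]] by blast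
  have "(\<lambda>l. h (prod_decode l)) \<longlonglongrightarrow> 0 \<longleftrightarrow> (\<forall>e>0. \<exists>I. \<forall>l\<ge>I. \<bar>h (prod_decode l)\<bar> < e)"
    by (simp add: lim_sequentially)
  also have "\<dots> \<longleftrightarrow> (\<forall>e>0. finite {l. \<bar>h (prod_decode l)\<bar> \<ge> e})"
  proof -
    have "(\<exists>I. \<forall>l\<ge>I. \<bar>h (prod_decode l)\<bar> < e) \<longleftrightarrow> finite {l. \<bar>h (prod_decode l)\<bar> \<ge> e}" for e
      unfolding finite_nat_set_iff_bounded by (auto simp: not_le) (meson not_le)+
    then show ?thesis by simp
  qed
  finally show ?thesis unfolding fin .
qed

lemma continuous_map_compose2:
  fixes h :: "'b::topological_space \<times> 'c::topological_space \<Rightarrow> 'd::topological_space"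
  assumes "continuous_map X euclidean u" "continuous_map X euclidean v" "continuous_on UNIV h"
  shows "continuous_map X euclidean (\<lambda>x. h (u x, v x))"
proof -
  have "continuous_map X (prod_topology euclidean euclidean) (\<lambda>x. (u x, v x))"
    using assms(1,2) by (simp only: continuous_map_pairedI)
  then have "continuous_map X euclidean (\<lambda>x. (u x, v x))" by simp
  moreover have "continuous_map euclidean euclidean h" using assms(3) by simp
  ultimately show ?thesis
    using continuous_map_compose[of X euclidean "\<lambda>x. (u x, v x)" euclidean h] by (simp add: o_def)
qed

text \<open>The odd entries record the real sequence \<open>e\<close> as a small displacement along a one-parameter
  subgroup, so that convergence of the image also forces \<open>e x l - e x' l\<close> to tend to \<open>0\<close>.\<close>
lemma borel_reducible_solenoidI:
  fixes y :: "'a \<Rightarrow> nat \<Rightarrow> nat \<Rightarrow> complex" and e :: "'a \<Rightarrow> nat \<Rightarrow> real"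
  assumes n: "n > 0"
    and y_mem: "\<And>x l. x \<in> topspace X \<Longrightarrow> y x l \<in> solenoid_set n D"
    and y_cont: "\<And>l m. continuous_map X euclidean (\<lambda>x. y x l m)"
    and e_cont: "\<And>l. continuous_map X euclideanreal (\<lambda>x. e x l)"
    and e_bound: "\<And>x l. x \<in> topspace X \<Longrightarrow> \<bar>e x l\<bar> \<le> 1/2"
    and red: "\<And>x x'. x \<in> topspace X \<Longrightarrow> x' \<in> topspace X \<Longrightarrow> (x, x') \<in> E \<longleftrightarrow>
      (\<forall>m. convergent (\<lambda>l. y x l m / y x' l m)) \<and> (\<lambda>l. e x l - e x' l) \<longlonglongrightarrow> 0"
  shows "borel_reducible X E (seq_space (solenoid n D)) (conv_rel (solenoid n D))"
proof -
  define \<theta> where "\<theta> x l m = (if even l then y x (l div 2) m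
      else y x (l div 2) m * cis (e x (l div 2) / sden D (m div n)))" for x l m
  have mem: "\<theta> x l \<in> solenoid_set n D" if x: "x \<in> topspace X" for x l
  proof (cases "even l")
    case True
    then have "\<theta> x l = y x (l div 2)" by (auto simp: \<theta>_def)
    then show ?thesis using y_mem[OF x] by simp
  next
    case False
    then have "\<theta> x l = (\<lambda>m. y x (l div 2) m * wind n D (\<lambda>_. e x (l div 2) / (2 * pi)) m)"
      by (auto simp: \<theta>_def wind_def)
    then show ?thesis using solenoid_set_mult[OF y_mem[OF x] wind_mem_solenoid_set[OF n]] by simp
  qed
  have comp: "continuous_map X euclidean (\<lambda>x. \<theta> x l m)" for l m
  proof (cases "even l")
    case True
    then show ?thesis using y_cont by (simp add: \<theta>_def)
  next
    case False
    have "continuous_on UNIV (\<lambda>p. fst p * cis (snd p / sden D (m div n)))"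
      using sden_pos[of D "m div n"] by (intro continuous_intros) auto
    from continuous_map_compose2[OF y_cont e_cont this]
    show ?thesis using False by (simp add: \<theta>_def)
  qed
  have "continuous_map X euclidean (\<lambda>x. \<theta> x l)" for l
    unfolding euclidean_product_topology[symmetric] continuous_map_componentwise_UNIV
    using comp by blast
  then have "continuous_map X euclidean \<theta>"
    unfolding euclidean_product_topology[symmetric, where 'b = "nat \<Rightarrow> complex"]
      continuous_map_componentwise_UNIV by blast
  then have cont: "continuous_map X (seq_space (solenoid n D)) \<theta>"
    unfolding seq_space_solenoid continuous_map_in_subtopology using mem by auto
  show ?thesis
  proof (rule borel_reducible_continuous[OF cont])
    fix x x' assume x: "x \<in> topspace X" "x' \<in> topspace X"
    define w where "w m l = y x l m / y x' l m" for m l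
    define d where "d l = e x l - e x' l" for l
    have even: "\<theta> x (2 * l) m / \<theta> x' (2 * l) m = w m l" for l m
      by (simp add: \<theta>_def w_def)
    have odd: "\<theta> x (2 * l + 1) m / \<theta> x' (2 * l + 1) m = w m l * cis (d l / sden D (m div n))" for l m
      by (simp add: \<theta>_def w_def d_def diff_divide_distrib cis_divide[symmetric])
    have nw: "norm (w m l) = 1" for m l
      unfolding w_def using solenoid_set_norm[OF y_mem[OF x(1)]] solenoid_set_norm[OF y_mem[OF x(2)]]
      by (simp add: norm_divide)
    have "(\<theta> x, \<theta> x') \<in> conv_rel (solenoid n D) \<longleftrightarrow> (\<forall>m. convergent (\<lambda>l. \<theta> x l m / \<theta> x' l m))"
      unfolding conv_rel_solenoid using mem x by blast
    also have "\<dots> \<longleftrightarrow> (\<forall>m. convergent (w m)) \<and> d \<longlonglongrightarrow> 0"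
    proof
      assume conv: "\<forall>m. convergent (\<lambda>l. \<theta> x l m / \<theta> x' l m)"
      have *: "convergent (w m) \<and> (\<lambda>l. cis (d l / sden D (m div n))) \<longlonglongrightarrow> 1" for m
      proof -
        obtain L where L: "(\<lambda>l. \<theta> x l m / \<theta> x' l m) \<longlonglongrightarrow> L" using conv unfolding convergent_def by blast
        have L1: "w m \<longlonglongrightarrow> L"
          using LIMSEQ_subseq_LIMSEQ[OF L, of "\<lambda>l. 2 * l"] unfolding o_def even
          by (simp add: strict_mono_def)
        have L2: "(\<lambda>l. w m l * cis (d l / sden D (m div n))) \<longlonglongrightarrow> L"
          using LIMSEQ_subseq_LIMSEQ[OF L, of "\<lambda>l. 2 * l + 1"] unfolding o_def odd
          by (simp add: strict_mono_def)
        have "norm L = 1" using tendsto_norm[OF L1] by (simp add: nw LIMSEQ_const_iff)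
        then have "L \<noteq> 0" by auto
        then have "(\<lambda>l. w m l * cis (d l / sden D (m div n)) / w m l) \<longlonglongrightarrow> L / L"
          by (intro tendsto_divide L1 L2)
        moreover have "w m l \<noteq> 0" for l using nw[of m l] by auto
        ultimately have "(\<lambda>l. cis (d l / sden D (m div n))) \<longlonglongrightarrow> 1" using \<open>L \<noteq> 0\<close> by simp
        then show ?thesis using L1 convergentI by blast
      qed
      have "(\<lambda>l. cis (d l)) \<longlonglongrightarrow> 1" using *[of 0] by simp
      \<comment> \<open>The bound 1/2 on both displacements keeps their difference within a single
        turn, so \<open>cis (d l)\<close> near 1 forces \<open>d l\<close> near 0.\<close>
      moreover have "\<bar>d l\<bar> \<le> 1" for l
        using e_bound[OF x(1), of l] e_bound[OF x(2), of l] unfolding d_def by linarith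
      ultimately have "d \<longlonglongrightarrow> 0" by (intro tendsto_0_of_cis)
      then show "(\<forall>m. convergent (w m)) \<and> d \<longlonglongrightarrow> 0" using * by blast
    next
      assume *: "(\<forall>m. convergent (w m)) \<and> d \<longlonglongrightarrow> 0"
      show "\<forall>m. convergent (\<lambda>l. \<theta> x l m / \<theta> x' l m)"
      proof
        fix m
        obtain L where L: "w m \<longlonglongrightarrow> L" using * unfolding convergent_def by blast
        have "(\<lambda>l. cis (d l / sden D (m div n))) \<longlonglongrightarrow> cis (0 / sden D (m div n))"
          using * sden_pos[of D "m div n"] by (intro tendsto_intros) auto
        from tendsto_mult[OF L this] have L2: "(\<lambda>l. w m l * cis (d l / sden D (m div n))) \<longlonglongrightarrow> L" by simp
        have "(\<lambda>l. \<theta> x l m / \<theta> x' l m) \<longlonglongrightarrow> L"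
          by (rule tendsto_interleave) (simp_all only: even odd L L2)
        then show "convergent (\<lambda>l. \<theta> x l m / \<theta> x' l m)" by (rule convergentI)
      qed
    qed
    finally show "(x, x') \<in> E \<longleftrightarrow> (\<theta> x, \<theta> x') \<in> conv_rel (solenoid n D)"
      unfolding red[OF x] w_def d_def by blast
  qed
qed

text \<open>Alternating real and imaginary parts lets one real array record complex numbers.\<close>

definition part :: "nat \<Rightarrow> complex \<Rightarrow> real" where
  "part m z = (if even m then Re z else Im z)"

lemma abs_part_le: "\<bar>part m z\<bar> \<le> norm z"
  by (simp add: part_def abs_Re_le_cmod abs_Im_le_cmod)

lemma part_diff: "part m z - part m w = part m (z - w)"
  by (simp add: part_def)

lemma continuous_on_part: "continuous_on S (part m)"
  unfolding part_def[abs_def] by (cases "even m") (auto intro!: continuous_intros)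

text \<open>The recursion says that the power maps with exponents \<open>N k\<close> commute with
  the bonding maps of the two inverse systems. The solution is
  \<open>sden D' K * sden D k / sden D' k\<close>, an integer since beyond \<open>K\<close> every
  factor of \<open>D'\<close> is also one of \<open>D\<close>.\<close>

lemma degrees_exist:
  assumes "D' \<subseteq>\<^sup>* D"
  obtains N where "\<And>k. N k > 0" "\<And>k. N (Suc k) * sfac D' k = sfac D k * N k"
proof -
  obtain K where K: "\<And>i. i \<in> D' \<Longrightarrow> i \<ge> K \<Longrightarrow> i \<in> D"
    using assms unfolding almost_subset_def finite_nat_set_iff_bounded by (metis Diff_iff not_le)
  define M where "M = sden D' K"
  have "sden D' k dvd M * sden D k" for k
  proof (cases "k \<le> K")
    case True
    then show ?thesis unfolding M_def using sden_dvd dvd_mult2 by blast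
  next
    case False
    then have "K \<le> k" by simp
    then show ?thesis
    proof (induction rule: dec_induct)
      case (step k)
      have "sfac D' k dvd sfac D k" using K[of k] step(1) by (simp add: sfac_def)
      from mult_dvd_mono[OF this step(3)] show ?case by (simp add: sden_Suc mult_ac)
    qed (simp add: M_def)
  qed
  then obtain N where N: "\<And>k. M * sden D k = sden D' k * N k" unfolding dvd_def by metis
  have "N k > 0" for k
  proof (rule ccontr)
    assume "\<not> N k > 0"
    then show False using N[of k] sden_pos[of D k] sden_pos[of D' K] by (simp add: M_def)
  qed
  moreover have "N (Suc k) * sfac D' k = sfac D k * N k" for k
  proof -
    have "sden D' k * (N (Suc k) * sfac D' k) = sden D' k * (sfac D k * N k)"
    proof -
      have "sden D' k * (N (Suc k) * sfac D' k) = M * sden D (Suc k)"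
        by (simp only: N) (simp add: sden_Suc)
      also have "\<dots> = sfac D k * (M * sden D k)" by (simp add: sden_Suc)
      finally show ?thesis by (auto simp: N)
    qed
    then show ?thesis using sden_pos[of D' k] by simp
  qed
  ultimately show ?thesis using that by blast
qed

text \<open>Powers remember a point only up to roots of unity. Once consecutive quotients approach
  1, a sequence cannot keep jumping between finitely many roots, which is
  \<open>convergent_unit_root\<close>; the displacements encode this condition on the steps.\<close>

lemma E_le_solenoid_if_almost_subset:
  assumes n: "n > 0" and sub: "D' \<subseteq>\<^sup>* D"
  shows "E_le (solenoid n D) (solenoid n D')"
proof -
  obtain N where N: "\<And>k. N k > 0" "\<And>k. N (Suc k) * sfac D' k = sfac D k * N k"
    using degrees_exist[OF sub] by metis
  define y where "y x l m = x l m ^ N (m div n)" for x :: "nat \<Rightarrow> nat \<Rightarrow> complex" and l m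
  define u where "u x i m = x (Suc i) m / x i m" for x :: "nat \<Rightarrow> nat \<Rightarrow> complex" and i m
  \<comment> \<open>The first index is the time of a step and the second a coordinate with a parity
    for \<open>part\<close>. Division by \<open>Suc (snd p)\<close> makes convergence of the whole
    array equivalent to convergence in each coordinate, and the factor 2 gives the bound
    1/2.\<close>
  define h where "h x p = part (snd p) (u x (fst p) (snd p div 2)) / (2 * real (Suc (snd p)))"
    for x and p :: "nat \<times> nat"
  let ?X = "seq_space (solenoid n D)"
  have X: "x \<in> topspace ?X \<longleftrightarrow> (\<forall>l. x l \<in> solenoid_set n D)" for x
    by (simp add: topspace_seq_space_solenoid)
  have nx: "norm (x l m) = 1" "x l m \<noteq> 0" if "x \<in> topspace ?X" for x l m
    using that X solenoid_set_norm solenoid_set_nonzero by blast+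
  have coord: "continuous_map ?X euclidean (\<lambda>x. x l m)" for l m
  proof -
    have "continuous_on {x. \<forall>l. x l \<in> solenoid_set n D} (\<lambda>x. x l m)"
      by (rule continuous_on_product_then_coordinatewise[OF continuous_on_product_then_coordinatewise[OF continuous_on_id]])
    then show ?thesis unfolding seq_space_solenoid by simp
  qed
  show ?thesis
    unfolding E_le_def
  proof (rule borel_reducible_solenoidI[OF n, where y = y and e = "\<lambda>x l. h x (prod_decode l)"])
    fix x l assume "x \<in> topspace ?X"
    then have x: "x l \<in> solenoid_set n D" using X by blast
    have "y x l m = y x l (m + n) ^ sfac D' (m div n)" for m
    proof -
      have "y x l (m + n) ^ sfac D' (m div n) = x l (m + n) ^ (N (Suc (m div n)) * sfac D' (m div n))"
        using n by (simp add: y_def power_mult)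
      also have "\<dots> = (x l (m + n) ^ sfac D (m div n)) ^ N (m div n)"
        by (simp add: N(2) power_mult)
      also have "\<dots> = y x l m" unfolding y_def using solenoid_set_step[OF x, of m] by simp
      finally show ?thesis by simp
    qed
    moreover have "norm (y x l m) = 1" for m
      using solenoid_set_norm[OF x] by (simp add: y_def norm_power)
    ultimately show "y x l \<in> solenoid_set n D'" unfolding solenoid_set_def by blast
  next
    fix l m
    show "continuous_map ?X euclidean (\<lambda>x. y x l m)"
    proof -
      have "continuous_on UNIV (\<lambda>p :: complex \<times> complex. fst p ^ N (m div n))" by (intro continuous_intros)
      from continuous_map_compose2[OF coord coord this] show ?thesis by (simp add: y_def)
    qed
  next
    fix l
    obtain i m where im: "prod_decode l = (i, m)" by (cases "prod_decode l")
    have "continuous_on {x. \<forall>l. x l \<in> solenoid_set n D} (\<lambda>x. x (Suc i) (m div 2) / x i (m div 2))"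
    proof (rule continuous_on_divide)
      show "continuous_on {x. \<forall>l. x l \<in> solenoid_set n D} (\<lambda>x. x k (m div 2))" for k
        by (rule continuous_on_product_then_coordinatewise[OF continuous_on_product_then_coordinatewise[OF continuous_on_id]])
      then show "continuous_on {x. \<forall>l. x l \<in> solenoid_set n D} (\<lambda>x. x k (m div 2))" for k .
    qed (use solenoid_set_nonzero in blast)
    then have "continuous_on {x. \<forall>l. x l \<in> solenoid_set n D}
        (\<lambda>x. part m (x (Suc i) (m div 2) / x i (m div 2)))"
      by (rule continuous_on_compose2[OF continuous_on_part[of UNIV]]) simp
    then have "continuous_on {x. \<forall>l. x l \<in> solenoid_set n D} (\<lambda>x. h x (prod_decode l))"
      unfolding im h_def u_def fst_conv snd_conv
      by (rule continuous_on_divide[OF _ continuous_on_const]) simp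
    then show "continuous_map ?X euclideanreal (\<lambda>x. h x (prod_decode l))"
      unfolding seq_space_solenoid by simp
  next
    fix x l assume x: "x \<in> topspace ?X"
    obtain i m where im: "prod_decode l = (i, m)" by (cases "prod_decode l")
    have "\<bar>part m (u x i (m div 2))\<bar> \<le> 1"
      using abs_part_le[of m "u x i (m div 2)"] nx[OF x] by (simp add: u_def norm_divide)
    then show "\<bar>h x (prod_decode l)\<bar> \<le> 1/2" by (simp add: im h_def field_simps)
  next
    fix x x' assume x: "x \<in> topspace ?X" "x' \<in> topspace ?X"
    define w where "w m l = x l m / x' l m" for m l
    have nw: "norm (w m l) = 1" for m l using nx[OF x(1)] nx[OF x(2)] by (simp add: w_def norm_divide)
    have nu': "norm (u x' i m) = 1" for i m using nx[OF x(2)] by (simp add: u_def norm_divide)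
    have wu: "w m (Suc i) / w m i - 1 = (u x i m - u x' i m) / u x' i m" for m i
      using nx[OF x(1)] nx[OF x(2)] by (simp add: w_def u_def field_simps)
    have norm_wu: "norm (w m (Suc i) / w m i - 1) = norm (u x i m - u x' i m)" for m i
      unfolding wu by (simp add: norm_divide nu')
    have hd: "h x (i, m) - h x' (i, m) = part m (u x i (m div 2) - u x' i (m div 2)) / (2 * real (Suc m))" for i m
      by (simp add: h_def part_diff[symmetric] diff_divide_distrib)
    have steps_iff: "(\<lambda>l. h x (prod_decode l) - h x' (prod_decode l)) \<longlonglongrightarrow> 0 \<longleftrightarrow>
        (\<forall>m. (\<lambda>i. u x i m - u x' i m) \<longlonglongrightarrow> 0)"
    proof
      assume lim: "(\<lambda>l. h x (prod_decode l) - h x' (prod_decode l)) \<longlonglongrightarrow> 0"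
      have sub: "(\<lambda>i. part m (u x i (m div 2) - u x' i (m div 2))) \<longlonglongrightarrow> 0" for m
      proof -
        have "strict_mono (\<lambda>i. prod_encode (i, m))"
          unfolding strict_mono_Suc_iff by (simp add: prod_encode_def)
        from LIMSEQ_subseq_LIMSEQ[OF lim this]
        have "(\<lambda>i. h x (i, m) - h x' (i, m)) \<longlonglongrightarrow> 0" by (simp add: o_def)
        then have "(\<lambda>i. (2 * real (Suc m)) * (h x (i, m) - h x' (i, m))) \<longlonglongrightarrow> (2 * real (Suc m)) * 0"
          by (intro tendsto_mult tendsto_const)
        then show ?thesis by (simp add: hd)
      qed
      show "\<forall>m. (\<lambda>i. u x i m - u x' i m) \<longlonglongrightarrow> 0"
      proof
        fix m
        have "(\<lambda>i. Re (u x i m - u x' i m)) \<longlonglongrightarrow> 0" using sub[of "2 * m"] by (simp add: part_def)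
        moreover have "(\<lambda>i. Im (u x i m - u x' i m)) \<longlonglongrightarrow> 0" using sub[of "2 * m + 1"] by (simp add: part_def)
        ultimately show "(\<lambda>i. u x i m - u x' i m) \<longlonglongrightarrow> 0" unfolding tendsto_complex_iff by simp
      qed
    next
      assume lim: "\<forall>m. (\<lambda>i. u x i m - u x' i m) \<longlonglongrightarrow> 0"
      show "(\<lambda>l. h x (prod_decode l) - h x' (prod_decode l)) \<longlonglongrightarrow> 0"
        unfolding tendsto_prod_decode_iff[of "\<lambda>p. h x p - h x' p"]
      proof (intro allI impI)
        fix e :: real assume e: "e > 0"
        \<comment> \<open>Unit numbers are at most 2 apart, so an entry of index \<open>m\<close> is
          at most \<open>1 / real (Suc m)\<close> and can reach \<open>e\<close> only for
          \<open>m < M\<close>.\<close>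
        obtain M :: nat where M: "1 / e < real M" using reals_Archimedean2 by blast
        have "eventually (\<lambda>i. \<forall>m\<in>{..<M}. norm (u x i (m div 2) - u x' i (m div 2)) < e) sequentially"
        proof (intro eventually_ball_finite ballI)
          fix m
          show "eventually (\<lambda>i. norm (u x i (m div 2) - u x' i (m div 2)) < e) sequentially"
            using tendstoD[OF lim[rule_format, of "m div 2"] e] by (simp add: dist_norm)
        qed simp
        then obtain I where I: "\<And>i m. i \<ge> I \<Longrightarrow> m < M \<Longrightarrow> norm (u x i (m div 2) - u x' i (m div 2)) < e"
          unfolding eventually_sequentially by auto
        have "p \<in> {..<I} \<times> {..<M}" if p: "\<bar>h x p - h x' p\<bar> \<ge> e" for p
        proof -
          obtain i m where im: "p = (i, m)" by (cases p)
          let ?d = "norm (u x i (m div 2) - u x' i (m div 2))"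
          have le: "e \<le> ?d / (2 * real (Suc m))"
          proof -
            have "e \<le> \<bar>part m (u x i (m div 2) - u x' i (m div 2))\<bar> / (2 * real (Suc m))"
              using p unfolding im hd abs_divide by simp
            also have "\<dots> \<le> ?d / (2 * real (Suc m))"
              by (intro divide_right_mono abs_part_le) simp
            finally show ?thesis .
          qed
          have "?d \<le> 2"
            using norm_triangle_ineq4[of "u x i (m div 2)" "u x' i (m div 2)"] nx[OF x(1)] nu'
            by (simp add: u_def norm_divide)
          then have "?d / (2 * real (Suc m)) \<le> 2 / (2 * real (Suc m))" by (intro divide_right_mono) auto
          also have "\<dots> = 1 / real (Suc m)" by (simp add: field_simps)
          finally have "?d / (2 * real (Suc m)) \<le> 1 / real (Suc m)" .
          then have "e \<le> 1 / real (Suc m)" using le by linarith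
          then have "real (Suc m) \<le> 1 / e" using e by (simp add: field_simps)
          then have m: "m < M" using M by simp
          have "?d / (2 * real (Suc m)) \<le> ?d" by (simp add: field_simps mult_left_mono)
          then have "\<not> ?d < e" using le by linarith
          then have "i < I" using I[of i m] m by (meson not_le)
          then show ?thesis using m im by simp
        qed
        then have "{p. e \<le> \<bar>h x p - h x' p\<bar>} \<subseteq> {..<I} \<times> {..<M}" by blast
        then show "finite {p. e \<le> \<bar>h x p - h x' p\<bar>}" by (rule finite_subset) simp
      qed
    qed
    have steps: "(\<lambda>i. u x i m - u x' i m) \<longlonglongrightarrow> 0 \<longleftrightarrow> (\<lambda>i. w m (Suc i) / w m i) \<longlonglongrightarrow> 1" for m
    proof -
      have "(\<lambda>i. w m (Suc i) / w m i) \<longlonglongrightarrow> 1 \<longleftrightarrow> (\<lambda>i. w m (Suc i) / w m i - 1) \<longlonglongrightarrow> 0"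
        by (simp add: LIM_zero_iff)
      also have "\<dots> \<longleftrightarrow> (\<lambda>i. u x i m - u x' i m) \<longlonglongrightarrow> 0"
        using norm_wu by (simp add: tendsto_norm_zero_iff[symmetric, of "\<lambda>i. w m (Suc i) / w m i - 1"]
            tendsto_norm_zero_iff[symmetric, of "\<lambda>i. u x i m - u x' i m"])
      finally show ?thesis by blast
    qed
    have yw: "y x l m / y x' l m = w m l ^ N (m div n)" for l m
      by (simp add: y_def w_def power_divide)
    have "(x, x') \<in> conv_rel (solenoid n D) \<longleftrightarrow> (\<forall>m. convergent (w m))"
      unfolding conv_rel_solenoid w_def using x X by blast
    also have "\<dots> \<longleftrightarrow> (\<forall>m. convergent (\<lambda>l. w m l ^ N (m div n))) \<and> (\<forall>m. (\<lambda>i. w m (Suc i) / w m i) \<longlonglongrightarrow> 1)"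
    proof
      assume conv: "\<forall>m. convergent (w m)"
      have "convergent (\<lambda>l. w m l ^ N (m div n)) \<and> (\<lambda>i. w m (Suc i) / w m i) \<longlonglongrightarrow> 1" for m
      proof -
        obtain l where l: "w m \<longlonglongrightarrow> l" using conv unfolding convergent_def by blast
        have "norm l = 1" using tendsto_norm[OF l] by (simp add: nw LIMSEQ_const_iff)
        then have l0: "l \<noteq> 0" by auto
        have "(\<lambda>i. w m (Suc i) / w m i) \<longlonglongrightarrow> l / l" by (intro tendsto_divide LIMSEQ_Suc l l0)
        moreover have "(\<lambda>i. w m i ^ N (m div n)) \<longlonglongrightarrow> l ^ N (m div n)" by (intro tendsto_power l)
        ultimately show ?thesis using l0 convergentI by auto
      qed
      then show "(\<forall>m. convergent (\<lambda>l. w m l ^ N (m div n))) \<and> (\<forall>m. (\<lambda>i. w m (Suc i) / w m i) \<longlonglongrightarrow> 1)" by blast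
    next
      assume *: "(\<forall>m. convergent (\<lambda>l. w m l ^ N (m div n))) \<and> (\<forall>m. (\<lambda>i. w m (Suc i) / w m i) \<longlonglongrightarrow> 1)"
      show "\<forall>m. convergent (w m)"
      proof
        fix m show "convergent (w m)"
          using * by (intro convergent_unit_root[OF nw _ _ N(1)]) auto
      qed
    qed
    finally show "(x, x') \<in> conv_rel (solenoid n D) \<longleftrightarrow>
        (\<forall>m. convergent (\<lambda>l. y x l m / y x' l m)) \<and> (\<lambda>l. h x (prod_decode l) - h x' (prod_decode l)) \<longlonglongrightarrow> 0"
      unfolding steps_iff steps yw .
  qed
qed

subsection \<open>Powers of the line and of the circle\<close>

lemma power_group_simps:
  "carrier (power_group G n) = PiE {..<n} (\<lambda>_. carrier G)"
  "x \<otimes>\<^bsub>power_group G n\<^esub> y = (\<lambda>i\<in>{..<n}. x i \<otimes>\<^bsub>G\<^esub> y i)"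
  "\<one>\<^bsub>power_group G n\<^esub> = (\<lambda>i\<in>{..<n}. \<one>\<^bsub>G\<^esub>)"
  "gtop (power_group G n) = product_topology (\<lambda>_. gtop G) {..<n}"
  by (simp_all add: power_group_def monoid.defs)

lemma inv_power_group:
  assumes "group G" "x \<in> PiE {..<n} (\<lambda>_. carrier G)"
  shows "inv\<^bsub>power_group G n\<^esub> x = (\<lambda>i\<in>{..<n}. inv\<^bsub>G\<^esub> (x i))"
proof -
  have "inv\<^bsub>power_group G n\<^esub> x = inv\<^bsub>product_group {..<n} (\<lambda>_. G)\<^esub> x"
    unfolding m_inv_def by (simp add: power_group_simps)
  also have "\<dots> = (\<lambda>i\<in>{..<n}. inv\<^bsub>G\<^esub> (x i))"
    using assms by (intro inv_product_group) auto
  finally show ?thesis .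
qed

lemma conv_rel_power_group:
  assumes G: "group G" "topspace (gtop G) = carrier G"
    and x: "x \<in> topspace (seq_space (power_group G n))" and y: "y \<in> topspace (seq_space (power_group G n))"
  shows "(x, y) \<in> conv_rel (power_group G n) \<longleftrightarrow>
    (\<forall>j<n. \<exists>l. limitin (gtop G) (\<lambda>k. x k j \<otimes>\<^bsub>G\<^esub> inv\<^bsub>G\<^esub> (y k j)) l sequentially)"
proof -
  have mem: "x k \<in> PiE {..<n} (\<lambda>_. carrier G)" "y k \<in> PiE {..<n} (\<lambda>_. carrier G)" for k
    using x y by (auto simp: seq_space_def power_group_simps G(2) PiE_iff)
  define z where "z k = (\<lambda>j\<in>{..<n}. x k j \<otimes>\<^bsub>G\<^esub> inv\<^bsub>G\<^esub> (y k j))" for k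
  have zeq: "(\<lambda>k. x k \<otimes>\<^bsub>power_group G n\<^esub> inv\<^bsub>power_group G n\<^esub> (y k)) = z"
    by (auto simp: z_def power_group_simps inv_power_group[OF G(1) mem(2)] fun_eq_iff)
  interpret group G by (rule G(1))
  have zmem: "z k \<in> PiE {..<n} (\<lambda>_. carrier G)" for k
    unfolding z_def using mem[of k] by (auto simp: PiE_iff)
  have "(x, y) \<in> conv_rel (power_group G n) \<longleftrightarrow>
      (\<exists>l. limitin (product_topology (\<lambda>_. gtop G) {..<n}) z l sequentially)"
    unfolding conv_rel_def mem_Collect_eq case_prod_conv zeq power_group_simps(4) using x y by blast
  also have "\<dots> \<longleftrightarrow> (\<exists>l. l \<in> extensional {..<n} \<and> (\<forall>j\<in>{..<n}. limitin (gtop G) (\<lambda>k. z k j) (l j) sequentially))"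
    unfolding limitin_componentwise using zmem by (simp add: G(2))
  also have "\<dots> \<longleftrightarrow> (\<forall>j\<in>{..<n}. \<exists>l. limitin (gtop G) (\<lambda>k. z k j) l sequentially)"
  proof
    assume "\<forall>j\<in>{..<n}. \<exists>l. limitin (gtop G) (\<lambda>k. z k j) l sequentially"
    then obtain l where "\<forall>j\<in>{..<n}. limitin (gtop G) (\<lambda>k. z k j) (l j) sequentially" by metis
    then have "restrict l {..<n} \<in> extensional {..<n} \<and>
        (\<forall>j\<in>{..<n}. limitin (gtop G) (\<lambda>k. z k j) (restrict l {..<n} j) sequentially)" by simp
    then show "\<exists>l. l \<in> extensional {..<n} \<and> (\<forall>j\<in>{..<n}. limitin (gtop G) (\<lambda>k. z k j) (l j) sequentially)"
      by (rule exI[of _ "restrict l {..<n}"])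
  qed blast
  also have "\<dots> \<longleftrightarrow> (\<forall>j<n. \<exists>l. limitin (gtop G) (\<lambda>k. x k j \<otimes>\<^bsub>G\<^esub> inv\<^bsub>G\<^esub> (y k j)) l sequentially)"
    by (auto simp: z_def)
  finally show ?thesis .
qed

lemma group_real_line: "group real_line_group" and inv_real_line: "inv\<^bsub>real_line_group\<^esub> t = - t"
proof -
  show g: "group real_line_group"
  proof (rule groupI)
    fix t :: real assume "t \<in> carrier real_line_group"
    then show "\<exists>s\<in>carrier real_line_group. s \<otimes>\<^bsub>real_line_group\<^esub> t = \<one>\<^bsub>real_line_group\<^esub>"
      by (intro bexI[of _ "- t"]) (simp_all add: real_line_group_def)
  qed (simp_all add: real_line_group_def)
  show "inv\<^bsub>real_line_group\<^esub> t = - t"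
    by (rule group.inv_equality[OF g]) (simp_all add: real_line_group_def)
qed

lemma group_circle: "group circle_group"
  and inv_circle: "norm z = 1 \<Longrightarrow> inv\<^bsub>circle_group\<^esub> z = inverse z"
proof -
  show g: "group circle_group"
  proof (rule groupI)
    fix z assume z: "z \<in> carrier circle_group"
    then have "norm z = 1" by (simp add: circle_group_def)
    then have "z \<noteq> 0" by auto
    then show "\<exists>s\<in>carrier circle_group. s \<otimes>\<^bsub>circle_group\<^esub> z = \<one>\<^bsub>circle_group\<^esub>"
      using \<open>norm z = 1\<close> by (intro bexI[of _ "inverse z"]) (simp_all add: circle_group_def norm_inverse)
  qed (simp_all add: circle_group_def norm_mult)
  show "inv\<^bsub>circle_group\<^esub> z = inverse z" if "norm z = 1"
  proof (rule group.inv_equality[OF g])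
    have "z \<noteq> 0" using that by auto
    then show "inverse z \<otimes>\<^bsub>circle_group\<^esub> z = \<one>\<^bsub>circle_group\<^esub>" by (simp add: circle_group_def)
  qed (use that in \<open>simp_all add: circle_group_def norm_inverse\<close>)
qed

lemma conv_rel_real_power:
  assumes "x \<in> topspace (seq_space (power_group real_line_group n))"
    "y \<in> topspace (seq_space (power_group real_line_group n))"
  shows "(x, y) \<in> conv_rel (power_group real_line_group n) \<longleftrightarrow> (\<forall>j<n. convergent (\<lambda>k. x k j - y k j))"
proof -
  have "topspace (gtop real_line_group) = carrier real_line_group" by (simp add: real_line_group_def)
  from conv_rel_power_group[OF group_real_line this assms] show ?thesis
    unfolding inv_real_line by (simp add: real_line_group_def convergent_def)
qed

lemma conv_rel_circle_power:
  assumes x: "x \<in> topspace (seq_space (power_group circle_group n))"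
    and y: "y \<in> topspace (seq_space (power_group circle_group n))"
  shows "(x, y) \<in> conv_rel (power_group circle_group n) \<longleftrightarrow> (\<forall>j<n. convergent (\<lambda>k. x k j / y k j))"
proof -
  have ts: "topspace (gtop circle_group) = carrier circle_group" by (simp add: circle_group_def)
  have mem: "norm (x k j) = 1" "norm (y k j) = 1" if "j < n" for k j
    using x y that by (auto simp: seq_space_def power_group_simps circle_group_def PiE_iff)
  have "(\<exists>l. limitin (gtop circle_group) (\<lambda>k. x k j \<otimes>\<^bsub>circle_group\<^esub> inv\<^bsub>circle_group\<^esub> (y k j)) l sequentially)
      \<longleftrightarrow> convergent (\<lambda>k. x k j / y k j)" if j: "j < n" for j
  proof -
    have eq: "(\<lambda>k. x k j \<otimes>\<^bsub>circle_group\<^esub> inv\<^bsub>circle_group\<^esub> (y k j)) = (\<lambda>k. x k j / y k j)"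
      using inv_circle[OF mem(2)[OF j]] by (simp add: circle_group_def divide_inverse)
    have n1: "norm (x k j / y k j) = 1" for k using mem[OF j] by (simp add: norm_divide)
    have "norm l = 1" if "(\<lambda>k. x k j / y k j) \<longlonglongrightarrow> l" for l
      using tendsto_norm[OF that] by (simp only: n1 LIMSEQ_const_iff)
    then show ?thesis
      unfolding eq convergent_def using n1 by (auto simp: circle_group_def limitin_subtopology)
  qed
  then show ?thesis using conv_rel_power_group[OF group_circle ts x y] by simp
qed

text \<open>For the empty set all exponents are 1, so points are \<open>n\<close>-periodic sequences
  and are determined by their first \<open>n\<close> entries.\<close>

lemma E_le_solenoid_circle:
  assumes n: "n > 0"
  shows "E_le (solenoid n {}) (power_group circle_group n)"
  unfolding E_le_def
proof (rule borel_reducible_continuous)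
  let ?X = "seq_space (solenoid n {})" and ?Y = "seq_space (power_group circle_group n)"
  let ?\<theta> = "\<lambda>x l. restrict (x l) {..<n}"
  have coord: "continuous_map ?X (top_of_set (sphere 0 1)) (\<lambda>x. x l m)" for l m
  proof -
    have "continuous_on {x. \<forall>l. x l \<in> solenoid_set n {}} (\<lambda>x. x l m)"
      by (rule continuous_on_product_then_coordinatewise[OF continuous_on_product_then_coordinatewise[OF continuous_on_id]])
    then show ?thesis unfolding seq_space_solenoid
      using solenoid_set_norm[of _ n "{}"] by (auto simp: image_subset_iff Pi_iff)
  qed
  show cont: "continuous_map ?X ?Y ?\<theta>"
    unfolding seq_space_def[of "power_group _ _"] continuous_map_componentwise_UNIV power_group_simps
      continuous_map_componentwise
    using coord by (auto simp: circle_group_def)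
  fix x y assume xy: "x \<in> topspace ?X" "y \<in> topspace ?X"
  have ty: "?\<theta> x \<in> topspace ?Y" "?\<theta> y \<in> topspace ?Y"
    using cont xy by (auto simp: continuous_map_def Pi_iff)
  have per: "z m = z (m mod n)" if "z \<in> solenoid_set n {}" for z m
  proof -
    have st: "z k = z (k + n)" for k using solenoid_set_step[OF that, of k] by (simp add: sfac_def)
    have "z j = z (j + k * n)" for j k
    proof (induction k)
      case (Suc k)
      have "z (j + k * n) = z (j + k * n + n)" by (rule st)
      also have "j + k * n + n = j + Suc k * n" by simp
      finally show ?case using Suc by simp
    qed simp
    from this[of "m mod n" "m div n"] show ?thesis by simp
  qed
  have xym: "x l \<in> solenoid_set n {}" "y l \<in> solenoid_set n {}" for l
    using xy by (simp_all add: topspace_seq_space_solenoid)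
  have "(x, y) \<in> conv_rel (solenoid n {}) \<longleftrightarrow> (\<forall>m. convergent (\<lambda>l. x l m / y l m))"
    unfolding conv_rel_solenoid using xym by blast
  also have "\<dots> \<longleftrightarrow> (\<forall>j<n. convergent (\<lambda>l. x l j / y l j))"
  proof
    assume *: "\<forall>j<n. convergent (\<lambda>l. x l j / y l j)"
    show "\<forall>m. convergent (\<lambda>l. x l m / y l m)"
    proof
      fix m
      have "(\<lambda>l. x l m / y l m) = (\<lambda>l. x l (m mod n) / y l (m mod n))"
        using per[OF xym(1), of _ m] per[OF xym(2), of _ m] by presburger
      then show "convergent (\<lambda>l. x l m / y l m)" using * n by simp
    qed
  qed blast
  also have "\<dots> \<longleftrightarrow> (?\<theta> x, ?\<theta> y) \<in> conv_rel (power_group circle_group n)"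
    unfolding conv_rel_circle_power[OF ty] by simp
  finally show "(x, y) \<in> conv_rel (solenoid n {}) \<longleftrightarrow> (?\<theta> x, ?\<theta> y) \<in> conv_rel (power_group circle_group n)" .
qed

text \<open>A single \<open>cis\<close> does not distinguish a real step from 0 if the step is a
  multiple of a full turn. Dividing by the ceiling of \<open>\<bar>d i\<bar>\<close> brings every
  step of size above 1 into absolute value between 1/2 and 1, where it is visible.\<close>

lemma tendsto_0_of_scaled_cis:
  fixes d :: "nat \<Rightarrow> real"
  assumes "\<And>r. r > 0 \<Longrightarrow> eventually (\<lambda>i. \<forall>k. norm (cis (d i / real (Suc k)) - 1) < r) sequentially"
  shows "d \<longlonglongrightarrow> 0"
proof -
  \<comment> \<open>Here \<open>Suc (K i)\<close> is the ceiling of \<open>\<bar>d i\<bar>\<close>,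
    except that truncated subtraction makes it 1 when \<open>d i = 0\<close>.\<close>
  define K where "K i = nat \<lceil>\<bar>d i\<bar>\<rceil> - 1" for i
  define t where "t i = d i / real (Suc (K i))" for i
  have K: "real (Suc (K i)) \<ge> \<bar>d i\<bar>" "\<bar>d i\<bar> \<le> 1 \<Longrightarrow> K i = 0" "\<bar>d i\<bar> > 1 \<Longrightarrow> real (Suc (K i)) \<le> 2 * \<bar>d i\<bar>" for i
  proof -
    show "real (Suc (K i)) \<ge> \<bar>d i\<bar>" unfolding K_def by linarith
    show "K i = 0" if "\<bar>d i\<bar> \<le> 1"
    proof -
      have "\<lceil>\<bar>d i\<bar>\<rceil> \<le> 1" using that by (simp add: ceiling_le_iff)
      then show ?thesis unfolding K_def by simp
    qed
    show "real (Suc (K i)) \<le> 2 * \<bar>d i\<bar>" if "\<bar>d i\<bar> > 1" unfolding K_def using that by linarith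
  qed
  have t1: "\<bar>t i\<bar> \<le> 1" for i
    using K(1)[of i] by (simp add: t_def abs_divide)
  have "(\<lambda>i. cis (t i)) \<longlonglongrightarrow> 1"
  proof (rule tendstoI)
    fix r :: real assume "r > 0"
    from assms[OF this] show "eventually (\<lambda>i. dist (cis (t i)) 1 < r) sequentially"
      by eventually_elim (simp add: t_def dist_norm)
  qed
  then have t0: "t \<longlonglongrightarrow> 0" by (intro tendsto_0_of_cis t1)
  have "eventually (\<lambda>i. t i = d i) sequentially"
    using tendstoD[OF t0 half_gt_zero[OF zero_less_one]]
  proof eventually_elim
    case (elim i)
    then have lt: "\<bar>t i\<bar> < 1/2" by simp
    have "\<not> \<bar>d i\<bar> > 1"
    proof
      assume d: "\<bar>d i\<bar> > 1"
      have "\<bar>d i\<bar> = \<bar>t i\<bar> * real (Suc (K i))" by (simp add: t_def abs_divide)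
      also have "\<dots> < 1/2 * real (Suc (K i))" using lt by (intro mult_strict_right_mono) auto
      also have "\<dots> \<le> \<bar>d i\<bar>" using K(3)[OF d] by simp
      finally show False by simp
    qed
    then show ?case using K(2)[of i] by (simp add: t_def)
  qed
  then show ?thesis using t0 by (rule Lim_transform_eventually[rotated])
qed

text \<open>Convergence in the solenoid controls real differences only modulo full turns. The
  displacements add that the steps tend to 0, and then \<open>convergent_lift_cis\<close> recovers
  convergence on the line. Steps of real sequences are unbounded, so they are recorded on the circle
  at all scales at once.\<close>

lemma E_le_real_solenoid:
  assumes n: "n > 0"
  shows "E_le (power_group real_line_group n) (solenoid n D)"
proof -
  let ?X = "seq_space (power_group real_line_group n)"
  \<comment> \<open>The index \<open>m\<close> packs three data: its parity for \<open>part\<close>,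
    the coordinate \<open>m div 2 mod n\<close> and the scale \<open>m div 2 div n\<close>.\<close>
  define v where "v x i m = (x (Suc i) (m div 2 mod n) - x i (m div 2 mod n)) / real (Suc (m div 2 div n))"
    for x :: "nat \<Rightarrow> nat \<Rightarrow> real" and i m
  define h where "h x p = part (snd p) (cis (v x (fst p) (snd p))) / 2" for x and p :: "nat \<times> nat"
  have coord: "continuous_map ?X euclideanreal (\<lambda>x. x l j)" if "j < n" for l j
  proof -
    have "continuous_map ?X (gtop (power_group real_line_group n)) (\<lambda>x. x l)"
      unfolding seq_space_def by (rule continuous_map_product_projection) simp
    moreover have "continuous_map (gtop (power_group real_line_group n)) (gtop real_line_group) (\<lambda>x. x j)"
      unfolding power_group_simps by (rule continuous_map_product_projection) (simp add: that)
    ultimately have "continuous_map ?X (gtop real_line_group) ((\<lambda>x. x j) \<circ> (\<lambda>x. x l))"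
      by (rule continuous_map_compose)
    then show ?thesis by (simp add: o_def real_line_group_def)
  qed
  show ?thesis
    unfolding E_le_def
  proof (rule borel_reducible_solenoidI[OF n, where y = "\<lambda>x l. wind n D (x l)" and e = "\<lambda>x l. h x (prod_decode l)"])
    show "wind n D (x l) \<in> solenoid_set n D" for x l by (rule wind_mem_solenoid_set[OF n])
  next
    fix l m
    have "continuous_on UNIV (\<lambda>p :: real \<times> real. cis (2 * pi * fst p / sden D (m div n)))"
      using sden_pos[of D "m div n"] by (intro continuous_intros) auto
    moreover have "continuous_map ?X euclideanreal (\<lambda>x. x l (m mod n))" using n by (intro coord) simp
    ultimately show "continuous_map ?X euclidean (\<lambda>x. wind n D (x l) m)"
      using continuous_map_compose2[of ?X "\<lambda>x. x l (m mod n)" "\<lambda>x. x l (m mod n)"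
          "\<lambda>p. cis (2 * pi * fst p / sden D (m div n))"] unfolding wind_def by simp
  next
    fix l
    obtain i m where im: "prod_decode l = (i, m)" by (cases "prod_decode l")
    have "continuous_on UNIV (\<lambda>p :: real \<times> real. cis ((fst p - snd p) / real (Suc (m div 2 div n))))"
      by (intro continuous_intros) auto
    then have "continuous_on UNIV (\<lambda>p :: real \<times> real. part m (cis ((fst p - snd p) / real (Suc (m div 2 div n)))))"
      by (rule continuous_on_compose2[OF continuous_on_part[of UNIV]]) simp
    then have "continuous_on UNIV (\<lambda>p :: real \<times> real. part m (cis ((fst p - snd p) / real (Suc (m div 2 div n)))) / 2)"
      by (rule continuous_on_divide[OF _ continuous_on_const]) simp
    moreover have "continuous_map ?X euclideanreal (\<lambda>x. x k (m div 2 mod n))" for k using n by (intro coord) simp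
    ultimately show "continuous_map ?X euclideanreal (\<lambda>x. h x (prod_decode l))"
      using continuous_map_compose2[of ?X "\<lambda>x. x (Suc i) (m div 2 mod n)" "\<lambda>x. x i (m div 2 mod n)"
          "\<lambda>p. part m (cis ((fst p - snd p) / real (Suc (m div 2 div n)))) / 2"]
      unfolding im h_def v_def by simp
  next
    fix x :: "nat \<Rightarrow> nat \<Rightarrow> real" and l
    show "\<bar>h x (prod_decode l)\<bar> \<le> 1/2"
      using abs_part_le[of "snd (prod_decode l)" "cis (v x (fst (prod_decode l)) (snd (prod_decode l)))"]
      by (simp add: h_def)
  next
    fix x x' assume x: "x \<in> topspace ?X" "x' \<in> topspace ?X"
    define d where "d j l = x l j - x' l j" for j l
    have vd: "v x i m - v x' i m = (d (m div 2 mod n) (Suc i) - d (m div 2 mod n) i) / real (Suc (m div 2 div n))" for i m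
      by (simp add: v_def d_def diff_divide_distrib)
    have norm_cis_diff: "norm (cis a - cis b) = norm (cis (a - b) - 1)" for a b
    proof -
      have "cis a - cis b = cis b * (cis (a - b) - 1)" by (simp add: algebra_simps cis_mult)
      then show ?thesis by (simp add: norm_mult)
    qed
    have wd: "wind n D (x l) m / wind n D (x' l) m = cis (2 * pi * d (m mod n) l / sden D (m div n))" for l m
      by (simp add: wind_def cis_divide d_def diff_divide_distrib right_diff_distrib)
    have steps_iff: "(\<lambda>l. h x (prod_decode l) - h x' (prod_decode l)) \<longlonglongrightarrow> 0 \<longleftrightarrow>
        (\<forall>j<n. (\<lambda>i. d j (Suc i) - d j i) \<longlonglongrightarrow> 0)"
      unfolding tendsto_prod_decode_iff[of "\<lambda>p. h x p - h x' p"]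
    proof
      assume fin: "\<forall>e>0. finite {p. e \<le> \<bar>h x p - h x' p\<bar>}"
      show "\<forall>j<n. (\<lambda>i. d j (Suc i) - d j i) \<longlonglongrightarrow> 0"
      proof (intro allI impI tendsto_0_of_scaled_cis)
        fix j r assume j: "j < n" and r: "(r::real) > 0"
        have "finite {p. r / 8 \<le> \<bar>h x p - h x' p\<bar>}" by (rule fin[rule_format]) (use r in simp)
        then have "finite (fst ` {p. r / 8 \<le> \<bar>h x p - h x' p\<bar>})" by (rule finite_imageI)
        then obtain I where "\<forall>i\<in>fst ` {p. r / 8 \<le> \<bar>h x p - h x' p\<bar>}. i < I"
          unfolding finite_nat_set_iff_bounded by (elim exE)
        then have I: "fst p < I" if "r / 8 \<le> \<bar>h x p - h x' p\<bar>" for p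
          using that by blast
        have "norm (cis ((d j (Suc i) - d j i) / real (Suc k)) - 1) < r" if i: "i \<ge> I" for i k
        proof -
          have hb: "\<bar>h x (i, m) - h x' (i, m)\<bar> < r / 8" for m
          proof (rule ccontr)
            assume "\<not> ?thesis"
            then have "fst (i, m) < I" by (intro I) simp
            then show False using i by simp
          qed
          define m where "m = 2 * (k * n + j)"
          have m2: "m div 2 = k * n + j" "Suc m div 2 = k * n + j" by (simp_all add: m_def)
          have mm: "(k * n + j) mod n = j" "(k * n + j) div n = k" using j by simp_all
          define a where "a = v x i m"
          define b where "b = v x' i m"
          have ab: "a = v x i (Suc m)" "b = v x' i (Suc m)" by (simp_all add: a_def b_def v_def m2)
          have "h x (i, m) - h x' (i, m) = Re (cis a - cis b) / 2"
            by (simp add: h_def part_def a_def b_def m_def diff_divide_distrib)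
          then have "\<bar>Re (cis a - cis b)\<bar> < r / 4" using hb[of m] by linarith
          moreover have "h x (i, Suc m) - h x' (i, Suc m) = Im (cis a - cis b) / 2"
            by (simp add: h_def part_def ab m_def diff_divide_distrib)
          then have "\<bar>Im (cis a - cis b)\<bar> < r / 4" using hb[of "Suc m"] by linarith
          ultimately have "norm (cis a - cis b) < r"
            using cmod_le[of "cis a - cis b"] r by linarith
          moreover have "a - b = (d j (Suc i) - d j i) / real (Suc k)"
            unfolding a_def b_def vd m2 mm by simp
          ultimately show ?thesis by (simp add: norm_cis_diff)
        qed
        then show "eventually (\<lambda>i. \<forall>k. norm (cis ((d j (Suc i) - d j i) / real (Suc k)) - 1) < r) sequentially"
          unfolding eventually_sequentially by blast
      qed
    next
      assume lim: "\<forall>j<n. (\<lambda>i. d j (Suc i) - d j i) \<longlonglongrightarrow> 0"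
      show "\<forall>e>0. finite {p. e \<le> \<bar>h x p - h x' p\<bar>}"
      proof (intro allI impI)
        fix e :: real assume e: "e > 0"
        have "eventually (\<lambda>i. \<forall>j\<in>{..<n}. \<bar>d j (Suc i) - d j i\<bar> < e) sequentially"
        proof (intro eventually_ball_finite ballI)
          fix j assume "j \<in> {..<n}"
          then show "eventually (\<lambda>i. \<bar>d j (Suc i) - d j i\<bar> < e) sequentially"
            using tendstoD[OF lim[rule_format, of j] e] by simp
        qed simp
        then obtain I where I: "\<And>i j. i \<ge> I \<Longrightarrow> j < n \<Longrightarrow> \<bar>d j (Suc i) - d j i\<bar> < e"
          unfolding eventually_sequentially by auto
        \<comment> \<open>The finitely many early steps are bounded by \<open>B\<close>, and
          division by the scale brings them below \<open>e\<close> from scale \<open>M\<close>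
          on.\<close>
        define B where "B = (\<Sum>i<I. \<Sum>j<n. \<bar>d j (Suc i) - d j i\<bar>)"
        have B: "\<bar>d j (Suc i) - d j i\<bar> \<le> B" if "i < I" "j < n" for i j
        proof -
          have "\<bar>d j (Suc i) - d j i\<bar> \<le> (\<Sum>j<n. \<bar>d j (Suc i) - d j i\<bar>)"
            using that by (intro member_le_sum) auto
          also have "\<dots> \<le> B" unfolding B_def using that
            by (intro member_le_sum[of i "{..<I}" "\<lambda>i. \<Sum>j<n. \<bar>d j (Suc i) - d j i\<bar>"] sum_nonneg) auto
          finally show ?thesis .
        qed
        obtain M :: nat where M: "B / e < real M" using reals_Archimedean2 by blast
        have "p \<in> {..<I} \<times> {..<2 * n * M}" if p: "e \<le> \<bar>h x p - h x' p\<bar>" for p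
        proof -
          obtain i m where im: "p = (i, m)" by (cases p)
          let ?j = "m div 2 mod n" and ?k = "m div 2 div n"
          have j: "?j < n" using n by simp
          have "h x p - h x' p = part m (cis (v x i m) - cis (v x' i m)) / 2"
            by (simp add: im h_def part_diff[symmetric] diff_divide_distrib)
          then have "2 * e \<le> \<bar>part m (cis (v x i m) - cis (v x' i m))\<bar>" using p by simp
          also have "\<dots> \<le> norm (cis (v x i m) - cis (v x' i m))" by (rule abs_part_le)
          also have "\<dots> \<le> \<bar>v x i m - v x' i m\<bar>" unfolding norm_cis_diff by (rule norm_cis_minus_1)
          finally have le: "2 * e \<le> \<bar>d ?j (Suc i) - d ?j i\<bar> / real (Suc ?k)"
            unfolding vd by (simp add: abs_divide)
          also have "\<dots> \<le> \<bar>d ?j (Suc i) - d ?j i\<bar> / 1" by (intro divide_left_mono) auto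
          finally have "\<not> \<bar>d ?j (Suc i) - d ?j i\<bar> < e" using e by simp
          then have i: "i < I" using I[OF _ j] by (meson not_le)
          have "e * real (Suc ?k) \<le> B"
          proof -
            have "2 * e * real (Suc ?k) \<le> \<bar>d ?j (Suc i) - d ?j i\<bar>"
              using le by (simp add: pos_le_divide_eq)
            also have "\<dots> \<le> B" by (rule B[OF i j])
            finally have "2 * (e * real (Suc ?k)) \<le> B" by simp
            moreover have "e * real (Suc ?k) \<ge> 0" using e by simp
            ultimately show ?thesis by linarith
          qed
          then have "real (Suc ?k) \<le> B / e" using e by (simp add: pos_le_divide_eq mult.commute)
          then have "?k < M" using M by simp
          then have "m div (2 * n) < M" by (simp add: div_mult2_eq)
          then have "m < M * (2 * n)" using n by (simp add: div_less_iff_less_mult)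
          then show ?thesis using i im by (simp add: mult_ac)
        qed
        then have "{p. e \<le> \<bar>h x p - h x' p\<bar>} \<subseteq> {..<I} \<times> {..<2 * n * M}" by blast
        then show "finite {p. e \<le> \<bar>h x p - h x' p\<bar>}" by (rule finite_subset) simp
      qed
    qed
    show "(x, x') \<in> conv_rel (power_group real_line_group n) \<longleftrightarrow>
        (\<forall>m. convergent (\<lambda>l. wind n D (x l) m / wind n D (x' l) m)) \<and>
        (\<lambda>l. h x (prod_decode l) - h x' (prod_decode l)) \<longlonglongrightarrow> 0"
      unfolding steps_iff wd conv_rel_real_power[OF x] d_def[symmetric]
    proof
      assume conv: "\<forall>j<n. convergent (\<lambda>k. d j k)"
      have "convergent (\<lambda>l. cis (2 * pi * d (m mod n) l / sden D (m div n)))" for m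
      proof -
        have "convergent (d (m mod n))" using conv n by simp
        then obtain L where "d (m mod n) \<longlonglongrightarrow> L" unfolding convergent_def by blast
        then have "(\<lambda>l. cis (2 * pi * d (m mod n) l / sden D (m div n))) \<longlonglongrightarrow> cis (2 * pi * L / sden D (m div n))"
          using sden_pos[of D "m div n"] by (intro tendsto_intros) auto
        then show ?thesis by (rule convergentI)
      qed
      moreover have "(\<lambda>i. d j (Suc i) - d j i) \<longlonglongrightarrow> 0" if "j < n" for j
      proof -
        have "convergent (d j)" using conv \<open>j < n\<close> by simp
        then obtain L where L: "d j \<longlonglongrightarrow> L" unfolding convergent_def by blast
        from tendsto_diff[OF LIMSEQ_Suc[OF L] L] show ?thesis by simp
      qed
      ultimately show "(\<forall>m. convergent (\<lambda>l. cis (2 * pi * d (m mod n) l / sden D (m div n)))) \<and>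
          (\<forall>j<n. (\<lambda>i. d j (Suc i) - d j i) \<longlonglongrightarrow> 0)" by blast
    next
      assume *: "(\<forall>m. convergent (\<lambda>l. cis (2 * pi * d (m mod n) l / sden D (m div n)))) \<and>
          (\<forall>j<n. (\<lambda>i. d j (Suc i) - d j i) \<longlonglongrightarrow> 0)"
      show "\<forall>j<n. convergent (\<lambda>k. d j k)"
      proof (intro allI impI)
        fix j assume j: "j < n"
        have "convergent (\<lambda>l. cis (2 * pi * d (j mod n) l / sden D (j div n)))" using * by blast
        then have "convergent (\<lambda>l. cis (2 * pi * d j l))" using j by simp
        moreover have "(\<lambda>i. 2 * pi * d j (Suc i) - 2 * pi * d j i) \<longlonglongrightarrow> 0"
        proof -
          have "(\<lambda>i. 2 * pi * (d j (Suc i) - d j i)) \<longlonglongrightarrow> 2 * pi * 0"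
            using * j by (intro tendsto_mult tendsto_const) blast
          then show ?thesis by (simp add: right_diff_distrib)
        qed
        ultimately have "convergent (\<lambda>l. 2 * pi * d j l)" by (intro convergent_lift_cis)
        then obtain L where "(\<lambda>l. 2 * pi * d j l) \<longlonglongrightarrow> L" unfolding convergent_def by blast
        then have "(\<lambda>l. 2 * pi * d j l / (2 * pi)) \<longlonglongrightarrow> L / (2 * pi)" by (intro tendsto_divide tendsto_const) auto
        then show "convergent (\<lambda>k. d j k)" unfolding convergent_def by auto
      qed
    qed
  qed
qed

subsection \<open>Generic points\<close>

text \<open>A closed set with empty interior is nowhere dense, so the union is meagre. The family is
  kept instead of the union because its members are translated later.\<close>

definition meagre_cover :: "'a topology \<Rightarrow> 'a set set \<Rightarrow> bool" where
  "meagre_cover X \<N> \<longleftrightarrow> countable \<N> \<and> (\<forall>T\<in>\<N>. closedin X T \<and> X interior_of T = {})"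

lemma interior_of_diff_interior_of: "X interior_of (T - X interior_of T) = {}"
proof -
  have "X interior_of (T - X interior_of T) \<subseteq> X interior_of T"
    by (rule interior_of_mono) auto
  moreover have "X interior_of (T - X interior_of T) \<subseteq> T - X interior_of T"
    by (rule interior_of_subset)
  ultimately show ?thesis by blast
qed

text \<open>Borel sets have the property of Baire. For complements, a closed set differs from its
  interior by a closed set with empty interior.\<close>

lemma borel_almost_open:
  assumes "B \<in> sets (borel_of X)"
  shows "\<exists>U \<N>. openin X U \<and> meagre_cover X \<N> \<and> (B - U) \<union> (U - B) \<subseteq> \<Union>\<N>"
  using assms unfolding sets_borel_of
proof (induction rule: sigma_sets.induct)
  case (Basic B)
  then show ?case by (intro exI[of _ B] exI[of _ "{}"]) (simp add: meagre_cover_def)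
next
  case Empty
  show ?case by (intro exI[of _ "{}"]) (simp add: meagre_cover_def)
next
  case (Compl B)
  then obtain U \<N> where U: "openin X U" "meagre_cover X \<N>" "(B - U) \<union> (U - B) \<subseteq> \<Union>\<N>"
    by blast
  define T where "T = topspace X - U"
  have "meagre_cover X (insert (T - X interior_of T) \<N>)"
    using U by (auto simp: meagre_cover_def interior_of_diff_interior_of T_def intro!: closedin_diff)
  moreover have "(topspace X - B - X interior_of T) \<union> (X interior_of T - (topspace X - B))
      \<subseteq> \<Union>(insert (T - X interior_of T) \<N>)"
    using U(3) interior_of_subset[of X T] unfolding T_def by blast
  ultimately show ?case
    by (intro exI[of _ "X interior_of T"] exI[of _ "insert (T - X interior_of T) \<N>"])
       simp
next
  case (Union B)
  then obtain U \<N> where U: "\<And>i::nat. openin X (U i)" "\<And>i. meagre_cover X (\<N> i)"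
      "\<And>i. (B i - U i) \<union> (U i - B i) \<subseteq> \<Union>(\<N> i)"
    by metis
  have "countable (\<Union>i. \<N> i)"
    by (rule countable_UN) (use U(2) in \<open>simp_all add: meagre_cover_def\<close>)
  moreover have "\<forall>T\<in>(\<Union>i. \<N> i). closedin X T \<and> X interior_of T = {}"
    using U(2) unfolding meagre_cover_def by blast
  ultimately have "meagre_cover X (\<Union>i. \<N> i)"
    unfolding meagre_cover_def by blast
  moreover have "((\<Union>i. B i) - (\<Union>i. U i)) \<union> ((\<Union>i. U i) - (\<Union>i. B i)) \<subseteq> \<Union>(\<Union>i. \<N> i)"
  proof
    fix y assume "y \<in> ((\<Union>i. B i) - (\<Union>i. U i)) \<union> ((\<Union>i. U i) - (\<Union>i. B i))"
    then obtain i where "y \<in> (B i - U i) \<union> (U i - B i)" by auto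
    then have "y \<in> \<Union>(\<N> i)" using U(3) by blast
    then show "y \<in> \<Union>(\<Union>i. \<N> i)" by auto
  qed
  ultimately show ?case
    by (intro exI[of _ "\<Union>i. U i"] exI[of _ "\<Union>i. \<N> i"] conjI openin_Union)
       (use U(1) in auto)
qed

text \<open>The rationals are discrete here, so neighbourhoods are cylinders and closeness means
  agreement on an initial segment.\<close>

definition rat_seqs :: "(nat \<Rightarrow> rat) topology" where
  "rat_seqs = product_topology (\<lambda>_. discrete_topology UNIV) UNIV"

lemma topspace_rat_seqs [simp]: "topspace rat_seqs = UNIV"
  by (simp add: rat_seqs_def)

lemma openin_rat_seqs_cylinder:
  assumes "openin rat_seqs U" "z \<in> U"
  obtains p where "\<And>y. (\<And>i. i < p \<Longrightarrow> y i = z i) \<Longrightarrow> y \<in> U"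
proof -
  obtain V where V: "finite {i. V i \<noteq> UNIV}" "z \<in> PiE UNIV V" "PiE UNIV V \<subseteq> U"
    using assms unfolding rat_seqs_def openin_product_topology_alt by auto
  obtain p where p: "\<And>i. V i \<noteq> UNIV \<Longrightarrow> i < p"
    using V(1) unfolding finite_nat_set_iff_bounded by blast
  show ?thesis
  proof
    fix y assume "\<And>i. i < p \<Longrightarrow> y i = z i"
    then have "y \<in> PiE UNIV V" using V(2) p by (force simp: PiE_iff)
    then show "y \<in> U" using V(3) by blast
  qed
qed

lemma continuous_map_from_rat_coordinate:
  "continuous_map rat_seqs (discrete_topology UNIV) (\<lambda>z. h (z i))"
proof -
  have "continuous_map rat_seqs (discrete_topology UNIV) (\<lambda>z. z i)"
    unfolding rat_seqs_def by (rule continuous_map_product_projection) simp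
  moreover have "continuous_map (discrete_topology UNIV) (discrete_topology UNIV) h"
    by simp
  ultimately show ?thesis
    using continuous_map_compose[of _ _ "\<lambda>z. z i" _ h] by (simp add: o_def)
qed

lemma continuous_map_rat_translation: "continuous_map rat_seqs rat_seqs (\<lambda>z i. z i + w i)"
proof -
  have "continuous_map rat_seqs (discrete_topology UNIV) (\<lambda>z. z k + w k)" for k
    by (rule continuous_map_from_rat_coordinate[of "\<lambda>t. t + w k"])
  then show ?thesis
    unfolding rat_seqs_def continuous_map_componentwise_UNIV by blast
qed

lemma completely_metrizable_rat_seqs: "completely_metrizable_space rat_seqs"
  unfolding rat_seqs_def
  by (simp add: completely_metrizable_space_product_topology completely_metrizable_space_discrete_topology)

lemma meagre_cover_translate:
  assumes "closedin rat_seqs T" "rat_seqs interior_of T = {}"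
  shows "closedin rat_seqs {z. (\<lambda>i. z i + w i) \<in> T} \<and>
    rat_seqs interior_of {z. (\<lambda>i. z i + w i) \<in> T} = {}"
proof
  show "closedin rat_seqs {z. (\<lambda>i. z i + w i) \<in> T}"
    using closedin_continuous_map_preimage[OF continuous_map_rat_translation assms(1), of w] by simp
  show "rat_seqs interior_of {z. (\<lambda>i. z i + w i) \<in> T} = {}"
  proof (rule ccontr)
    assume "rat_seqs interior_of {z. (\<lambda>i. z i + w i) \<in> T} \<noteq> {}"
    then obtain U z where U: "openin rat_seqs U" "z \<in> U" "U \<subseteq> {z. (\<lambda>i. z i + w i) \<in> T}"
      by (auto simp: interior_of_def)
    define U' where "U' = {y. (\<lambda>i. y i + - w i) \<in> U}"
    have "openin rat_seqs U'"
      using openin_continuous_map_preimage[OF continuous_map_rat_translation U(1), of "\<lambda>i. - w i"]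
      by (simp add: U'_def)
    moreover have "U' \<subseteq> T"
    proof
      fix y assume "y \<in> U'"
      then have "(\<lambda>i. y i + - w i) \<in> U" by (simp add: U'_def)
      then have "(\<lambda>i. (y i + - w i) + w i) \<in> T" using U(3) by blast
      then show "y \<in> T" by simp
    qed
    moreover have "(\<lambda>i. z i + w i) \<in> U'" using U(2) by (simp add: U'_def)
    ultimately show False using assms(2) by (auto simp: interior_of_def)
  qed
qed

text \<open>Outside the sets \<open>N k\<close>, each set in \<open>\<B>\<close> coincides with an
  open set. Countably many translates of countably many nowhere dense sets still leave a point, so
  all shifts of \<open>x\<close> by \<open>W\<close> can be kept outside at once.\<close>

lemma generic_point:
  assumes W: "countable W" and \<B>: "countable \<B>" "\<B> \<subseteq> sets (borel_of rat_seqs)"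
  shows "\<exists>(N :: nat \<Rightarrow> (nat \<Rightarrow> rat) set) x.
    (\<forall>k. closedin rat_seqs (N k)) \<and> (\<forall>w\<in>W. \<forall>k. (\<lambda>i. x i + w i) \<notin> N k) \<and>
    (\<forall>B\<in>\<B>. \<forall>z\<in>B. (\<forall>k. z \<notin> N k) \<longrightarrow>
       (\<exists>p. \<forall>y. (\<forall>k. y \<notin> N k) \<and> (\<forall>i<p. y i = z i) \<longrightarrow> y \<in> B))"
proof -
  have "\<forall>B\<in>\<B>. \<exists>U \<N>. openin rat_seqs U \<and> meagre_cover rat_seqs \<N> \<and> (B - U) \<union> (U - B) \<subseteq> \<Union>\<N>"
    using borel_almost_open \<B>(2) by blast
  then obtain U \<N> where U: "\<And>B. B \<in> \<B> \<Longrightarrow> openin rat_seqs (U B)"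
      "\<And>B. B \<in> \<B> \<Longrightarrow> meagre_cover rat_seqs (\<N> B)"
      "\<And>B. B \<in> \<B> \<Longrightarrow> (B - U B) \<union> (U B - B) \<subseteq> \<Union>(\<N> B)"
    by metis
  \<comment> \<open>The empty set is added so that the family can be enumerated by
    \<open>from_nat_into\<close> even if nothing else is in it.\<close>
  define \<M> where "\<M> = insert {} (\<Union>B\<in>\<B>. \<N> B)"
  have "countable (\<Union>B\<in>\<B>. \<N> B)"
    by (rule countable_UN[OF \<B>(1)]) (use U(2) in \<open>simp add: meagre_cover_def\<close>)
  then have \<M>: "countable \<M>" unfolding \<M>_def by (rule countable_insert)
  have \<M>_nd: "closedin rat_seqs T \<and> rat_seqs interior_of T = {}" if "T \<in> \<M>" for T
    using that U(2) unfolding \<M>_def meagre_cover_def by auto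
  define \<M>' where "\<M>' = (\<lambda>(T, w). {z. (\<lambda>i. z i + w i) \<in> T}) ` (\<M> \<times> W)"
  have "countable \<M>'" unfolding \<M>'_def using \<M> W by auto
  moreover have "closedin rat_seqs T \<and> rat_seqs interior_of T = {}" if "T \<in> \<M>'" for T
    using that \<M>_nd meagre_cover_translate by (auto simp: \<M>'_def)
  ultimately have "rat_seqs interior_of \<Union>\<M>' = {}"
    using completely_metrizable_rat_seqs by (intro Baire_category_alt) auto
  then have "\<Union>\<M>' \<noteq> UNIV"
    using interior_of_topspace[of rat_seqs] by auto
  then obtain x where x: "x \<notin> \<Union>\<M>'" by blast
  define N where "N = from_nat_into \<M>"
  have "\<M> \<noteq> {}" by (simp add: \<M>_def)
  then have N: "range N = \<M>" unfolding N_def using \<M> by (rule range_from_nat_into)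
  have 1: "closedin rat_seqs (N k)" for k
    using N \<M>_nd by auto
  have 2: "(\<lambda>i. x i + w i) \<notin> N k" if "w \<in> W" for w k
  proof -
    have "N k \<in> \<M>" using N by auto
    then have "{z. (\<lambda>i. z i + w i) \<in> N k} \<in> \<M>'" using that by (force simp: \<M>'_def)
    then show ?thesis using x by blast
  qed
  have 3: "\<exists>p. \<forall>y. (\<forall>k. y \<notin> N k) \<and> (\<forall>i<p. y i = z i) \<longrightarrow> y \<in> B"
    if B: "B \<in> \<B>" "z \<in> B" "\<forall>k. z \<notin> N k" for B z
  proof -
    have sub: "\<Union>(\<N> B) \<subseteq> (\<Union>k. N k)" using B(1) N by (auto simp: \<M>_def)
    then have "z \<in> U B" using U(3)[OF B(1)] B by blast
    then obtain p where p: "\<And>y. (\<And>i. i < p \<Longrightarrow> y i = z i) \<Longrightarrow> y \<in> U B"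
      using openin_rat_seqs_cylinder[OF U(1)[OF B(1)]] by metis
    have "y \<in> B" if "\<forall>k. y \<notin> N k" "\<forall>i<p. y i = z i" for y
      using p[of y] that sub U(3)[OF B(1)] by blast
    then show ?thesis by blast
  qed
  show ?thesis
    by (intro exI[of _ N] exI[of _ x] conjI allI ballI impI 1 2 3) blast+
qed

subsection \<open>From reductions to sequences of rationals\<close>

lemma openin_rat_seqsI:
  assumes "\<And>z. z \<in> U \<Longrightarrow> \<exists>p. \<forall>y. (\<forall>i<p. y i = z i) \<longrightarrow> y \<in> U"
  shows "openin rat_seqs U"
  unfolding rat_seqs_def openin_product_topology_alt
proof (intro ballI)
  fix z assume "z \<in> U"
  then obtain p where p: "\<And>y. (\<forall>i<p. y i = z i) \<Longrightarrow> y \<in> U" using assms by blast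
  define V where "V i = (if i < p then {z i} else UNIV)" for i
  have "{i. V i \<noteq> UNIV} \<subseteq> {..<p}" by (auto simp: V_def)
  then have "finite {i. V i \<noteq> UNIV}" by (rule finite_subset) simp
  moreover have "z \<in> PiE UNIV V" by (auto simp: PiE_iff V_def)
  moreover have "PiE UNIV V \<subseteq> U"
  proof
    fix y assume y: "y \<in> PiE UNIV V"
    have "y i = z i" if "i < p" for i
      using PiE_mem[OF y, of i] that by (simp add: V_def)
    then show "y \<in> U" using p by blast
  qed
  ultimately show "\<exists>V. finite {i \<in> UNIV. V i \<noteq> topspace (discrete_topology UNIV)} \<and>
      (\<forall>i\<in>UNIV. openin (discrete_topology UNIV) (V i)) \<and> z \<in> PiE UNIV V \<and> PiE UNIV V \<subseteq> U"
    by (intro exI[of _ V]) simp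
qed

lemma continuous_map_rat_seqs_local:
  assumes "\<And>y z. (\<forall>i<p. y i = z i) \<Longrightarrow> g y = g z"
  shows "continuous_map rat_seqs euclidean g"
  unfolding continuous_map_def
proof (intro conjI allI impI)
  fix U
  show "openin rat_seqs {z \<in> topspace rat_seqs. g z \<in> U}"
  proof (rule openin_rat_seqsI)
    fix z assume "z \<in> {z \<in> topspace rat_seqs. g z \<in> U}"
    then have "g y \<in> U" if "\<forall>i<p. y i = z i" for y using assms[OF that] by simp
    then show "\<exists>p. \<forall>y. (\<forall>i<p. y i = z i) \<longrightarrow> y \<in> {z \<in> topspace rat_seqs. g z \<in> U}" by auto
  qed
qed simp

text \<open>The partial sums run along the diagonal one-parameter subgroup. The variable is the
  sequence of increments, not of positions: changing one increment translates the tail and preserves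
  the class.\<close>

definition rat_walk :: "nat \<Rightarrow> nat set \<Rightarrow> (nat \<Rightarrow> rat) \<Rightarrow> nat \<Rightarrow> nat \<Rightarrow> complex" where
  "rat_walk n D z l = wind n D (\<lambda>_. of_rat (\<Sum>p<l. z p))"

lemma continuous_map_rat_walk:
  assumes "n > 0"
  shows "continuous_map rat_seqs (seq_space (solenoid n D)) (rat_walk n D)"
proof -
  have loc: "continuous_map rat_seqs euclidean (\<lambda>z. rat_walk n D z l m)" for l m
  proof (rule continuous_map_rat_seqs_local)
    fix y z :: "nat \<Rightarrow> rat" assume "\<forall>i<l. y i = z i"
    then have "(\<Sum>p<l. y p) = (\<Sum>p<l. z p)" by (intro sum.cong) auto
    then show "rat_walk n D y l m = rat_walk n D z l m" by (simp add: rat_walk_def)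
  qed
  have "continuous_map rat_seqs euclidean (\<lambda>z. rat_walk n D z l)" for l
    unfolding euclidean_product_topology[symmetric] continuous_map_componentwise_UNIV
    using loc by blast
  then have "continuous_map rat_seqs euclidean (rat_walk n D)"
    unfolding euclidean_product_topology[symmetric, where 'b = "nat \<Rightarrow> complex"]
      continuous_map_componentwise_UNIV by blast
  then show ?thesis
    unfolding seq_space_solenoid continuous_map_in_subtopology
    using wind_mem_solenoid_set[OF assms] by (auto simp: rat_walk_def)
qed

lemma conv_rel_rat_walk:
  assumes "n > 0"
  shows "(rat_walk n D y, rat_walk n D z) \<in> conv_rel (solenoid n D) \<longleftrightarrow>
    tconv D (\<lambda>i. \<Sum>p<i. y p - z p)"
proof -
  have eq: "rat_walk n D y l m / rat_walk n D z l m =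
      cis (2 * pi * of_rat (\<Sum>p<l. y p - z p) / sden D (m div n))" for l m
    by (simp add: rat_walk_def wind_def cis_divide sum_subtractf of_rat_diff
        diff_divide_distrib right_diff_distrib)
  have "(rat_walk n D y, rat_walk n D z) \<in> conv_rel (solenoid n D) \<longleftrightarrow>
      (\<forall>m. convergent (\<lambda>l. cis (2 * pi * of_rat (\<Sum>p<l. y p - z p) / sden D (m div n))))"
    unfolding conv_rel_solenoid eq using wind_mem_solenoid_set[OF assms] by (simp add: rat_walk_def)
  also have "\<dots> \<longleftrightarrow> tconv D (\<lambda>i. \<Sum>p<i. y p - z p)"
    unfolding tconv_def
  proof (intro iffI allI)
    fix k assume *: "\<forall>m. convergent (\<lambda>l. cis (2 * pi * of_rat (\<Sum>p<l. y p - z p) / sden D (m div n)))"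
    show "convergent (\<lambda>l. cis (2 * pi * of_rat (\<Sum>p<l. y p - z p) / sden D k))"
      using spec[OF *, of "k * n"] assms by simp
  qed blast
  finally show ?thesis .
qed

text \<open>Of a reduction only its composite with \<open>rat_walk\<close> is kept:
  \<open>f l m\<close> is coordinate \<open>m\<close> of the \<open>l\<close>-th term of the image,
  as a function of the increments.\<close>

locale rat_reduction =
  fixes n :: nat and D D' :: "nat set" and f :: "nat \<Rightarrow> nat \<Rightarrow> (nat \<Rightarrow> rat) \<Rightarrow> complex"
  assumes n_pos: "n > 0"
    and norm_f: "norm (f l m z) = 1"
    and f_step: "f l m z = f l (m + n) z ^ sfac D' (m div n)"
    and f_meas: "f l m \<in> borel_measurable (borel_of rat_seqs)"
    and f_red: "tconv D (\<lambda>i. \<Sum>p<i. y p - z p) \<longleftrightarrow> (\<forall>m. convergent (\<lambda>l. f l m y / f l m z))"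

lemma borel_of_euclidean: "borel_of (euclidean :: 'a::topological_space topology) = borel"
  by (simp add: borel_of_def borel_def)

lemma E_le_imp_rat_reduction:
  assumes n: "n > 0" and le: "E_le (solenoid n D) (solenoid n D')"
  shows "\<exists>f. rat_reduction n D D' f"
proof -
  let ?X = "seq_space (solenoid n D)" and ?Y = "seq_space (solenoid n D')"
  from le obtain \<theta> where \<theta>: "\<theta> \<in> borel_of ?X \<rightarrow>\<^sub>M borel_of ?Y"
    "\<forall>x\<in>topspace ?X. \<forall>y\<in>topspace ?X. (x, y) \<in> conv_rel (solenoid n D) \<longleftrightarrow> (\<theta> x, \<theta> y) \<in> conv_rel (solenoid n D')"
    unfolding E_le_def borel_reducible_def by blast
  have walk: "rat_walk n D z \<in> topspace ?X" for z
    using continuous_map_rat_walk[OF n, of D] by (auto simp: continuous_map_def Pi_iff)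
  have \<theta>m: "(\<lambda>z. \<theta> (rat_walk n D z)) \<in> borel_of rat_seqs \<rightarrow>\<^sub>M borel_of ?Y"
    using measurable_comp[OF measurable_continuous_map[OF continuous_map_rat_walk[OF n]] \<theta>(1)]
    by (simp add: o_def)
  have \<theta>s: "\<theta> (rat_walk n D z) l \<in> solenoid_set n D'" for z l
    using measurable_space[OF \<theta>(1), of "rat_walk n D z"] walk
    by (simp add: topspace_seq_space_solenoid)
  have "rat_reduction n D D' (\<lambda>l m z. \<theta> (rat_walk n D z) l m)"
  proof
    show "n > 0" by (rule n)
    show "norm (\<theta> (rat_walk n D z) l m) = 1" for l m z
      by (rule solenoid_set_norm[OF \<theta>s])
    show "\<theta> (rat_walk n D z) l m = \<theta> (rat_walk n D z) l (m + n) ^ sfac D' (m div n)" for l m z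
      by (rule solenoid_set_step[OF \<theta>s])
    show "(\<lambda>z. \<theta> (rat_walk n D z) l m) \<in> borel_measurable (borel_of rat_seqs)" for l m
    proof -
      have "continuous_on S (\<lambda>x. x l m)" for S :: "(nat \<Rightarrow> nat \<Rightarrow> complex) set"
        by (rule continuous_on_product_then_coordinatewise[OF continuous_on_product_then_coordinatewise[OF continuous_on_id]])
      then have "continuous_map ?Y euclidean (\<lambda>x. x l m)"
        unfolding seq_space_solenoid by simp
      then have "(\<lambda>x. x l m) \<in> borel_of ?Y \<rightarrow>\<^sub>M (borel :: complex measure)"
        using measurable_continuous_map borel_of_euclidean by metis
      from measurable_comp[OF \<theta>m this] show ?thesis by (simp add: o_def)
    qed
    show "tconv D (\<lambda>i. \<Sum>p<i. y p - z p) \<longleftrightarrow>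
        (\<forall>m. convergent (\<lambda>l. \<theta> (rat_walk n D y) l m / \<theta> (rat_walk n D z) l m))" for y z
    proof -
      have "tconv D (\<lambda>i. \<Sum>p<i. y p - z p) \<longleftrightarrow> (\<theta> (rat_walk n D y), \<theta> (rat_walk n D z)) \<in> conv_rel (solenoid n D')"
        using \<theta>(2) walk conv_rel_rat_walk[OF n] by blast
      then show ?thesis unfolding conv_rel_solenoid using \<theta>s by blast
    qed
  qed
  then show ?thesis by blast
qed

definition finite_diff :: "(nat \<Rightarrow> rat) \<Rightarrow> (nat \<Rightarrow> rat) \<Rightarrow> bool" where
  "finite_diff y z \<longleftrightarrow> finite {i. y i \<noteq> z i}"

lemma finite_diff_sym: "finite_diff y z \<Longrightarrow> finite_diff z y"
  unfolding finite_diff_def by (simp add: eq_commute)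

lemma finite_diff_trans:
  assumes "finite_diff x y" "finite_diff y z"
  shows "finite_diff x z"
proof -
  have "{i. x i \<noteq> z i} \<subseteq> {i. x i \<noteq> y i} \<union> {i. y i \<noteq> z i}" by auto
  then show ?thesis using assms unfolding finite_diff_def by (meson finite_UnI finite_subset)
qed

lemma finite_diff_refl [simp]: "finite_diff z z"
  by (simp add: finite_diff_def)

lemma finite_diff_upd [simp]: "finite_diff (z(i := t)) z"
  unfolding finite_diff_def by (rule finite_subset[of _ "{i}"]) auto

text \<open>After the last change the partial sums of the differences are constant. Hence finite
  alterations of a point lead to convergent quotients of images.\<close>

lemma tconv_finite_diff:
  assumes "finite_diff y z"
  shows "tconv D (\<lambda>i. \<Sum>p<i. y p - z p)"
proof -
  obtain q where q: "\<And>i. y i \<noteq> z i \<Longrightarrow> i < q"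
    using assms unfolding finite_diff_def finite_nat_set_iff_bounded by blast
  have "(\<Sum>p<i. y p - z p) = (\<Sum>p<q. y p - z p)" if "i \<ge> q" for i
    using that q by (intro sum.mono_neutral_right) force+
  then have "eventually (\<lambda>i. (\<Sum>p<i. y p - z p) = (\<Sum>p<q. y p - z p)) sequentially"
    unfolding eventually_sequentially by blast
  then have "(\<lambda>i. cis (2 * pi * of_rat (\<Sum>p<i. y p - z p) / sden D k)) \<longlonglongrightarrow>
      cis (2 * pi * of_rat (\<Sum>p<q. y p - z p) / sden D k)" for k
    by (intro tendsto_eventually) (auto elim: eventually_mono)
  then show ?thesis unfolding tconv_def convergent_def by blast
qed

context rat_reduction
begin

lemma f_nonzero [simp]: "f l m z \<noteq> 0"
  using norm_f[of l m z] by auto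

definition q :: "nat \<Rightarrow> nat \<Rightarrow> (nat \<Rightarrow> rat) \<Rightarrow> (nat \<Rightarrow> rat) \<Rightarrow> complex" where
  "q l m y z = f l m y / f l m z"

lemma norm_q [simp]: "norm (q l m y z) = 1"
  by (simp add: q_def norm_divide norm_f)

lemma q_self [simp]: "q l m z z = 1"
  by (simp add: q_def)

lemma q_step: "q l m y z = q l (m + n) y z ^ sfac D' (m div n)"
  using f_step[of l m y] f_step[of l m z] by (simp only: q_def power_divide)

lemma convergent_q: "finite_diff y z \<Longrightarrow> convergent (\<lambda>l. q l m y z)"
  using f_red tconv_finite_diff unfolding q_def by blast

text \<open>The Cauchy condition for the pair \<open>y\<close>, \<open>y + w\<close> with explicit
  bounds. As a Borel condition on \<open>y\<close> it persists near generic points, which makes the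
  index \<open>L\<close> locally uniform although convergence itself is only pointwise.\<close>

definition osc :: "(nat \<Rightarrow> rat) \<Rightarrow> (nat \<Rightarrow> rat) \<Rightarrow> nat \<Rightarrow> nat \<Rightarrow> real \<Rightarrow> bool" where
  "osc y w m L e \<longleftrightarrow> (\<forall>l\<ge>L. \<forall>l'\<ge>L. norm (q l m y (\<lambda>i. y i + w i) - q l' m y (\<lambda>i. y i + w i)) \<le> e)"

lemma osc_measurable: "{y. osc y w m L e} \<in> sets (borel_of rat_seqs)"
proof -
  have fm [measurable]: "f l m \<in> borel_measurable (borel_of rat_seqs)" for l m by (rule f_meas)
  have [measurable]: "(\<lambda>y. f l m (\<lambda>i. y i + w i)) \<in> borel_measurable (borel_of rat_seqs)" for l m
    using measurable_comp[OF measurable_continuous_map[OF continuous_map_rat_translation] f_meas]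
    by (simp add: o_def)
  have "{y \<in> space (borel_of rat_seqs). osc y w m L e} \<in> sets (borel_of rat_seqs)"
    unfolding osc_def q_def by measurable
  then show ?thesis by simp
qed

text \<open>Applied to preimages of a countable base, genericity gives continuity of all
  \<open>f l m\<close>; applied to the oscillation sets, it gives stability of the bounds. Both are
  countable families because alterations have finite support.\<close>

lemma generic_exists:
  "\<exists>(N :: nat \<Rightarrow> (nat \<Rightarrow> rat) set) x. (\<forall>k. closedin rat_seqs (N k)) \<and> (\<forall>z k. finite_diff z x \<longrightarrow> z \<notin> N k) \<and>
    (\<forall>z l m e. (\<forall>k. z \<notin> N k) \<longrightarrow> e > 0 \<longrightarrow>
       (\<exists>p. \<forall>y. (\<forall>k. y \<notin> N k) \<and> (\<forall>i<p. y i = z i) \<longrightarrow> norm (f l m y - f l m z) \<le> e)) \<and>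
    (\<forall>z w m L j. (\<forall>k. z \<notin> N k) \<longrightarrow> finite_diff w (\<lambda>_. 0) \<longrightarrow> osc z w m L ((1/2)^j) \<longrightarrow>
       (\<exists>p. \<forall>y. (\<forall>k. y \<notin> N k) \<and> (\<forall>i<p. y i = z i) \<longrightarrow> osc y w m L ((1/2)^j)))"
proof -
  \<comment> \<open>Finitely supported sequences are listed through finite lists, which makes their
    countability immediate.\<close>
  define W :: "(nat \<Rightarrow> rat) set" where "W = range (\<lambda>xs i. if i < length xs then xs ! i else 0)"
  have W: "countable W" unfolding W_def by (rule countable_image) (rule countableI_type)
  have inW: "w \<in> W" if w: "finite_diff w (\<lambda>_. 0)" for w
  proof -
    obtain r where r: "\<And>i. w i \<noteq> 0 \<Longrightarrow> i < r"
      using w unfolding finite_diff_def finite_nat_set_iff_bounded by blast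
    have "w = (\<lambda>i. if i < length (map w [0..<r]) then map w [0..<r] ! i else 0)"
      using r by (auto simp: fun_eq_iff)
    then show ?thesis unfolding W_def by blast
  qed
  obtain V :: "complex set set" where V: "countable V" "topological_basis V"
    using ex_countable_basis by blast
  define \<B>1 where "\<B>1 = (\<lambda>(l, m, U). {z. f l m z \<in> U}) ` (UNIV \<times> UNIV \<times> V)"
  define \<B>2 where "\<B>2 = (\<lambda>(w, m, L, j). {z. osc z w m L ((1/2)^j)}) ` (W \<times> UNIV \<times> UNIV \<times> UNIV)"
  have cB: "countable (\<B>1 \<union> \<B>2)"
    unfolding \<B>1_def \<B>2_def
    by (intro countable_Un countable_image countable_SIGMA countableI_type V(1) W)
  have sB: "\<B>1 \<union> \<B>2 \<subseteq> sets (borel_of rat_seqs)"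
  proof -
    have "{z. f l m z \<in> U} \<in> sets (borel_of rat_seqs)" if "U \<in> V" for l m U
    proof -
      have "open U" using V(2) that by (rule topological_basis_open)
      then have "f l m -` U \<inter> space (borel_of rat_seqs) \<in> sets (borel_of rat_seqs)"
        by (intro measurable_sets[OF f_meas] borel_open)
      moreover have "f l m -` U \<inter> space (borel_of rat_seqs) = {z. f l m z \<in> U}" by auto
      ultimately show ?thesis by simp
    qed
    then show ?thesis using osc_measurable by (auto simp: \<B>1_def \<B>2_def)
  qed
  obtain N :: "nat \<Rightarrow> (nat \<Rightarrow> rat) set" and x where N: "\<forall>k. closedin rat_seqs (N k)"
    and x: "\<forall>w\<in>W. \<forall>k. (\<lambda>i. x i + w i) \<notin> N k"
    and gen: "\<forall>B\<in>\<B>1 \<union> \<B>2. \<forall>z\<in>B. (\<forall>k. z \<notin> N k) \<longrightarrow>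
       (\<exists>p. \<forall>y. (\<forall>k. y \<notin> N k) \<and> (\<forall>i<p. y i = z i) \<longrightarrow> y \<in> B)"
    using generic_point[OF W cB sB] by (elim exE conjE) 
  have 1: "z \<notin> N k" if "finite_diff z x" for z k
  proof -
    have "finite_diff (\<lambda>i. z i - x i) (\<lambda>_. 0)" using that by (simp add: finite_diff_def)
    from x[rule_format, OF inW[OF this], of k] show ?thesis by simp
  qed
  have 2: "\<exists>p. \<forall>y. (\<forall>k. y \<notin> N k) \<and> (\<forall>i<p. y i = z i) \<longrightarrow> norm (f l m y - f l m z) \<le> e"
    if z: "\<forall>k. z \<notin> N k" and e: "e > 0" for z l m e
  proof -
    obtain U where U: "U \<in> V" "f l m z \<in> U" "U \<subseteq> ball (f l m z) e"
      using topological_basisE[OF V(2) open_ball, of "f l m z" "f l m z" e] e by auto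
    have "{z. f l m z \<in> U} \<in> \<B>1 \<union> \<B>2" using U(1) by (auto simp: \<B>1_def)
    then have "\<exists>p. \<forall>y. (\<forall>k. y \<notin> N k) \<and> (\<forall>i<p. y i = z i) \<longrightarrow> y \<in> {z. f l m z \<in> U}"
      by (rule gen[rule_format]) (simp_all add: U(2) z)
    then obtain p where p: "\<forall>y. (\<forall>k. y \<notin> N k) \<and> (\<forall>i<p. y i = z i) \<longrightarrow> f l m y \<in> U"
      unfolding mem_Collect_eq by (elim exE)
    have "norm (f l m y - f l m z) \<le> e" if "f l m y \<in> U" for y
    proof -
      have "f l m y \<in> ball (f l m z) e" using U(3) that by blast
      then show ?thesis by (simp add: dist_norm norm_minus_commute)
    qed
    with p show ?thesis by (intro exI[of _ p]) simp
  qed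
  have 3: "\<exists>p. \<forall>y. (\<forall>k. y \<notin> N k) \<and> (\<forall>i<p. y i = z i) \<longrightarrow> osc y w m L ((1/2)^j)"
    if "\<forall>k. z \<notin> N k" "finite_diff w (\<lambda>_. 0)" "osc z w m L ((1/2)^j)" for z w m L j
  proof -
    have "{z. osc z w m L ((1/2)^j)} \<in> \<B>1 \<union> \<B>2" using inW[OF that(2)] by (auto simp: \<B>2_def)
    then have "\<exists>p. \<forall>y. (\<forall>k. y \<notin> N k) \<and> (\<forall>i<p. y i = z i) \<longrightarrow> y \<in> {z. osc z w m L ((1/2)^j)}"
      by (rule gen[rule_format]) (simp_all add: that)
    then show ?thesis unfolding mem_Collect_eq .
  qed
  show ?thesis
    by (intro exI[of _ N] exI[of _ x] conjI N; intro allI impI) (rule 1 2 3; assumption)+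
qed

end

subsection \<open>Choosing blocks\<close>

definition agree :: "nat \<Rightarrow> (nat \<Rightarrow> rat) \<Rightarrow> (nat \<Rightarrow> rat) \<Rightarrow> bool" where
  "agree p y z \<longleftrightarrow> (\<forall>i<p. y i = z i)"

lemma agree_mono: "agree j y z \<Longrightarrow> p \<le> j \<Longrightarrow> agree p y z"
  by (simp add: agree_def)

text \<open>Finite sets that grow to all rationals. Finiteness leaves finitely many requirements at
  each stage, and 0 permits leaving a position unchanged.\<close>

definition alphabet :: "nat \<Rightarrow> rat set" where
  "alphabet i = insert 0 (from_nat ` {..i})"

lemma finite_alphabet [simp]: "finite (alphabet i)"
  by (simp add: alphabet_def)

lemma zero_mem_alphabet [simp]: "0 \<in> alphabet i"
  by (simp add: alphabet_def)

lemma mem_alphabet: "to_nat a \<le> i \<Longrightarrow> a \<in> alphabet i"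
  unfolding alphabet_def by (intro insertI2 image_eqI[of _ _ "to_nat a"]) simp_all

lemma unit_quotient_diff:
  fixes a b a' b' :: complex
  assumes "norm a = 1" "norm b = 1" "norm a' = 1" "norm b' = 1"
  shows "norm (a / b - a' / b') \<le> norm (a - a') + norm (b - b')"
proof -
  have nz: "b \<noteq> 0" "b' \<noteq> 0" using assms by auto
  have "a / b - a' / b' = (a - a') / b + a' * (b' - b) / (b * b')"
    using nz by (simp add: field_simps)
  then have "norm (a / b - a' / b') \<le> norm ((a - a') / b) + norm (a' * (b' - b) / (b * b'))"
    by (simp add: norm_triangle_ineq)
  also have "\<dots> = norm (a - a') + norm (b - b')"
    using assms by (simp add: norm_divide norm_mult norm_minus_commute)
  finally show ?thesis .
qed

locale generic_reduction = rat_reduction +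
  fixes N :: "nat \<Rightarrow> (nat \<Rightarrow> rat) set" and x :: "nat \<Rightarrow> rat"
  assumes N_closed: "closedin rat_seqs (N k)"
    and generic: "finite_diff z x \<Longrightarrow> z \<notin> N k"
    and f_cont: "\<forall>k. z \<notin> N k \<Longrightarrow> e > 0 \<Longrightarrow>
      \<exists>p. \<forall>y. (\<forall>k. y \<notin> N k) \<and> (\<forall>i<p. y i = z i) \<longrightarrow> norm (f l m y - f l m z) \<le> e"
    and osc_cont: "\<forall>k. z \<notin> N k \<Longrightarrow> finite_diff w (\<lambda>_. 0) \<Longrightarrow> osc z w m L ((1/2)^j) \<Longrightarrow>
      \<exists>p. \<forall>y. (\<forall>k. y \<notin> N k) \<and> (\<forall>i<p. y i = z i) \<longrightarrow> osc y w m L ((1/2)^j)"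
begin

definition gen :: "(nat \<Rightarrow> rat) \<Rightarrow> bool" where
  "gen z \<longleftrightarrow> (\<forall>k. z \<notin> N k)"

lemma gen_finite_diff: "finite_diff z x \<Longrightarrow> gen z"
  unfolding gen_def using generic by blast

lemma eventually_f_close:
  assumes "gen z" "e > 0"
  shows "eventually (\<lambda>j. \<forall>y. gen y \<and> agree j y z \<longrightarrow> norm (f l m y - f l m z) \<le> e) sequentially"
proof -
  obtain p where p: "\<forall>y. gen y \<and> agree p y z \<longrightarrow> norm (f l m y - f l m z) \<le> e"
    using f_cont[OF assms(1)[unfolded gen_def] assms(2), of l m] unfolding gen_def agree_def by (elim exE)
  show ?thesis
    using eventually_ge_at_top[of p] by eventually_elim (use p agree_mono in blast)
qed

lemma eventually_osc:
  assumes "gen z" "finite_diff w (\<lambda>_. 0)" "osc z w m L ((1/2)^i)"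
  shows "eventually (\<lambda>j. \<forall>y. gen y \<and> agree j y z \<longrightarrow> osc y w m L ((1/2)^i)) sequentially"
proof -
  obtain p where p: "\<forall>y. gen y \<and> agree p y z \<longrightarrow> osc y w m L ((1/2)^i)"
    using osc_cont[OF assms(1)[unfolded gen_def] assms(2,3)] unfolding gen_def agree_def by (elim exE)
  show ?thesis
    using eventually_ge_at_top[of p] by eventually_elim (use p agree_mono in blast)
qed

lemma eventually_notin_N:
  assumes "gen z"
  shows "eventually (\<lambda>j. \<forall>y. agree j y z \<longrightarrow> y \<notin> N k) sequentially"
proof -
  have "openin rat_seqs (UNIV - N k)" using N_closed[of k] by (simp add: closedin_def)
  moreover have "z \<in> UNIV - N k" using assms by (simp add: gen_def)
  ultimately obtain p where p: "\<And>y. (\<And>i. i < p \<Longrightarrow> y i = z i) \<Longrightarrow> y \<in> UNIV - N k"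
    using openin_rat_seqs_cylinder[of "UNIV - N k" z] by metis
  show ?thesis
    using eventually_ge_at_top[of p]
  proof eventually_elim
    case (elim j)
    have "y \<notin> N k" if "agree j y z" for y
      using p[of y] agree_mono[OF that elim] by (simp add: agree_def)
    then show ?case by blast
  qed
qed

text \<open>The limiting effect on the image of adding \<open>a\<close> to the increment at position
  \<open>j\<close> of the generic point. The limit exists because the two points differ
  finitely.\<close>

definition alpha :: "nat \<Rightarrow> rat \<Rightarrow> nat \<Rightarrow> complex" where
  "alpha m a j = lim (\<lambda>l. q l m (x(j := x j + a)) x)"

lemma alpha_tendsto: "(\<lambda>l. q l m (x(j := x j + a)) x) \<longlonglongrightarrow> alpha m a j"
  unfolding alpha_def using convergent_q[of "x(j := x j + a)" x m] by (simp add: convergent_LIMSEQ_iff)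

lemma norm_alpha: "norm (alpha m a j) = 1"
  using tendsto_norm[OF alpha_tendsto[of m j a]] by (simp add: LIMSEQ_const_iff)

lemma alpha_0: "alpha m 0 j = 1"
  using alpha_tendsto[of m j 0] by (simp add: LIMSEQ_const_iff)

lemma alpha_step: "alpha m a j = alpha (m + n) a j ^ sfac D' (m div n)"
proof (rule LIMSEQ_unique[OF alpha_tendsto])
  show "(\<lambda>l. q l m (x(j := x j + a)) x) \<longlonglongrightarrow> alpha (m + n) a j ^ sfac D' (m div n)"
    unfolding q_step[of _ m] by (intro tendsto_power alpha_tendsto)
qed

text \<open>The indices \<open>(m, a)\<close> are countable, so a product of circles over them is
  sequentially compact; along a subsequence of positions all effects converge at once.\<close>

lemma alpha_subseq:
  obtains J c where "strict_mono (J :: nat \<Rightarrow> nat)" "\<forall>m a. (\<lambda>k. alpha m a (J k)) \<longlonglongrightarrow> c m a"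
proof -
  define s where "s j = (\<lambda>p. alpha (fst p) (snd p) j)" for j
  have "seq_compact {g :: nat \<times> rat \<Rightarrow> complex. \<forall>p. norm (g p) = 1}"
    using compact_torus compact_eq_seq_compact_metric by blast
  moreover have "\<forall>j. s j \<in> {g. \<forall>p. norm (g p) = 1}" by (simp add: s_def norm_alpha)
  ultimately obtain l J where J: "strict_mono J" "(s \<circ> J) \<longlonglongrightarrow> l"
    unfolding seq_compact_def by blast
  have "(\<lambda>k. (s \<circ> J) k (m, a)) \<longlonglongrightarrow> l (m, a)" for m a
    using J(2) unfolding tendsto_fun_iff by blast
  then show ?thesis by (intro that[of J "\<lambda>m a. l (m, a)"] J(1)) (simp add: s_def)
qed

lemma eventually_osc_start:
  assumes "finite S" "\<forall>z\<in>S. finite_diff z x" "e > 0"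
  shows "eventually (\<lambda>L. \<forall>z\<in>S. \<forall>z'\<in>S. \<forall>m\<in>{..i}. osc z (\<lambda>p. z' p - z p) m L e) sequentially"
proof (intro eventually_ball_finite ballI assms(1) finite_atMost)
  fix z z' m assume z: "z \<in> S" "z' \<in> S"
  have "finite_diff z z'" using assms(2) z by (meson finite_diff_sym finite_diff_trans)
  then have "Cauchy (\<lambda>l. q l m z z')" by (intro convergent_Cauchy convergent_q)
  then obtain M where M: "\<And>l l'. l \<ge> M \<Longrightarrow> l' \<ge> M \<Longrightarrow> norm (q l m z z' - q l' m z z') < e"
    using CauchyD assms(3) by blast
  show "eventually (\<lambda>L. osc z (\<lambda>p. z' p - z p) m L e) sequentially"
    using eventually_ge_at_top[of M]
  proof eventually_elim
    case (elim L)
    then show ?case unfolding osc_def using M by (simp add: less_imp_le)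
  qed
qed

text \<open>What makes position \<open>j\<close> far enough out at stage \<open>i\<close>: whatever
  happens from \<open>j\<close> on, oscillation bounds survive, outputs up to time \<open>L\<close>
  hardly change, and \<open>N i\<close> is missed.\<close>

definition stage_ok :: "nat \<Rightarrow> (nat \<Rightarrow> rat) set \<Rightarrow> nat \<Rightarrow> nat \<Rightarrow> bool" where
  "stage_ok i S L j \<longleftrightarrow>
     (\<forall>z\<in>S. \<forall>z'\<in>S. \<forall>m\<in>{..i}. \<forall>y. gen y \<and> agree j y z \<longrightarrow> osc y (\<lambda>p. z' p - z p) m L ((1/2)^i)) \<and>
     (\<forall>z\<in>S. \<forall>l\<in>{..L}. \<forall>m\<in>{..i}. \<forall>y. gen y \<and> agree j y z \<longrightarrow> norm (f l m y - f l m z) \<le> (1/2)^i) \<and>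
     (\<forall>z\<in>S. \<forall>y. agree j y z \<longrightarrow> y \<notin> N i)"

lemma eventually_stage_ok:
  assumes S: "finite S" "\<forall>z\<in>S. finite_diff z x"
    and L: "\<forall>z\<in>S. \<forall>z'\<in>S. \<forall>m\<in>{..i}. osc z (\<lambda>p. z' p - z p) m L ((1/2)^i)"
  shows "eventually (stage_ok i S L) sequentially"
proof -
  have g: "gen z" if "z \<in> S" for z using S(2) that gen_finite_diff by blast
  have fd: "finite_diff (\<lambda>p. z' p - z p) (\<lambda>_. 0)" if "z \<in> S" "z' \<in> S" for z z'
  proof -
    have "finite_diff z' z" using S(2) that by (meson finite_diff_sym finite_diff_trans)
    then show ?thesis by (simp add: finite_diff_def)
  qed
  have "eventually (\<lambda>j. \<forall>z\<in>S. \<forall>z'\<in>S. \<forall>m\<in>{..i}. \<forall>y. gen y \<and> agree j y z \<longrightarrow>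
      osc y (\<lambda>p. z' p - z p) m L ((1/2)^i)) sequentially"
    using L by (intro eventually_ball_finite ballI S(1) finite_atMost eventually_osc g fd) auto
  moreover have "eventually (\<lambda>j. \<forall>z\<in>S. \<forall>l\<in>{..L}. \<forall>m\<in>{..i}. \<forall>y. gen y \<and> agree j y z \<longrightarrow>
      norm (f l m y - f l m z) \<le> (1/2)^i) sequentially"
    by (intro eventually_ball_finite ballI S(1) finite_atMost eventually_f_close g) auto
  moreover have "eventually (\<lambda>j. \<forall>z\<in>S. \<forall>y. agree j y z \<longrightarrow> y \<notin> N i) sequentially"
    by (intro eventually_ball_finite ballI S(1) eventually_notin_N g)
  ultimately show ?thesis
    unfolding stage_ok_def by eventually_elim blast
qed

definition next_points :: "nat \<Rightarrow> (nat \<Rightarrow> rat) set \<Rightarrow> nat \<Rightarrow> (nat \<Rightarrow> rat) set" where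
  "next_points i S j = (\<lambda>(z, a). z(j := z j + a)) ` (S \<times> alphabet i)"

text \<open>Times and positions are chosen alternately. First \<open>L\<close> is late enough for
  all pairs from the finite set \<open>S\<close> to have settled, then \<open>j\<close> is far
  enough out for changes there to be invisible up to \<open>L\<close>. The error 2 adds the distance
  from \<open>q\<close> to \<open>alpha\<close> and that from \<open>alpha\<close> to
  \<open>c\<close>.\<close>

lemma blocks_exist:
  assumes J: "strict_mono (J :: nat \<Rightarrow> nat)" and c: "\<And>m a. (\<lambda>k. alpha m a (J k)) \<longlonglongrightarrow> c m a"
  shows "\<exists>S L j. \<forall>i. finite (S i) \<and> x \<in> S i \<and> (\<forall>z\<in>S i. finite_diff z x) \<and> stage_ok i (S i) (L i) (j i) \<and>
    S (Suc i) = next_points i (S i) (j i) \<and> L i < L (Suc i) \<and> j i < j (Suc i) \<and>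
    (\<forall>a\<in>alphabet i. \<forall>m\<in>{..i}. norm (q (L (Suc i)) m (x(j i := x (j i) + a)) x - c m a) \<le> 2 * (1/2)^i)"
proof -
  \<comment> \<open>\<open>P\<close> is the invariant of a single stage. The time at which a change
    at \<open>j\<close> has settled belongs to the following stage, so that condition is put into
    the transition \<open>Q\<close>.\<close>
  define P where "P i s \<longleftrightarrow> (case s of (S, L, j) \<Rightarrow> finite S \<and> x \<in> S \<and> (\<forall>z\<in>S. finite_diff z x) \<and>
     stage_ok i S L j \<and> (\<forall>a\<in>alphabet i. \<forall>m\<in>{..i}. norm (alpha m a j - c m a) \<le> (1/2)^i))"
    for i :: nat and s :: "(nat \<Rightarrow> rat) set \<times> nat \<times> nat"
  define Q where "Q i s s' \<longleftrightarrow> (case s of (S, L, j) \<Rightarrow> case s' of (S', L', j') \<Rightarrow>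
     S' = next_points i S j \<and> L < L' \<and> j < j' \<and>
     (\<forall>a\<in>alphabet i. \<forall>m\<in>{..i}. norm (q L' m (x(j := x j + a)) x - alpha m a j) \<le> (1/2)^i))"
    for i :: nat and s s' :: "(nat \<Rightarrow> rat) set \<times> nat \<times> nat"
  have close: "eventually (\<lambda>k. norm (s k - l) \<le> (1/2)^i) sequentially"
    if "s \<longlonglongrightarrow> l" for s and l :: complex and i :: nat
    using tendstoD[OF that, of "(1/2)^i"] by (auto simp: dist_norm elim: eventually_mono)
  \<comment> \<open>Candidates are the values of \<open>J\<close>, along which the single effects
    approach \<open>c\<close>; all other requirements hold for large positions anyway.\<close>
  have pick_j: "\<exists>j>j0. stage_ok i S L j \<and> (\<forall>a\<in>alphabet i. \<forall>m\<in>{..i}. norm (alpha m a j - c m a) \<le> (1/2)^i)"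
    if S: "finite S" "\<forall>z\<in>S. finite_diff z x"
      and L: "\<forall>z\<in>S. \<forall>z'\<in>S. \<forall>m\<in>{..i}. osc z (\<lambda>p. z' p - z p) m L ((1/2)^i)" for i S L j0
  proof -
    have Jlim: "filterlim J sequentially sequentially" using J by (rule filterlim_subseq)
    have "eventually (\<lambda>k. \<forall>a\<in>alphabet i. \<forall>m\<in>{..i}. norm (alpha m a (J k) - c m a) \<le> (1/2)^i) sequentially"
      by (intro eventually_ball_finite ballI finite_alphabet finite_atMost close c)
    moreover have "eventually (\<lambda>k. stage_ok i S L (J k)) sequentially"
      using eventually_stage_ok[OF S L] Jlim by (rule eventually_compose_filterlim)
    moreover have "eventually (\<lambda>k. j0 < J k) sequentially"
      using eventually_gt_at_top[of j0] Jlim by (rule eventually_compose_filterlim)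
    ultimately have "eventually (\<lambda>k. j0 < J k \<and> stage_ok i S L (J k) \<and>
        (\<forall>a\<in>alphabet i. \<forall>m\<in>{..i}. norm (alpha m a (J k) - c m a) \<le> (1/2)^i)) sequentially"
      by eventually_elim blast
    then obtain k where "j0 < J k \<and> stage_ok i S L (J k) \<and>
        (\<forall>a\<in>alphabet i. \<forall>m\<in>{..i}. norm (alpha m a (J k) - c m a) \<le> (1/2)^i)"
      using eventually_happens'[OF sequentially_bot] by blast
    then show ?thesis by blast
  qed
  have "\<exists>s. \<forall>i. P i (s i) \<and> Q i (s i) (s (Suc i))"
  proof (rule dependent_nat_choice)
    have S: "finite {x}" "\<forall>z\<in>{x}. finite_diff z x" by simp_all
    obtain L where L: "\<forall>z\<in>{x}. \<forall>z'\<in>{x}. \<forall>m\<in>{..0}. osc z (\<lambda>p. z' p - z p) m L ((1/2)^0)"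
      using eventually_happens'[OF sequentially_bot eventually_osc_start[OF S, of "(1/2)^0" 0]] by auto
    obtain j where "stage_ok 0 {x} L j" "\<forall>a\<in>alphabet 0. \<forall>m\<in>{..0}. norm (alpha m a j - c m a) \<le> (1/2)^0"
      using pick_j[OF S L, of 0] by blast
    then have "P 0 ({x}, L, j)" unfolding P_def by simp
    then show "\<exists>s. P 0 s" by blast
  next
    fix s i assume Ps: "P i s"
    obtain S L j where s: "s = (S, L, j)" by (cases s) auto
    have S: "finite S" "x \<in> S" "\<forall>z\<in>S. finite_diff z x" using Ps unfolding P_def s by simp_all
    define S' where "S' = next_points i S j"
    have fS': "finite S'" unfolding S'_def next_points_def using S(1) by simp
    have xS': "x \<in> S'" unfolding S'_def next_points_def
      by (rule image_eqI[of _ _ "(x, 0)"]) (simp_all add: S(2))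
    have dS': "\<forall>z\<in>S'. finite_diff z x"
    proof
      fix z assume "z \<in> S'"
      then obtain y a where "y \<in> S" "z = y(j := y j + a)" unfolding S'_def next_points_def by auto
      then show "finite_diff z x" using S(3) finite_diff_trans[OF finite_diff_upd] by blast
    qed
    have "eventually (\<lambda>l. \<forall>a\<in>alphabet i. \<forall>m\<in>{..i}. norm (q l m (x(j := x j + a)) x - alpha m a j) \<le> (1/2)^i) sequentially"
      by (intro eventually_ball_finite ballI finite_alphabet finite_atMost close alpha_tendsto)
    moreover have "eventually (\<lambda>L. \<forall>z\<in>S'. \<forall>z'\<in>S'. \<forall>m\<in>{..Suc i}. osc z (\<lambda>p. z' p - z p) m L ((1/2)^Suc i)) sequentially"
      by (rule eventually_osc_start[OF fS' dS']) simp
    ultimately have "eventually (\<lambda>l. L < l \<and> (\<forall>a\<in>alphabet i. \<forall>m\<in>{..i}. norm (q l m (x(j := x j + a)) x - alpha m a j) \<le> (1/2)^i) \<and>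
        (\<forall>z\<in>S'. \<forall>z'\<in>S'. \<forall>m\<in>{..Suc i}. osc z (\<lambda>p. z' p - z p) m l ((1/2)^Suc i))) sequentially"
      using eventually_gt_at_top[of L] by eventually_elim blast
    then obtain L' where L': "L < L'"
        "\<forall>a\<in>alphabet i. \<forall>m\<in>{..i}. norm (q L' m (x(j := x j + a)) x - alpha m a j) \<le> (1/2)^i"
        "\<forall>z\<in>S'. \<forall>z'\<in>S'. \<forall>m\<in>{..Suc i}. osc z (\<lambda>p. z' p - z p) m L' ((1/2)^Suc i)"
      using eventually_happens'[OF sequentially_bot] by blast
    obtain j' where j': "j < j'" "stage_ok (Suc i) S' L' j'"
        "\<forall>a\<in>alphabet (Suc i). \<forall>m\<in>{..Suc i}. norm (alpha m a j' - c m a) \<le> (1/2)^Suc i"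
      using pick_j[OF fS' dS' L'(3), of j] by blast
    have "P (Suc i) (S', L', j')" unfolding P_def using fS' xS' dS' j' by simp
    moreover have "Q i s (S', L', j')" unfolding Q_def s using L' j'(1) by (simp add: S'_def)
    ultimately show "\<exists>s'. P (Suc i) s' \<and> Q i s s'" by blast
  qed
  then obtain s where s: "\<And>i. P i (s i)" "\<And>i. Q i (s i) (s (Suc i))" by blast
  define S where "S i = fst (s i)" for i
  define L where "L i = fst (snd (s i))" for i
  define j where "j i = snd (snd (s i))" for i
  have s_eq: "s i = (S i, L i, j i)" for i by (simp add: S_def L_def j_def)
  have Pi: "finite (S i)" "x \<in> S i" "\<forall>z\<in>S i. finite_diff z x" "stage_ok i (S i) (L i) (j i)"
     "\<forall>a\<in>alphabet i. \<forall>m\<in>{..i}. norm (alpha m a (j i) - c m a) \<le> (1/2)^i" for i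
    using s(1)[of i] unfolding P_def s_eq by simp_all
  have Qi: "S (Suc i) = next_points i (S i) (j i)" "L i < L (Suc i)" "j i < j (Suc i)"
     "\<forall>a\<in>alphabet i. \<forall>m\<in>{..i}. norm (q (L (Suc i)) m (x(j i := x (j i) + a)) x - alpha m a (j i)) \<le> (1/2)^i" for i
    using s(2)[of i] unfolding Q_def s_eq by simp_all
  have "norm (q (L (Suc i)) m (x(j i := x (j i) + a)) x - c m a) \<le> 2 * (1/2)^i"
    if "a \<in> alphabet i" "m \<in> {..i}" for i a m
  proof -
    have "norm (q (L (Suc i)) m (x(j i := x (j i) + a)) x - c m a)
        \<le> norm (q (L (Suc i)) m (x(j i := x (j i) + a)) x - alpha m a (j i)) + norm (alpha m a (j i) - c m a)"
      by (rule norm_diff_triangle_le) auto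
    moreover have "norm (q (L (Suc i)) m (x(j i := x (j i) + a)) x - alpha m a (j i)) \<le> (1/2)^i"
      using Qi(4)[of i] that by blast
    moreover have "norm (alpha m a (j i) - c m a) \<le> (1/2)^i"
      using Pi(5)[of i] that by blast
    ultimately show ?thesis by simp
  qed
  then show ?thesis
    by (intro exI[of _ S] exI[of _ L] exI[of _ j] allI conjI ballI Pi Qi) auto
qed

end

subsection \<open>Rigidity\<close>

definition place :: "(nat \<Rightarrow> nat) \<Rightarrow> (nat \<Rightarrow> rat) \<Rightarrow> nat \<Rightarrow> rat" where
  "place \<sigma> a p = (if p \<in> range \<sigma> then a (inv_into UNIV \<sigma> p) else 0)"

text \<open>For strictly increasing \<open>\<sigma>\<close> this is the number of positions
  \<open>\<sigma> k\<close> below \<open>l\<close>.\<close>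

definition count_below :: "(nat \<Rightarrow> nat) \<Rightarrow> nat \<Rightarrow> nat" where
  "count_below \<sigma> l = (LEAST k. l \<le> \<sigma> k)"

context
  fixes \<sigma> :: "nat \<Rightarrow> nat"
  assumes \<sigma>: "strict_mono \<sigma>"
begin

lemma place_at [simp]: "place \<sigma> a (\<sigma> k) = a k"
  using strict_mono_imp_inj_on[OF \<sigma>] by (simp add: place_def inv_f_f)

lemma place_diff: "place \<sigma> a p - place \<sigma> b p = place \<sigma> (\<lambda>k. a k - b k) p"
  by (simp add: place_def)

lemma less_count_below: "k < count_below \<sigma> l \<longleftrightarrow> \<sigma> k < l"
proof -
  have "l \<le> \<sigma> l" using strict_mono_imp_increasing[OF \<sigma>] .
  then have l: "l \<le> \<sigma> (count_below \<sigma> l)" unfolding count_below_def by (rule LeastI)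
  show ?thesis
  proof
    assume "k < count_below \<sigma> l"
    then show "\<sigma> k < l" unfolding count_below_def using not_less_Least by force
  next
    assume "\<sigma> k < l"
    then have "\<sigma> k < \<sigma> (count_below \<sigma> l)" using l by linarith
    then show "k < count_below \<sigma> l" using \<sigma> by (simp add: strict_mono_less)
  qed
qed

lemma count_below_at [simp]: "count_below \<sigma> (\<sigma> k) = k"
proof -
  have "i < count_below \<sigma> (\<sigma> k) \<longleftrightarrow> i < k" for i
    using \<sigma> by (simp add: less_count_below strict_mono_less)
  then show ?thesis by (metis nat_neq_iff)
qed

lemma filterlim_count_below: "filterlim (count_below \<sigma>) sequentially sequentially"
  unfolding filterlim_at_top eventually_sequentially
proof
  fix k
  have "k \<le> count_below \<sigma> l" if "Suc (\<sigma> k) \<le> l" for l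
    using less_count_below[of k l] that by simp
  then show "\<exists>N. \<forall>l\<ge>N. k \<le> count_below \<sigma> l" by blast
qed

lemma sum_place: "(\<Sum>p<l. place \<sigma> a p) = (\<Sum>k<count_below \<sigma> l. a k)"
proof -
  have inj: "inj_on \<sigma> {..<count_below \<sigma> l}"
    using strict_mono_imp_inj_on[OF \<sigma>] inj_on_subset by blast
  have "(\<Sum>p<l. place \<sigma> a p) = (\<Sum>p\<in>\<sigma> ` {..<count_below \<sigma> l}. place \<sigma> a p)"
  proof (rule sum.mono_neutral_right)
    show "\<sigma> ` {..<count_below \<sigma> l} \<subseteq> {..<l}" by (auto simp: less_count_below)
    show "\<forall>p\<in>{..<l} - \<sigma> ` {..<count_below \<sigma> l}. place \<sigma> a p = 0"
      by (auto simp: place_def less_count_below)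
  qed simp
  also have "\<dots> = (\<Sum>k<count_below \<sigma> l. a k)"
    by (simp add: sum.reindex[OF inj])
  finally show ?thesis .
qed

lemma prod_place:
  fixes h :: "rat \<Rightarrow> rat \<Rightarrow> complex"
  assumes "h 0 0 = 1"
  shows "(\<Prod>p<l. h (place \<sigma> a p) (place \<sigma> b p)) = (\<Prod>k<count_below \<sigma> l. h (a k) (b k))"
proof -
  have inj: "inj_on \<sigma> {..<count_below \<sigma> l}"
    using strict_mono_imp_inj_on[OF \<sigma>] inj_on_subset by blast
  have "(\<Prod>p<l. h (place \<sigma> a p) (place \<sigma> b p)) =
      (\<Prod>p\<in>\<sigma> ` {..<count_below \<sigma> l}. h (place \<sigma> a p) (place \<sigma> b p))"
  proof (rule prod.mono_neutral_right)
    show "\<sigma> ` {..<count_below \<sigma> l} \<subseteq> {..<l}" by (auto simp: less_count_below)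
    show "\<forall>p\<in>{..<l} - \<sigma> ` {..<count_below \<sigma> l}. h (place \<sigma> a p) (place \<sigma> b p) = 1"
      by (auto simp: place_def less_count_below assms)
  qed simp
  also have "\<dots> = (\<Prod>k<count_below \<sigma> l. h (a k) (b k))"
    by (simp add: prod.reindex[OF inj])
  finally show ?thesis .
qed

lemma convergent_count_below:
  fixes s :: "nat \<Rightarrow> complex"
  shows "convergent (\<lambda>l. s (count_below \<sigma> l)) \<longleftrightarrow> convergent s"
proof
  assume "convergent s"
  then obtain L where "s \<longlonglongrightarrow> L" unfolding convergent_def by blast
  then have "(\<lambda>l. s (count_below \<sigma> l)) \<longlonglongrightarrow> L"
    by (rule filterlim_compose[OF _ filterlim_count_below])
  then show "convergent (\<lambda>l. s (count_below \<sigma> l))" by (rule convergentI)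
next
  assume "convergent (\<lambda>l. s (count_below \<sigma> l))"
  from convergent_subseq_convergent[OF this \<sigma>] show "convergent s" by (simp add: o_def)
qed

lemma tconv_place: "tconv D (\<lambda>l. \<Sum>p<l. place \<sigma> a p) \<longleftrightarrow> tconv D (\<lambda>l. \<Sum>k<l. a k)"
  unfolding tconv_def sum_place
  using convergent_count_below[of "\<lambda>l. cis (2 * pi * of_rat (\<Sum>k<l. a k) / sden D _)"] by simp

lemma tnull_place:
  assumes "tnull D a"
  shows "tnull D (place \<sigma> a)"
  unfolding tnull_def
proof
  fix k
  have a: "(\<lambda>i. cis (2 * pi * of_rat (a i) / sden D k)) \<longlonglongrightarrow> 1"
    using assms unfolding tnull_def by blast
  show "(\<lambda>p. cis (2 * pi * of_rat (place \<sigma> a p) / sden D k)) \<longlonglongrightarrow> 1"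
  proof (rule metric_LIMSEQ_I)
    fix e :: real assume "e > 0"
    with a obtain I where I: "\<And>i. i \<ge> I \<Longrightarrow> dist (cis (2 * pi * of_rat (a i) / sden D k)) 1 < e"
      by (metis metric_LIMSEQ_D)
    have "dist (cis (2 * pi * of_rat (place \<sigma> a p) / sden D k)) 1 < e" if p: "p \<ge> \<sigma> I" for p
    proof (cases "p \<in> range \<sigma>")
      case True
      then obtain i where i: "p = \<sigma> i" by blast
      then have "i \<ge> I" using p \<sigma> by (simp add: strict_mono_less_eq)
      then show ?thesis using I i by simp
    qed (simp add: place_def \<open>e > 0\<close>)
    then show "\<exists>I. \<forall>p\<ge>I. dist (cis (2 * pi * of_rat (place \<sigma> a p) / sden D k)) 1 < e" by blast
  qed
qed

end

lemma strict_mono_block: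
  assumes L: "strict_mono (L :: nat \<Rightarrow> nat)" and l: "L I \<le> l"
  shows "\<exists>i\<ge>I. L i \<le> l \<and> l \<le> L (Suc i)"
proof -
  define k where "k = count_below L (Suc l)"
  have k: "i < k \<longleftrightarrow> L i \<le> l" for i
    unfolding k_def using less_count_below[OF L, of i "Suc l"] by (simp add: less_Suc_eq_le)
  have "I < k" using k l by blast
  then obtain i where i: "k = Suc i" by (cases k) auto
  have "I \<le> i" using \<open>I < k\<close> i by simp
  moreover have "L i \<le> l" using k[of i] i by simp
  moreover have "\<not> L (Suc i) \<le> l" using k[of "Suc i"] i by simp
  ultimately show ?thesis by (intro exI[of _ i]) simp
qed

lemma limit_unit:
  fixes s :: "nat \<Rightarrow> complex"
  assumes "\<And>i. norm (s i) = 1" "s \<longlonglongrightarrow> l"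
  shows "norm l = 1" "l \<noteq> 0"
proof -
  show "norm l = 1" using tendsto_norm[OF assms(2)] by (simp add: assms(1) LIMSEQ_const_iff)
  then show "l \<noteq> 0" by auto
qed

lemma half_power_null: "(\<lambda>i. K * (1/2::real)^i) \<longlonglongrightarrow> 0"
  by (intro tendsto_mult_right_zero LIMSEQ_power_zero) simp

text \<open>Growth of this size puts \<open>a k\<close> and \<open>b k\<close> into the alphabet of
  their new position. The summand 2 leaves a free place after each position, used later for a
  shifted copy.\<close>

definition slow :: "(nat \<Rightarrow> rat) \<Rightarrow> (nat \<Rightarrow> rat) \<Rightarrow> nat \<Rightarrow> nat" where
  "slow a b k = (\<Sum>i\<le>k. 2 + to_nat (a i) + to_nat (b i))"

lemma slow_Suc: "slow a b k + 2 \<le> slow a b (Suc k)"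
  by (simp add: slow_def)

lemma mono_slow: "strict_mono (slow a b)"
  using slow_Suc[of a b] by (simp add: strict_mono_Suc_iff) (metis add_2_eq_Suc' less_eq_Suc_le Suc_leD)

lemma slow_ge: "to_nat (a k) \<le> slow a b k" "to_nat (b k) \<le> slow a b k"
  unfolding slow_def atMost_Suc using member_le_sum[of k "{..k}" "\<lambda>i. 2 + to_nat (a i) + to_nat (b i)"] by auto

section \<open>Altering a generic point block by block\<close>

locale block_reduction = generic_reduction +
  fixes c :: "nat \<Rightarrow> rat \<Rightarrow> complex" and S :: "nat \<Rightarrow> (nat \<Rightarrow> rat) set" and L j :: "nat \<Rightarrow> nat"
  assumes norm_c: "norm (c m a) = 1" and c_0: "c m 0 = 1"
    and x_mem: "x \<in> S i"
    and S_finite_diff: "z \<in> S i \<Longrightarrow> finite_diff z x"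
    and ok: "stage_ok i (S i) (L i) (j i)"
    and S_Suc: "S (Suc i) = next_points i (S i) (j i)"
    and L_Suc: "L i < L (Suc i)" and j_Suc: "j i < j (Suc i)"
    and c_close: "a \<in> alphabet i \<Longrightarrow> m \<le> i \<Longrightarrow>
      norm (q (L (Suc i)) m (x(j i := x (j i) + a)) x - c m a) \<le> 2 * (1/2)^i"
begin

lemma mono_L: "strict_mono L" and mono_j: "strict_mono j"
  using L_Suc j_Suc by (simp_all add: strict_mono_Suc_iff)

lemma c_nonzero [simp]: "c m a \<noteq> 0"
  using norm_c[of m a] by auto

lemma ok_osc: "z \<in> S i \<Longrightarrow> z' \<in> S i \<Longrightarrow> m \<le> i \<Longrightarrow> gen y \<Longrightarrow> agree (j i) y z \<Longrightarrow>
    osc y (\<lambda>p. z' p - z p) m (L i) ((1/2)^i)"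
  using ok[of i] unfolding stage_ok_def by simp

lemma ok_close: "z \<in> S i \<Longrightarrow> l \<le> L i \<Longrightarrow> m \<le> i \<Longrightarrow> gen y \<Longrightarrow> agree (j i) y z \<Longrightarrow>
    norm (f l m y - f l m z) \<le> (1/2)^i"
  using ok[of i] unfolding stage_ok_def by simp

lemma ok_notin: "z \<in> S i \<Longrightarrow> agree (j i) y z \<Longrightarrow> y \<notin> N i"
  using ok[of i] unfolding stage_ok_def by simp

primrec pt :: "(nat \<Rightarrow> rat) \<Rightarrow> nat \<Rightarrow> nat \<Rightarrow> rat" where
  "pt u 0 = x"
| "pt u (Suc i) = (pt u i)(j i := pt u i (j i) + u i)"

definition bump :: "nat \<Rightarrow> rat \<Rightarrow> nat \<Rightarrow> rat" where
  "bump i a = x(j i := x (j i) + a)"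

definition full :: "(nat \<Rightarrow> rat) \<Rightarrow> nat \<Rightarrow> rat" where
  "full u = (\<lambda>p. x p + place j u p)"

definition word :: "(nat \<Rightarrow> rat) \<Rightarrow> bool" where
  "word u \<longleftrightarrow> (\<forall>i. u i \<in> alphabet i)"

lemma pt_mem:
  assumes "word u"
  shows "pt u i \<in> S i"
proof (induction i)
  case 0
  then show ?case by (simp add: x_mem)
next
  case (Suc i)
  have "u i \<in> alphabet i" using assms by (simp add: word_def)
  with Suc show ?case unfolding S_Suc next_points_def
    by (intro image_eqI[of _ _ "(pt u i, u i)"]) (auto simp: fun_eq_iff)
qed

lemma pt_below: "agree (j i) (full u) (pt u i) \<and> (\<forall>k\<ge>i. pt u i (j k) = x (j k))"
proof (induction i)
  case 0
  have "place j u p = 0" if "p < j 0" for p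
  proof -
    have "p \<notin> range j"
    proof
      assume "p \<in> range j"
      then obtain k where "p = j k" by blast
      then show False using that mono_j by (simp add: strict_mono_less)
    qed
    then show ?thesis by (simp add: place_def)
  qed
  then show ?case by (simp add: agree_def full_def)
next
  case (Suc i)
  have "full u p = pt u (Suc i) p" if p: "p < j (Suc i)" for p
  proof (cases "p < j i \<or> p = j i")
    case True
    then show ?thesis
    proof
      assume "p < j i"
      then show ?thesis using Suc by (simp add: agree_def)
    next
      assume "p = j i"
      then show ?thesis using Suc by (simp add: full_def place_at[OF mono_j])
    qed
  next
    case False
    have np: "p \<notin> range j"
    proof
      assume "p \<in> range j"
      then obtain k where k: "p = j k" by blast
      then have "j i < j k" "j k < j (Suc i)" using False p by auto
      then have "i < k" "k < Suc i" using strict_mono_less[OF mono_j] by blast+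
      then show False by simp
    qed
    have "pt u k p = x p" for k
      using np by (induction k) auto
    then show ?thesis using np by (simp add: full_def place_def del: pt.simps)
  qed
  moreover have "pt u (Suc i) (j k) = x (j k)" if "k \<ge> Suc i" for k
  proof -
    have "j k \<noteq> j i" using that strict_mono_eq[OF mono_j, of k i] by simp
    then show ?thesis using Suc that by simp
  qed
  ultimately show ?case unfolding agree_def by blast
qed

text \<open>The point may differ from \<open>x\<close> infinitely often, so the choice of
  \<open>x\<close> says nothing about it. It misses \<open>N i\<close> because below
  \<open>j i\<close> it agrees with a point of \<open>S i\<close>.\<close>

lemma gen_full: "word u \<Longrightarrow> gen (full u)"
  unfolding gen_def using ok_notin[OF pt_mem] pt_below by blast

lemma gen_pt: "word u \<Longrightarrow> gen (pt u i)"
  using gen_finite_diff S_finite_diff pt_mem by blast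

lemma gen_bump: "gen (bump i a)"
  unfolding bump_def by (rule gen_finite_diff) simp

lemma full_close:
  assumes "word u" "m \<le> i" "l \<le> L i"
  shows "norm (f l m (full u) - f l m (pt u i)) \<le> (1/2)^i"
  using assms pt_below by (intro ok_close pt_mem gen_full) auto

text \<open>Time \<open>L i\<close> is where the first \<open>i\<close> alterations have settled
  relative to each other while later ones are not yet visible.\<close>

definition A :: "nat \<Rightarrow> (nat \<Rightarrow> rat) \<Rightarrow> nat \<Rightarrow> complex" where
  "A m u i = q (L i) m (pt u i) x"

definition g :: "nat \<Rightarrow> nat \<Rightarrow> rat \<Rightarrow> nat \<Rightarrow> complex" where
  "g m i a l = q l m (bump i a) x"

lemma norm_A [simp]: "norm (A m u i) = 1" and norm_g [simp]: "norm (g m i a l) = 1"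
  by (simp_all add: A_def g_def)

lemma g_0 [simp]: "g m i 0 l = 1"
  by (simp add: g_def bump_def)

text \<open>The alterations of \<open>pt u i\<close> are applied to \<open>bump i (u i)\<close>
  instead of \<open>x\<close>. From \<open>L i\<close> on their effect is settled, with error 1; at
  \<open>L i\<close> itself the change at \<open>j i\<close> is invisible for both points, with
  error 2. Hence new and old alterations act almost multiplicatively.\<close>

lemma pt_estimate:
  assumes u: "word u" and m: "m \<le> i" and l: "L i \<le> l"
  shows "norm (q l m (pt u (Suc i)) x - A m u i * g m i (u i) l) \<le> 3 * (1/2)^i"
proof -
  let ?y = "bump i (u i)" and ?e = "(1/2::real)^i"
  have ag: "agree (j i) ?y x" by (simp add: agree_def bump_def)
  have ag': "agree (j i) (pt u (Suc i)) (pt u i)" by (simp add: agree_def)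
  have eq: "(\<lambda>p. ?y p + (pt u i p - x p)) = pt u (Suc i)"
    by (auto simp: bump_def fun_eq_iff)
  have "osc ?y (\<lambda>p. pt u i p - x p) m (L i) ?e"
    by (rule ok_osc[OF x_mem pt_mem[OF u] m gen_bump ag])
  then have 1: "norm (q l m ?y (pt u (Suc i)) - q (L i) m ?y (pt u (Suc i))) \<le> ?e"
    using l unfolding osc_def eq by simp
  have "norm (f (L i) m ?y - f (L i) m x) \<le> ?e"
    by (rule ok_close[OF x_mem _ m gen_bump ag]) simp
  moreover have "norm (f (L i) m (pt u (Suc i)) - f (L i) m (pt u i)) \<le> ?e"
    by (rule ok_close[OF pt_mem[OF u] _ m gen_pt[OF u] ag']) simp
  ultimately have 2: "norm (q (L i) m ?y (pt u (Suc i)) - q (L i) m x (pt u i)) \<le> 2 * ?e"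
    unfolding q_def
    using unit_quotient_diff[OF norm_f norm_f norm_f norm_f, of "L i" m ?y "L i" m "pt u (Suc i)" "L i" m x "L i" m "pt u i"]
    by linarith
  have 3: "norm (q l m ?y (pt u (Suc i)) - q (L i) m x (pt u i)) \<le> 3 * ?e"
    using norm_triangle_ineq[of "q l m ?y (pt u (Suc i)) - q (L i) m ?y (pt u (Suc i))"
        "q (L i) m ?y (pt u (Suc i)) - q (L i) m x (pt u i)"] 1 2 by simp
  have "q l m (pt u (Suc i)) x - A m u i * g m i (u i) l =
     g m i (u i) l * (1 / q l m ?y (pt u (Suc i)) - 1 / q (L i) m x (pt u i))"
    by (simp add: A_def g_def q_def field_simps)
  then have "norm (q l m (pt u (Suc i)) x - A m u i * g m i (u i) l) =
     norm (1 / q l m ?y (pt u (Suc i)) - 1 / q (L i) m x (pt u i))"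
    by (simp add: norm_mult)
  also have "\<dots> \<le> 3 * ?e"
    using unit_quotient_diff[of 1 "q l m ?y (pt u (Suc i))" 1 "q (L i) m x (pt u i)"] 3 by simp
  finally show ?thesis .
qed

text \<open>Alterations after block \<open>i\<close> sit at \<open>j (Suc i)\<close> and beyond, and
  add one more error up to time \<open>L (Suc i)\<close>.\<close>

lemma full_estimate:
  assumes u: "word u" and m: "m \<le> i" and l: "L i \<le> l" "l \<le> L (Suc i)"
  shows "norm (q l m (full u) x - A m u i * g m i (u i) l) \<le> 4 * (1/2)^i"
proof -
  define y where "y = pt u (Suc i)"
  have "norm (f l m (full u) - f l m y) \<le> (1/2)^Suc i"
    unfolding y_def by (rule full_close[OF u]) (use m l in auto)
  also have "\<dots> \<le> (1/2)^i" by simp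
  finally have "norm (f l m (full u) - f l m y) \<le> (1/2)^i" .
  moreover have "norm (q l m (full u) x - q l m y x) \<le> norm (f l m (full u) - f l m y) + norm (f l m x - f l m x)"
    unfolding q_def by (rule unit_quotient_diff) (rule norm_f)+
  ultimately have "norm (q l m (full u) x - q l m (pt u (Suc i)) x) \<le> (1/2)^i"
    unfolding y_def[symmetric] by simp
  then show ?thesis
    using norm_triangle_ineq[of "q l m (full u) x - q l m (pt u (Suc i)) x"
        "q l m (pt u (Suc i)) x - A m u i * g m i (u i) l"] pt_estimate[OF u m l(1)] by simp
qed

text \<open>At time \<open>L (Suc i)\<close> the single effect is within \<open>2 * (1/2)^i\<close>
  of its limit \<open>c m (u i)\<close>. The resulting errors are summable.\<close>

lemma A_step:
  assumes u: "word u" and m: "m \<le> i"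
  shows "norm (A m u (Suc i) - A m u i * c m (u i)) \<le> 5 * (1/2)^i"
proof -
  have "norm (A m u (Suc i) - A m u i * g m i (u i) (L (Suc i))) \<le> 3 * (1/2)^i"
    unfolding A_def[of m u "Suc i"] using L_Suc[of i] by (intro pt_estimate[OF u m]) simp
  moreover have "norm (A m u i * g m i (u i) (L (Suc i)) - A m u i * c m (u i)) \<le> 2 * (1/2)^i"
  proof -
    have "norm (g m i (u i) (L (Suc i)) - c m (u i)) \<le> 2 * (1/2)^i"
      unfolding g_def bump_def using u m by (intro c_close) (simp_all add: word_def)
    then show ?thesis by (simp add: norm_mult right_diff_distrib[symmetric])
  qed
  ultimately show ?thesis
    using norm_triangle_ineq[of "A m u (Suc i) - A m u i * g m i (u i) (L (Suc i))"
        "A m u i * g m i (u i) (L (Suc i)) - A m u i * c m (u i)"] by simp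
qed

definition cprod :: "nat \<Rightarrow> (nat \<Rightarrow> rat) \<Rightarrow> nat \<Rightarrow> complex" where
  "cprod m u i = (\<Prod>k<i. c m (u k))"

lemma norm_cprod [simp]: "norm (cprod m u i) = 1"
  by (simp add: cprod_def prod_norm[symmetric] norm_c)

lemma cprod_nonzero [simp]: "cprod m u i \<noteq> 0"
  using norm_cprod[of m u i] by (metis norm_zero zero_neq_one)

lemma A_nonzero [simp]: "A m u i \<noteq> 0"
  using norm_A[of m u i] by (metis norm_zero zero_neq_one)

text \<open>The quotients have summable increments, and modulus 1 keeps their limit away from 0. So
  the image follows the product of the \<open>c m (u k)\<close> up to a convergent factor.\<close>

lemma A_over_cprod:
  assumes u: "word u"
  obtains b where "(\<lambda>i. A m u i / cprod m u i) \<longlonglongrightarrow> b" "b \<noteq> 0"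
proof -
  define B where "B i = A m u i / cprod m u i" for i
  have bound: "norm (B (Suc i) - B i) \<le> 5 * (1/2)^i" if "i \<ge> m" for i
  proof -
    have "B (Suc i) - B i = (A m u (Suc i) - A m u i * c m (u i)) / cprod m u (Suc i)"
      by (simp add: B_def cprod_def field_simps)
    then have "norm (B (Suc i) - B i) = norm (A m u (Suc i) - A m u i * c m (u i))"
      by (simp add: norm_divide)
    then show ?thesis using A_step[OF u that] by simp
  qed
  have "summable (\<lambda>i. B (Suc i) - B i)"
  proof (rule summable_comparison_test'[of _ m])
    show "summable (\<lambda>i. 5 * (1/2::real)^i)" by (intro summable_mult summable_geometric) simp
  qed (rule bound)
  then have "convergent (\<lambda>k. \<Sum>i<k. B (Suc i) - B i)" by (simp add: summable_iff_convergent)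
  then have "convergent (\<lambda>k. B k - B 0)" by (simp add: sum_lessThan_telescope)
  then have "convergent (\<lambda>k. (B k - B 0) + B 0)" by (intro convergent_add convergent_const)
  then obtain b where b: "B \<longlonglongrightarrow> b" unfolding convergent_def by auto
  have "norm (B i) = 1" for i by (simp add: B_def norm_divide)
  from limit_unit(2)[OF this b] b show ?thesis using that[of b] unfolding B_def by blast
qed

lemma tconv_full:
  "tconv D (\<lambda>i. \<Sum>p<i. full u p - full v p) \<longleftrightarrow> tconv D (\<lambda>i. \<Sum>k<i. u k - v k)"
proof -
  have "(\<lambda>p. full u p - full v p) = place j (\<lambda>k. u k - v k)"
    by (auto simp: full_def place_diff[OF mono_j])
  then have "(\<Sum>p<i. full u p - full v p) = (\<Sum>p<i. place j (\<lambda>k. u k - v k) p)" for i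
    by (metis (no_types))
  then show ?thesis using tconv_place[OF mono_j] by simp
qed

text \<open>At the times \<open>L i\<close> the full and the truncated alterations have outputs
  within \<open>(1/2)^i\<close>, so both quotients have the same limit.\<close>

lemma A_quotient:
  assumes uv: "word u" "word v" and t: "tconv D (\<lambda>i. \<Sum>k<i. u k - v k)"
  obtains l where "(\<lambda>l. q l m (full u) (full v)) \<longlonglongrightarrow> l" "(\<lambda>i. A m u i / A m v i) \<longlonglongrightarrow> l" "l \<noteq> 0"
proof -
  have "convergent (\<lambda>l. q l m (full u) (full v))"
    using f_red[of "full u" "full v"] t unfolding tconv_full q_def by blast
  then obtain l where l: "(\<lambda>l. q l m (full u) (full v)) \<longlonglongrightarrow> l" unfolding convergent_def by blast
  have "(\<lambda>i. q (L i) m (full u) (full v)) \<longlonglongrightarrow> l"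
    using LIMSEQ_subseq_LIMSEQ[OF l mono_L] by (simp add: o_def)
  moreover have "(\<lambda>i. A m u i / A m v i - q (L i) m (full u) (full v)) \<longlonglongrightarrow> 0"
  proof (rule Lim_null_comparison[OF _ half_power_null[of 2]])
    show "\<forall>\<^sub>F i in sequentially. norm (A m u i / A m v i - q (L i) m (full u) (full v)) \<le> 2 * (1/2)^i"
      using eventually_ge_at_top[of m]
    proof eventually_elim
      case (elim i)
      have "A m u i / A m v i = f (L i) m (pt u i) / f (L i) m (pt v i)"
        by (simp add: A_def q_def)
      moreover have "norm (f (L i) m (pt u i) / f (L i) m (pt v i) - f (L i) m (full u) / f (L i) m (full v)) \<le>
          norm (f (L i) m (pt u i) - f (L i) m (full u)) + norm (f (L i) m (pt v i) - f (L i) m (full v))"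
        by (rule unit_quotient_diff) (rule norm_f)+
      ultimately show ?case
        using full_close[OF uv(1) elim order_refl] full_close[OF uv(2) elim order_refl]
        by (simp add: q_def norm_minus_commute)
    qed
  qed
  ultimately have "(\<lambda>i. q (L i) m (full u) (full v) + (A m u i / A m v i - q (L i) m (full u) (full v))) \<longlonglongrightarrow> l + 0"
    by (rule tendsto_add)
  then have "(\<lambda>i. A m u i / A m v i) \<longlonglongrightarrow> l" by simp
  moreover have "l \<noteq> 0" using limit_unit(2)[OF _ l] by simp
  ultimately show ?thesis using that l by blast
qed

lemma convergent_quotients_word:
  assumes uv: "word u" "word v" and t: "tconv D (\<lambda>i. \<Sum>k<i. u k - v k)"
  shows "convergent (\<lambda>i. \<Prod>k<i. c m (u k) / c m (v k))"
proof -
  obtain b where b: "(\<lambda>i. A m u i / cprod m u i) \<longlonglongrightarrow> b" "b \<noteq> 0" by (rule A_over_cprod[OF uv(1)])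
  obtain b' where b': "(\<lambda>i. A m v i / cprod m v i) \<longlonglongrightarrow> b'" "b' \<noteq> 0" by (rule A_over_cprod[OF uv(2)])
  obtain l where l: "(\<lambda>i. A m u i / A m v i) \<longlonglongrightarrow> l" by (rule A_quotient[OF uv t])
  have "(\<lambda>i. (A m u i / A m v i) * (A m v i / cprod m v i) / (A m u i / cprod m u i)) \<longlonglongrightarrow> l * b' / b"
    by (intro tendsto_mult tendsto_divide b b' l)
  moreover have "(A m u i / A m v i) * (A m v i / cprod m v i) / (A m u i / cprod m u i) = (\<Prod>k<i. c m (u k) / c m (v k))" for i
    by (simp add: cprod_def prod_dividef[symmetric] field_simps)
  ultimately show ?thesis unfolding convergent_def by auto
qed

text \<open>Comparing \<open>u\<close> with the sequence \<open>v\<close> supported on other blocks shows that the fluctuation of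
  \<open>q\<close> inside a block is negligible.\<close>
lemma tconv_word:
  assumes uv: "word u" "word v" and t: "tconv D (\<lambda>i. \<Sum>k<i. u k - v k)"
    and disj: "\<And>i. u i = 0 \<or> v i = 0"
    and conv: "\<And>m. convergent (\<lambda>i. \<Prod>k<i. c m (u k))"
  shows "tconv D (\<lambda>i. \<Sum>k<i. u k)"
proof -
  have "convergent (\<lambda>l. q l m (full u) x)" for m
  proof -
    obtain l0 where l0: "(\<lambda>l. q l m (full u) (full v)) \<longlonglongrightarrow> l0" "(\<lambda>i. A m u i / A m v i) \<longlonglongrightarrow> l0" "l0 \<noteq> 0"
      by (rule A_quotient[OF uv t])
    obtain b where b: "(\<lambda>i. A m u i / cprod m u i) \<longlonglongrightarrow> b" "b \<noteq> 0" by (rule A_over_cprod[OF uv(1)])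
    obtain p where p: "cprod m u \<longlonglongrightarrow> p" using conv[of m] unfolding convergent_def cprod_def by blast
    have "(\<lambda>i. A m u i / cprod m u i * cprod m u i) \<longlonglongrightarrow> b * p"
      by (intro tendsto_mult b p)
    then have A_lim: "A m u \<longlonglongrightarrow> b * p" by simp
    have "(\<lambda>l. q l m (full u) x) \<longlonglongrightarrow> b * p"
    proof (rule metric_LIMSEQ_I)
      fix e :: real assume e: "e > 0"
      \<comment> \<open>The final estimate spends three portions \<open>r\<close> on the limits
        \<open>l0\<close> (twice) and \<open>b * p\<close>, and the errors
        \<open>12 * (1/2)^i\<close> stay below the fourth.\<close>
      define r where "r = e / 4"
      have r: "r > 0" using e by (simp add: r_def)
      obtain I1 where I1: "\<And>l. l \<ge> I1 \<Longrightarrow> dist (q l m (full u) (full v)) l0 < r"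
        using metric_LIMSEQ_D[OF l0(1) r] by blast
      obtain I2 where I2: "\<And>i. i \<ge> I2 \<Longrightarrow> dist (A m u i / A m v i) l0 < r"
        using metric_LIMSEQ_D[OF l0(2) r] by blast
      obtain I3 where I3: "\<And>i. i \<ge> I3 \<Longrightarrow> dist (A m u i) (b * p) < r"
        using metric_LIMSEQ_D[OF A_lim r] by blast
      obtain I4 where I4: "\<And>i. i \<ge> I4 \<Longrightarrow> 12 * (1/2)^i < r"
        using metric_LIMSEQ_D[OF half_power_null[of 12] r] by (auto simp: dist_norm)
      define I where "I = Max {m, I1, I2, I3, I4}"
      have I: "m \<le> I" "I1 \<le> I" "I2 \<le> I" "I3 \<le> I" "I4 \<le> I" by (auto simp: I_def)
      have "dist (q l m (full u) x) (b * p) < e" if l: "l \<ge> L I" for l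
      proof -
        obtain i where i: "i \<ge> I" "L i \<le> l" "l \<le> L (Suc i)" using strict_mono_block[OF mono_L l] by blast
        have mi: "m \<le> i" using i(1) I(1) by simp
        have "l \<ge> I1" using strict_mono_imp_increasing[OF mono_L, of i] i I(2) by linarith
        let ?h = "(1/2::real)^i"
        have h: "12 * ?h < r" using I4[of i] i(1) I(5) by simp
        have eu: "norm (q l m (full u) x - A m u i * g m i (u i) l) \<le> 4 * ?h"
          by (rule full_estimate[OF uv(1) mi i(2,3)])
        have ev: "norm (q l m (full v) x - A m v i * g m i (v i) l) \<le> 4 * ?h"
          by (rule full_estimate[OF uv(2) mi i(2,3)])
        \<comment> \<open>If \<open>u i\<close> is nonzero then \<open>v\<close> does nothing in
          this block, so the quotient of the two images is about
          \<open>A m u i / A m v i * g\<close>. Both that quotient and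
          \<open>A m u i / A m v i\<close> are near \<open>l0\<close>, which leaves \<open>g\<close>
          near 1.\<close>
        have gz: "norm (g m i (u i) l - 1) \<le> 8 * ?h + 2 * r"
        proof (cases "u i = 0")
          case True
          then show ?thesis using r by simp
        next
          case False
          then have v0: "v i = 0" using disj by blast
          have "norm (q l m (full u) x / q l m (full v) x - (A m u i * g m i (u i) l) / A m v i) \<le> 8 * ?h"
            using unit_quotient_diff[of "q l m (full u) x" "q l m (full v) x" "A m u i * g m i (u i) l" "A m v i"]
              eu ev v0 by (simp add: norm_mult)
          moreover have "q l m (full u) x / q l m (full v) x = q l m (full u) (full v)"
            by (simp add: q_def)
          ultimately have 1: "norm (q l m (full u) (full v) - (A m u i / A m v i) * g m i (u i) l) \<le> 8 * ?h"
            by simp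
          have 2: "norm (q l m (full u) (full v) - l0) < r" using I1[OF \<open>l \<ge> I1\<close>] by (simp add: dist_norm)
          have 3: "norm (l0 - A m u i / A m v i) < r"
            using I2[of i] i(1) I(3) by (simp add: dist_norm norm_minus_commute)
          have "norm ((A m u i / A m v i) * (g m i (u i) l - 1)) =
              norm (((A m u i / A m v i) * g m i (u i) l - q l m (full u) (full v)) +
                (q l m (full u) (full v) - l0) + (l0 - A m u i / A m v i))"
            by (simp add: algebra_simps diff_divide_distrib)
          also have "\<dots> \<le> 8 * ?h + r + r"
            using 1 2 3 by (intro norm_triangle_le add_mono) (simp_all add: norm_minus_commute)
          finally show ?thesis by (simp add: norm_mult norm_divide)
        qed
        have "norm (q l m (full u) x - b * p) = norm ((q l m (full u) x - A m u i * g m i (u i) l) +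
            A m u i * (g m i (u i) l - 1) + (A m u i - b * p))"
          by (simp add: algebra_simps)
        also have "\<dots> \<le> norm (q l m (full u) x - A m u i * g m i (u i) l) +
            norm (A m u i * (g m i (u i) l - 1)) + norm (A m u i - b * p)"
          by (intro norm_triangle_le add_mono norm_triangle_ineq order_refl)
        also have "\<dots> < 4 * ?h + (8 * ?h + 2 * r) + r"
          using eu gz I3[of i] i(1) I(4) by (simp add: norm_mult dist_norm)
        also have "\<dots> \<le> e" using h by (simp add: r_def)
        finally show ?thesis by (simp add: dist_norm)
      qed
      then show "\<exists>I. \<forall>l\<ge>I. dist (q l m (full u) x) (b * p) < e" by blast
    qed
    then show ?thesis by (rule convergentI)
  qed
  moreover have "full (\<lambda>_. 0) = x" by (auto simp: full_def place_def)
  ultimately have "tconv D (\<lambda>i. \<Sum>p<i. full u p - full (\<lambda>_. 0) p)"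
    using f_red[of "full u" "full (\<lambda>_. 0)"] by (simp add: q_def)
  then show ?thesis unfolding tconv_full by simp
qed

lemma word_place:
  assumes "strict_mono \<sigma>" "\<And>k. to_nat (a k) \<le> \<sigma> k"
  shows "word (place \<sigma> a)"
  unfolding word_def
proof
  fix i
  show "place \<sigma> a i \<in> alphabet i"
  proof (cases "i \<in> range \<sigma>")
    case True
    then obtain k where "i = \<sigma> k" by blast
    then show ?thesis using assms(2)[of k] by (simp add: place_at[OF assms(1)] mem_alphabet)
  qed (simp add: place_def)
qed

text \<open>Spreading \<open>a\<close> and \<open>b\<close> over the same slow positions turns them
  into words. The inserted zeros only repeat partial sums and products.\<close>

lemma convergent_quotients:
  assumes t: "tconv D (\<lambda>i. \<Sum>k<i. a k - b k)"
  shows "convergent (\<lambda>i. \<Prod>k<i. c m (a k) / c m (b k))"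
proof -
  let ?s = "slow a b"
  note ms = mono_slow[of a b]
  have "tconv D (\<lambda>i. \<Sum>p<i. place ?s a p - place ?s b p)"
    unfolding place_diff[OF ms] tconv_place[OF ms] by (rule t)
  from convergent_quotients_word[OF word_place[OF ms slow_ge(1)] word_place[OF ms slow_ge(2)] this, of m]
  have "convergent (\<lambda>i. \<Prod>k<count_below ?s i. c m (a k) / c m (b k))"
    using prod_place[OF ms, of "\<lambda>y z. c m y / c m z" a b] by (simp add: c_0)
  then show ?thesis
    using convergent_count_below[OF ms, of "\<lambda>i. \<Prod>k<i. c m (a k) / c m (b k)"] by simp
qed

text \<open>A spread copy of \<open>a\<close> is compared with the same copy moved by one place. The
  differences telescope to the moved copy itself, which tends to 0, so the two words are equivalent;
  their supports are disjoint, as \<open>tconv_word\<close> demands.\<close>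

lemma tconv_if_convergent_cprod:
  assumes t: "tnull D a" and conv: "\<forall>m. convergent (\<lambda>i. \<Prod>k<i. c m (a k))"
  shows "tconv D (\<lambda>i. \<Sum>k<i. a k)"
proof -
  let ?s = "slow a a" and ?s' = "\<lambda>k. Suc (slow a a k)"
  note ms = mono_slow[of a a]
  have ms': "strict_mono ?s'" using ms by (simp add: strict_mono_def)
  let ?u = "place ?s a" and ?v = "place ?s' a"
  have wu: "word ?u" by (rule word_place[OF ms slow_ge(1)])
  have wv: "word ?v" using word_place[OF ms' le_SucI[OF slow_ge(1)]] .
  have v0: "?v 0 = 0" by (auto simp: place_def)
  have vS: "?v (Suc p) = ?u p" for p
  proof (cases "p \<in> range ?s")
    case True
    then obtain k where k: "p = ?s k" by blast
    then show ?thesis using place_at[OF ms', of a k] place_at[OF ms, of a k] by simp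
  next
    case False
    then have "Suc p \<notin> range ?s'" by auto
    then show ?thesis using False by (simp add: place_def)
  qed
  have telescope: "(\<Sum>p<i. ?u p - ?v p) = ?v i" for i
    using sum_lessThan_telescope[of ?v i] by (simp only: vS v0)
  have "tnull D ?v" by (rule tnull_place[OF ms' t])
  then have tc: "tconv D (\<lambda>i. \<Sum>p<i. ?u p - ?v p)"
    unfolding telescope tnull_def tconv_def convergent_def by blast
  have disj: "?u i = 0 \<or> ?v i = 0" for i
  proof (rule ccontr)
    assume "\<not> ?thesis"
    then have "i \<in> range ?s" "i \<in> range ?s'" by (auto simp: place_def split: if_splits)
    then obtain k k' where k: "i = ?s k" "i = Suc (?s k')" by blast
    then have "?s k' < ?s k" by simp
    then have "Suc k' \<le> k" using ms by (simp add: strict_mono_less)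
    then have "?s (Suc k') \<le> ?s k" using ms by (simp add: strict_mono_less_eq)
    then show False using k slow_Suc[of a a k'] by simp
  qed
  have cv: "convergent (\<lambda>i. \<Prod>p<i. c m (?u p))" for m
  proof -
    have "(\<Prod>p<i. c m (?u p)) = (\<Prod>k<count_below ?s i. c m (a k))" for i
      using prod_place[OF ms, of "\<lambda>y z. c m y" a a i] by (simp add: c_0)
    then show ?thesis
      using convergent_count_below[OF ms, of "\<lambda>i. \<Prod>k<i. c m (a k)"] conv by simp
  qed
  from tconv_word[OF wu wv tc disj cv] show ?thesis
    unfolding tconv_place[OF ms] .
qed

end

theorem E_le_solenoid_imp_almost_subset:
  assumes n: "n > 0" and le: "E_le (solenoid n D) (solenoid n D')"
  shows "D' \<subseteq>\<^sup>* D"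
proof -
  obtain f where "rat_reduction n D D' f" using E_le_imp_rat_reduction[OF n le] by (elim exE)
  then interpret rat_reduction n D D' f .
  have "\<exists>N x. generic_reduction n D D' f N x"
    using generic_exists
  proof (elim exE conjE)
    fix N :: "nat \<Rightarrow> (nat \<Rightarrow> rat) set" and x
    assume 1: "\<forall>k. closedin rat_seqs (N k)" and 2: "\<forall>z k. finite_diff z x \<longrightarrow> z \<notin> N k"
      and 3: "\<forall>z l m e. (\<forall>k. z \<notin> N k) \<longrightarrow> e > 0 \<longrightarrow>
       (\<exists>p. \<forall>y. (\<forall>k. y \<notin> N k) \<and> (\<forall>i<p. y i = z i) \<longrightarrow> norm (f l m y - f l m z) \<le> e)"
      and 4: "\<forall>z w m L j. (\<forall>k. z \<notin> N k) \<longrightarrow> finite_diff w (\<lambda>_. 0) \<longrightarrow> osc z w m L ((1/2)^j) \<longrightarrow>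
       (\<exists>p. \<forall>y. (\<forall>k. y \<notin> N k) \<and> (\<forall>i<p. y i = z i) \<longrightarrow> osc y w m L ((1/2)^j))"
    have "generic_reduction n D D' f N x"
    proof
      show "closedin rat_seqs (N k)" for k using 1 by (rule spec)
      show "z \<notin> N k" if "finite_diff z x" for z k
        using 2[THEN spec, THEN spec, THEN mp, OF that] .
      show "\<exists>p. \<forall>y. (\<forall>k. y \<notin> N k) \<and> (\<forall>i<p. y i = z i) \<longrightarrow> norm (f l m y - f l m z) \<le> e"
        if "\<forall>k. z \<notin> N k" "e > 0" for z l m e
        using 3[THEN spec, THEN spec, THEN spec, THEN spec, THEN mp, THEN mp, OF that] .
      show "\<exists>p. \<forall>y. (\<forall>k. y \<notin> N k) \<and> (\<forall>i<p. y i = z i) \<longrightarrow> osc y w m L ((1/2)^j)"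
        if "\<forall>k. z \<notin> N k" "finite_diff w (\<lambda>_. 0)" "osc z w m L ((1/2)^j)" for z w m L j
        using 4[THEN spec, THEN spec, THEN spec, THEN spec, THEN spec, THEN mp, THEN mp, THEN mp, OF that] .
    qed
    then show ?thesis by (intro exI)
  qed
  then obtain N x where "generic_reduction n D D' f N x" by (elim exE)
  then interpret generic_reduction n D D' f N x .
  obtain J c where J: "strict_mono (J :: nat \<Rightarrow> nat)" and c': "\<forall>m a. (\<lambda>k. alpha m a (J k)) \<longlonglongrightarrow> c m a"
    by (rule alpha_subseq)
  note c = c'[rule_format]
  obtain S L j where SLj: "\<forall>i. finite (S i) \<and> x \<in> S i \<and> (\<forall>z\<in>S i. finite_diff z x) \<and> stage_ok i (S i) (L i) (j i) \<and>
    S (Suc i) = next_points i (S i) (j i) \<and> L i < L (Suc i) \<and> j i < j (Suc i) \<and>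
    (\<forall>a\<in>alphabet i. \<forall>m\<in>{..i}. norm (q (L (Suc i)) m (x(j i := x (j i) + a)) x - c m a) \<le> 2 * (1/2)^i)"
    using blocks_exist[OF J c] by (elim exE)
  have norm_c: "norm (c m a) = 1" for m a
    using tendsto_norm[OF c[of m a]] by (simp add: norm_alpha LIMSEQ_const_iff)
  have c0: "c m 0 = 1" for m
    using c[of m 0] by (simp add: alpha_0 LIMSEQ_const_iff)
  interpret block_reduction n D D' f N x c S L j
  proof
    show "norm (q (L (Suc i)) m (x(j i := x (j i) + a)) x - c m a) \<le> 2 * (1/2)^i"
      if "a \<in> alphabet i" "m \<le> i" for a i m
      using SLj[THEN spec, of i] that by simp
    show "finite_diff z x" if "z \<in> S i" for z i
      using SLj[THEN spec, of i] that by simp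
    show "x \<in> S i" "stage_ok i (S i) (L i) (j i)" "S (Suc i) = next_points i (S i) (j i)"
      "L i < L (Suc i)" "j i < j (Suc i)" for i
      using SLj[THEN spec, of i] by simp_all
  qed (rule norm_c c0)+
  show ?thesis
  proof (rule almost_subset_if_characters[OF n])
    show "sum_product_map D (c m)" for m
    proof
      show "convergent (\<lambda>i. \<Prod>p<i. c m (a p) / c m (b p))"
        if "tconv D (\<lambda>i. \<Sum>p<i. a p - b p)" for a b
        by (rule convergent_quotients[OF that])
    qed (rule norm_c c0)+
    show "c m t = c (m + n) t ^ sfac D' (m div n)" for m t
    proof (rule LIMSEQ_unique[OF c])
      show "(\<lambda>k. alpha m t (J k)) \<longlonglongrightarrow> c (m + n) t ^ sfac D' (m div n)"
        unfolding alpha_step[of m] by (intro tendsto_power c)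
    qed
    show "tconv D (\<lambda>i. \<Sum>p<i. a p)"
      if "tnull D a" "\<forall>m. convergent (\<lambda>i. \<Prod>p<i. c m (a p))" for a
      by (rule tconv_if_convergent_cprod[OF that])
  qed
qed

subsection \<open>The family of groups\<close>

text \<open>Residue 1 modulo 3 codes the complement of \<open>A\<close>, since the correspondence
  reverses inclusion. Residue 0 is always present and residue 2 always absent.\<close>

definition prime_indices :: "nat set \<Rightarrow> nat set" where
  "prime_indices A = range (\<lambda>i. 3 * i) \<union> (\<lambda>i. 3 * i + 1) ` (- A)"

lemma infinite_prime_indices: "infinite (prime_indices A)"
proof -
  have "infinite (range (\<lambda>i::nat. 3 * i))" by (rule range_inj_infinite) (simp add: inj_def)
  then show ?thesis unfolding prime_indices_def by simp
qed

lemma coinfinite_prime_indices: "infinite (- prime_indices A)"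
proof -
  have "infinite (range (\<lambda>i::nat. 3 * i + 2))" by (rule range_inj_infinite) (simp add: inj_def)
  moreover have "range (\<lambda>i. 3 * i + 2) \<subseteq> - prime_indices A"
  proof -
    have "x mod 3 \<noteq> 2" if "x \<in> prime_indices A" for x
      using that unfolding prime_indices_def by auto
    moreover have "(3 * i + 2) mod 3 = 2" for i :: nat by presburger
    ultimately show ?thesis by blast
  qed
  ultimately show ?thesis using finite_subset by blast
qed

lemma prime_indices_almost_subset: "prime_indices B \<subseteq>\<^sup>* prime_indices A \<longleftrightarrow> A \<subseteq>\<^sup>* B"
proof -
  have "prime_indices B - prime_indices A = (\<lambda>i. 3 * i + 1) ` (A - B)"
    unfolding prime_indices_def by (auto simp: image_iff) presburger+
  moreover have "inj_on (\<lambda>i::nat. 3 * i + 1) (A - B)" by (simp add: inj_on_def)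
  ultimately show ?thesis unfolding almost_subset_def by (simp add: finite_image_iff)
qed

theorem theorem1p5:
  fixes n :: nat
  assumes "n > 0"
  shows "\<exists>G :: nat set \<Rightarrow> (nat \<Rightarrow> complex) top_monoid.
    (\<forall>A. Polish_group (G A) \<and> comm_group (G A) \<and>
         compact_space (gtop (G A)) \<and> connected_space (gtop (G A)) \<and>
         has_covering_dim (gtop (G A)) (int n) \<and>
         E_less (power_group real_line_group n) (G A) \<and>
         E_less (G A) (power_group circle_group n)) \<and>
    (\<forall>A B. A \<subseteq>\<^sup>* B \<longleftrightarrow> E_le (G A) (G B))"
proof -
  have le_iff: "E_le (solenoid n D) (solenoid n D') \<longleftrightarrow> D' \<subseteq>\<^sup>* D" for D D'
    using E_le_solenoid_imp_almost_subset[OF assms] E_le_solenoid_if_almost_subset[OF assms] by blast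
  have circle: "E_le (solenoid n D) (power_group circle_group n)" for D
  proof (rule E_le_trans)
    show "E_le (solenoid n D) (solenoid n {})" by (simp add: le_iff almost_subset_def)
  qed (rule E_le_solenoid_circle[OF assms])
  \<comment> \<open>The torus lies above the solenoid of the empty set, so a reduction would make
    \<open>prime_indices A\<close> almost contained in the empty set.\<close>
  have not_circle: "\<not> E_le (power_group circle_group n) (solenoid n (prime_indices A))" for A
  proof
    assume "E_le (power_group circle_group n) (solenoid n (prime_indices A))"
    from E_le_trans[OF circle this, of "{}"] have "finite (prime_indices A)"
      by (simp add: le_iff almost_subset_def)
    then show False using infinite_prime_indices by blast
  qed
  \<comment> \<open>The line power lies below the solenoid of all primes, so a reduction would make
    \<open>UNIV\<close> almost contained in \<open>prime_indices A\<close>.\<close>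
  have not_real: "\<not> E_le (solenoid n (prime_indices A)) (power_group real_line_group n)" for A
  proof
    assume "E_le (solenoid n (prime_indices A)) (power_group real_line_group n)"
    from E_le_trans[OF this E_le_real_solenoid[OF assms, of UNIV]] have "finite (- prime_indices A)"
      by (simp add: le_iff almost_subset_def Compl_eq_Diff_UNIV)
    then show False using coinfinite_prime_indices by blast
  qed
  have conn: "connected_space (top_of_set (solenoid_set n D))" for D
    using connected_solenoid_set[OF assms] by (metis connectedin_def connectedin_iff_connected)
  have comp: "compact_space (top_of_set (solenoid_set n D))" for D
    using compact_solenoid_set by (simp add: compact_space_subtopology)
  show ?thesis
    by (intro exI[of _ "\<lambda>A. solenoid n (prime_indices A)"])
       (simp add: E_less_def Polish_group_solenoid comm_group_solenoid has_covering_dim_solenoid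
          assms conn comp circle not_circle not_real E_le_real_solenoid le_iff prime_indices_almost_subset)
qed

end
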